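(* Let $(\zeta_i)_{i\ge 0}$ be i.i.d. random vectors with values in $\mathbb{Z}^2$ on a probability space $(\Omega,\mathbb{P})$, with $\mathbb{E}\zeta_0=0$, finite second moment, nonsingular covariance matrix $\Sigma$, and aperiodic (the subgroup of $\mathbb{Z}^2$ generated by $\{\underline{\ell}:\mathbb{P}(\zeta_0=\underline{\ell})>0\}$ is $\mathbb{Z}^2$). Let $Z_0=\underline 0$, $Z_n=\zeta_0+\dots+\zeta_{n-1}$. Let $(X_{\underline{\ell}})_{\underline{\ell}\in\mathbb{Z}^2}$ be a family of i.i.d. centered real random variables on a probability space $(E,\mu)$ with $\mathbb{E}(X_{\underline 0}^2)=1$. For $\omega\in\Omega$, $x\in E$, put $S_n^{\omega}(x)=\sum_{i=0}^{n-1}X_{Z_i(\omega)}(x)$. Then for $\mathbb{P}$-a.e. $\omega$, the process $$\Big(Y_n(\omega,x,t)\Big)_{t\in[0,1]}=\Big(\frac{S^{\omega}_{\lfloor nt\rfloor}(x)}{\sqrt{n\log n}}\Big)_{t\in[0,1]}$$ (considered as a process on $(E,\mu)$) satisfies a functional central limit theorem with asymptotic variance $\sigma^2=(\pi\sqrt{\det\Sigma})^{-1}$.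
   Context: "Satisfies a functional central limit theorem (FCLT) with asymptotic variance $\sigma^2$" means: as $n\to\infty$, the processes $t\mapsto Y_n(\omega,\cdot,t)$, viewed as random elements (under $\mu$) of the space $D[0,1]$ of right-continuous functions with left limits, converge in distribution to $\sigma W$, where $W$ is a standard Wiener process on $[0,1]$; equivalently, the finite-dimensional distributions converge to those of $\sigma W$ and the tightness condition $\forall\varepsilon>0$, $\lim_{\delta\to0}\limsup_n\mu(x:\sup_{|t'-t|\le\delta}|Y_n(\omega,x,t')-Y_n(\omega,x,t)|\ge\varepsilon)=0$ holds. *)

theory Defs
  imports "HOL-Probability.Probability"
begin

definition weak_conv_top :: "(nat \<Rightarrow> 'a::topological_space measure) \<Rightarrow> 'a measure \<Rightarrow> bool" where
  "weak_conv_top M M' \<longleftrightarrow>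
     (\<forall>g :: 'a \<Rightarrow> real. continuous_on UNIV g \<and> bounded (range g) \<longrightarrow>
        (\<lambda>n. \<integral>y. g y \<partial>M n) \<longlonglongrightarrow> (\<integral>y. g y \<partial>M'))"

text \<open>Law of the vector (c W(ts 0), ..., c W(ts (k-1))) for a standard Wiener process W and
  times 0 \<le> ts 0 \<le> ... \<le> ts (k-1) \<le> 1, realised via independent Gaussian increments;
  coordinates j \<ge> k are set to 0.\<close>
definition wiener_fdd :: "real \<Rightarrow> (nat \<Rightarrow> real) \<Rightarrow> nat \<Rightarrow> (nat \<Rightarrow> real) measure" where
  "wiener_fdd c ts k =
     distr (PiM {..<k} (\<lambda>_. density lborel std_normal_density)) borel
       (\<lambda>y j. if j < k then c * (\<Sum>i\<le>j. sqrt (ts i - (if i = 0 then 0 else ts (i - 1))) * y i) else 0)"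

definition proc_fdd :: "'e measure \<Rightarrow> ('e \<Rightarrow> real \<Rightarrow> real) \<Rightarrow> (nat \<Rightarrow> real) \<Rightarrow> nat \<Rightarrow> (nat \<Rightarrow> real) measure" where
  "proc_fdd \<mu> Y ts k = distr \<mu> borel (\<lambda>x j. if j < k then Y x (ts j) else 0)"

text \<open>Functional CLT with asymptotic variance c^2 (c \<ge> 0): convergence of finite-dimensional
  distributions to those of c W, plus the tightness (modulus of continuity) condition.\<close>
definition satisfies_FCLT :: "'e measure \<Rightarrow> (nat \<Rightarrow> 'e \<Rightarrow> real \<Rightarrow> real) \<Rightarrow> real \<Rightarrow> bool" where
  "satisfies_FCLT \<mu> Y c \<longleftrightarrow>
     (\<forall>k ts. (\<forall>j<k. 0 \<le> ts j \<and> ts j \<le> 1) \<and> (\<forall>i j. i \<le> j \<and> j < k \<longrightarrow> ts i \<le> ts j) \<longrightarrow>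
        weak_conv_top (\<lambda>n. proc_fdd \<mu> (Y n) ts k) (wiener_fdd c ts k)) \<and>
     (\<forall>\<epsilon>>0. ((\<lambda>\<delta>. limsup (\<lambda>n. emeasure \<mu>
          {x \<in> space \<mu>. (SUP p \<in> {(t, t'). t \<in> {0..1} \<and> t' \<in> {0..1} \<and> \<bar>t' - t\<bar> \<le> \<delta>}.
                ereal \<bar>Y n x (snd p) - Y n x (fst p)\<bar>) \<ge> ereal \<epsilon>}))
        \<longlongrightarrow> 0) (at_right 0))"

definition gen_subgroup :: "'a::ab_group_add set \<Rightarrow> 'a set" where
  "gen_subgroup S = \<Inter>{H. S \<subseteq> H \<and> 0 \<in> H \<and> (\<forall>a\<in>H. \<forall>b\<in>H. a - b \<in> H)}"

definition to_real2 :: "int ^ 2 \<Rightarrow> real ^ 2" where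
  "to_real2 v = (\<chi> i. real_of_int (v $ i))"

text \<open>Covariance matrix of a centered Z^2-valued random vector.\<close>
definition cov_matrix :: "'w measure \<Rightarrow> ('w \<Rightarrow> int ^ 2) \<Rightarrow> real ^ 2 ^ 2" where
  "cov_matrix P V = (\<chi> i j. prob_space.expectation P (\<lambda>\<omega>. to_real2 (V \<omega>) $ i * to_real2 (V \<omega>) $ j))"

end

(*
  Expanding a linear combination of the values of S as a weighted sum of the X_l, with weights given
  by the local times of the walk, the finite-dimensional distributions follow from a central limit
  theorem for weighted i.i.d. sums, once the number I_n of pairs (i, j) in [0,n)^2 with Z_i = Z_j
  satisfies I_n / (n log n) \<longrightarrow> C almost surely: by polarisation this also determines the mutual
  intersections of disjoint time blocks, which are asymptotically negligible.  Tightness rests on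
  the Newman-Wright maximal inequality: for a fixed walk, the partial sums and their running maxima are
  increasing functions of the independent scenery, hence positively associated, so the maximum over
  a time block is controlled by the endpoint, whose law is asymptotically Gaussian.

  For the strong law for I_n, a Fourier argument bounds P(Z_k = l) by K / (k + 1) uniformly in l.
  This gives Var I_n = O(n^2), hence almost sure convergence along a geometric subsequence, and
  monotonicity of I_n fills the gaps.  The mean only requires the Green function asymptotics
  sum_{k<n} P(Z_k = 0) ~ log n / (2 pi sqrt(det Sigma)).  It is obtained by comparing the walk with
  its continuous-time analogue of characteristic function exp(phi - 1): as
  |phi - exp(phi - 1)| = O(|1 - phi|^2), the difference of the two resolvents
  1 / (1 - r phi) and 1 / (1 - r exp(phi - 1)) is bounded uniformly in r < 1, and Tauber's argument
  transfers this to the partial sums; the return probabilities of the continuous-time walk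
  are asymptotic to 1 / (2 pi k sqrt(det Sigma)) by a rescaling of the Fourier integral.
*)
theory Submission
  imports Defs "HOL-Analysis.Infinite_Set_Sum" "HOL-Real_Asymp.Real_Asymp"
begin

section \<open>Positive association\<close>

text \<open>Three obstacles shape the proof. Aperiodicity as a statement on generated subgroups
  admits periodic walks, such as the nearest-neighbour one, with |\<phi>| = 1 at nonzero points of
  the torus; the return probabilities then oscillate and only their sums have an asymptotic law. But
  1 - Re \<phi> vanishes on the torus at 0 alone, so |exp(\<phi> - 1)| < 1 elsewhere: this is what
  passing to continuous time buys. The scenery has second moments only, and a second-moment bound
  over m blocks of length 1/m adds up to a constant. Tightness therefore tests the endpoint of a
  block with the bounded continuous function min 1 (x^4), passes to the Gaussian limit through the
  two-dimensional laws, and uses the Gaussian fourth moment, which is O(1/m^2) per block. The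
  central limit theorem also needs every single weight to be negligible. There is no separate
  estimate of the maximal local time: its smallness is deduced from the almost sure law for the
  self-intersections of time blocks. The constant of the theorem is twice that of the Green
  function, because intersections are counted as ordered pairs.\<close>

definition coord_mono :: "'i set \<Rightarrow> (('i \<Rightarrow> real) \<Rightarrow> real) \<Rightarrow> bool" where
  "coord_mono F f \<longleftrightarrow> (\<forall>x y. (\<forall>i\<in>F. x i \<le> y i) \<longrightarrow> f x \<le> f y)"

lemma coord_monoD: "coord_mono F f \<Longrightarrow> (\<And>i. i \<in> F \<Longrightarrow> x i \<le> y i) \<Longrightarrow> f x \<le> f y"
  by (auto simp: coord_mono_def)

text \<open>Two points that agree on \<open>F\<close> dominate each other there. So
  \<open>coord_mono F f\<close> forces \<open>f\<close> to ignore all other coordinates, and a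
  function of total families can stand for one on the product space over \<open>F\<close>.\<close>

lemma coord_mono_cong: "coord_mono F f \<Longrightarrow> (\<And>i. i \<in> F \<Longrightarrow> x i = y i) \<Longrightarrow> f x = f y"
  by (intro antisym) (auto simp: coord_mono_def)

lemma (in prob_space) integrable_bounded:
  fixes f :: "'a \<Rightarrow> real"
  assumes "f \<in> borel_measurable M" "\<And>x. \<bar>f x\<bar> \<le> B"
  shows "integrable M f"
  by (rule integrable_const_bound[where B=B]) (use assms in auto)

text \<open>The product of increments (u x - u y) (v x - v y) is nonnegative for monotone functions
  of one variable; integrated over two independent copies of \<open>M\<close> it is twice the
  covariance. This is the one-coordinate case of the Harris inequality.\<close>

lemma chebyshev_integral_inequality:
  fixes u v :: "real \<Rightarrow> real" and M :: "real measure"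
  assumes "prob_space M" and sets: "sets M = sets borel"
    and [measurable]: "u \<in> borel_measurable borel" "v \<in> borel_measurable borel"
    and "mono u" "mono v" and bu: "\<And>x. \<bar>u x\<bar> \<le> B" and bv: "\<And>x. \<bar>v x\<bar> \<le> B"
  shows "(\<integral>x. u x \<partial>M) * (\<integral>x. v x \<partial>M) \<le> (\<integral>x. u x * v x \<partial>M)"
proof -
  interpret prob_space M by fact
  have mu[measurable]: "u \<in> borel_measurable M" "v \<in> borel_measurable M"
    by (simp_all add: measurable_cong_sets[OF sets refl])
  have iu[simp]: "integrable M u" and iv[simp]: "integrable M v"
    by (rule integrable_bounded[OF _ bu] integrable_bounded[OF _ bv]; simp)+
  have iuv[simp]: "integrable M (\<lambda>x. u x * v x)"
    by (rule integrable_bounded[where B="B*B"]) (auto simp: abs_mult intro!: mult_mono bu bv order_trans[OF abs_ge_zero bu])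
  have inner: "(\<integral>y. (u x - u y) * (v x - v y) \<partial>M)
      = u x * v x - u x * (\<integral>y. v y \<partial>M) - v x * (\<integral>y. u y \<partial>M) + (\<integral>y. u y * v y \<partial>M)" for x
  proof -
    have "(\<integral>y. (u x - u y) * (v x - v y) \<partial>M) = (\<integral>y. u x * v x - u x * v y - v x * u y + u y * v y \<partial>M)"
      by (rule Bochner_Integration.integral_cong) (auto simp: algebra_simps)
    also have "\<dots> = u x * v x - u x * (\<integral>y. v y \<partial>M) - v x * (\<integral>y. u y \<partial>M) + (\<integral>y. u y * v y \<partial>M)"
      by (simp add: prob_space)
    finally show ?thesis .
  qed
  have "0 \<le> (u x - u y) * (v x - v y)" for x y
    using monoD[OF \<open>mono u\<close>, of x y] monoD[OF \<open>mono v\<close>, of x y]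
      monoD[OF \<open>mono u\<close>, of y x] monoD[OF \<open>mono v\<close>, of y x]
    by (cases "x \<le> y") (auto simp: zero_le_mult_iff)
  then have "0 \<le> (\<integral>x. (\<integral>y. (u x - u y) * (v x - v y) \<partial>M) \<partial>M)"
    by (intro integral_nonneg_AE AE_I2) auto
  also have "\<dots> = (\<integral>x. u x * v x - u x * (\<integral>y. v y \<partial>M) - v x * (\<integral>y. u y \<partial>M) + (\<integral>y. u y * v y \<partial>M) \<partial>M)"
    by (simp only: inner)
  also have "\<dots> = 2 * (\<integral>x. u x * v x \<partial>M) - 2 * ((\<integral>x. u x \<partial>M) * (\<integral>x. v x \<partial>M))"
    by (simp add: prob_space)
  finally show ?thesis by simp
qed

text \<open>Induction on the coordinates: with the others fixed, the one-variable inequality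
  compares the section integrals of f, g and f g. The section integrals of f and g are again
  monotone and bounded, so the induction hypothesis handles them, and Fubini reassembles both
  sides.\<close>

lemma harris_inequality:
  fixes \<nu> :: "'i \<Rightarrow> real measure"
  assumes "finite F" and \<nu>: "\<And>i. prob_space (\<nu> i)" "\<And>i. sets (\<nu> i) = sets borel"
    and "f \<in> borel_measurable (PiM F (\<lambda>_. borel))" "g \<in> borel_measurable (PiM F (\<lambda>_. borel))"
    and "coord_mono F f" "coord_mono F g" "\<And>x. \<bar>f x\<bar> \<le> B" "\<And>x. \<bar>g x\<bar> \<le> B"
  shows "(\<integral>x. f x \<partial>PiM F \<nu>) * (\<integral>x. g x \<partial>PiM F \<nu>) \<le> (\<integral>x. f x * g x \<partial>PiM F \<nu>)"
  using assms(1) assms(4-)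
proof (induction F arbitrary: f g rule: finite_induct)
  case empty
  interpret prob_space "PiM {} \<nu>" by (rule prob_space_PiM) (rule \<nu>)
  \<comment> \<open>The witness is an arbitrary point: over no coordinates, monotone functions are
    constant.\<close>
  obtain x0 :: "'i \<Rightarrow> real" where True by simp
  have "f = (\<lambda>_. f x0)" "g = (\<lambda>_. g x0)"
    using coord_mono_cong[OF empty(3)] coord_mono_cong[OF empty(4)] by auto
  then obtain a b where "f = (\<lambda>_. a)" "g = (\<lambda>_. b)" by blast
  then show ?case by (simp add: prob_space)
next
  case (insert i F)
  interpret P: product_sigma_finite \<nu>
    using \<nu>(1) by (auto simp: product_sigma_finite_def intro: prob_space_imp_sigma_finite)
  interpret PF: prob_space "PiM F \<nu>" by (rule prob_space_PiM) (rule \<nu>)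
  interpret PI: prob_space "PiM (insert i F) \<nu>" by (rule prob_space_PiM) (rule \<nu>)
  interpret Ni: prob_space "\<nu> i" by (rule \<nu>)
  have seq: "sets (PiM J \<nu>) = sets (PiM J (\<lambda>_. borel))" for J
    by (rule sets_PiM_cong) (auto simp: \<nu>)
  have B0: "0 \<le> B" using insert.prems(5) abs_ge_zero order_trans by blast
  define sec where "sec h x = (\<integral>y. h (x(i:=y)) \<partial>\<nu> i)" for h :: "('i \<Rightarrow> real) \<Rightarrow> real" and x
  have slice: "(\<lambda>y. h (x(i:=y))) \<in> borel_measurable borel"
    if h: "h \<in> borel_measurable (PiM (insert i F) (\<lambda>_. borel))" "coord_mono (insert i F) h" for h and x :: "'i \<Rightarrow> real"
  proof -
    \<comment> \<open>Points of the product space are undefined off the index set; restricting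
      \<open>x\<close> does not change \<open>h\<close> and makes the updated point one of
      them.\<close>
    have "(\<lambda>y. h (x(i:=y))) = (\<lambda>y. h ((restrict x F)(i:=y)))"
      by (intro ext coord_mono_cong[OF h(2)]) auto
    moreover have "(\<lambda>y. (restrict x F)(i:=y)) \<in> measurable borel (PiM (insert i F) (\<lambda>_. borel))"
      by (rule measurable_fun_upd[where J=F]) (auto simp: space_PiM)
    ultimately show ?thesis using h(1) by (metis measurable_compose)
  qed
  have meas: "sec h \<in> borel_measurable (PiM F (\<lambda>_. borel))"
    if h: "h \<in> borel_measurable (PiM (insert i F) (\<lambda>_. borel))" for h
  proof -
    have h': "h \<in> borel_measurable (PiM (insert i F) \<nu>)"
      using h measurable_cong_sets[OF seq refl] by blast
    have "(\<lambda>(x,y). h (x(i:=y))) \<in> borel_measurable (PiM F \<nu> \<Otimes>\<^sub>M \<nu> i)"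
      using measurable_compose[OF measurable_add_dim h'] by (simp add: case_prod_beta')
    then have "(\<lambda>x. \<integral>y. h (x(i:=y)) \<partial>\<nu> i) \<in> borel_measurable (PiM F \<nu>)"
      by (rule sigma_finite_measure.borel_measurable_lebesgue_integral[OF P.sigma_finite_measures])
    then show ?thesis using measurable_cong_sets[OF seq refl] unfolding sec_def by blast
  qed
  have int: "integrable (\<nu> i) (\<lambda>y. h (x(i:=y)))"
    if h: "h \<in> borel_measurable (PiM (insert i F) (\<lambda>_. borel))" "coord_mono (insert i F) h" "\<And>x. \<bar>h x\<bar> \<le> B" for h x
    by (rule Ni.integrable_bounded[OF _ h(3)]) (use slice[OF h(1,2)] measurable_cong_sets[OF \<nu>(2) refl] in blast)
  have mono: "coord_mono F (sec h)"
    if h: "h \<in> borel_measurable (PiM (insert i F) (\<lambda>_. borel))" "coord_mono (insert i F) h" "\<And>x. \<bar>h x\<bar> \<le> B" for h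
    unfolding coord_mono_def sec_def
    by (intro allI impI integral_mono int h) (rule coord_monoD[OF h(2)], auto)
  have bnd: "\<bar>sec h x\<bar> \<le> B"
    if h: "h \<in> borel_measurable (PiM (insert i F) (\<lambda>_. borel))" "coord_mono (insert i F) h" "\<And>x. \<bar>h x\<bar> \<le> B" for h x
  proof -
    have "\<bar>sec h x\<bar> \<le> (\<integral>y. \<bar>h (x(i:=y))\<bar> \<partial>\<nu> i)" unfolding sec_def by (rule integral_abs_bound)
    also have "\<dots> \<le> (\<integral>y. B \<partial>\<nu> i)"
      by (rule integral_mono) (use int[OF h] h(3) in auto)
    finally show ?thesis by (simp add: Ni.prob_space)
  qed
  have fub: "(\<integral>x. h x \<partial>PiM (insert i F) \<nu>) = (\<integral>x. sec h x \<partial>PiM F \<nu>)"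
    if h: "h \<in> borel_measurable (PiM (insert i F) (\<lambda>_. borel))" "\<And>x. \<bar>h x\<bar> \<le> C" for h C
  proof -
    have h': "h \<in> borel_measurable (PiM (insert i F) \<nu>)"
      using h measurable_cong_sets[OF seq refl] by blast
    show ?thesis unfolding sec_def
      by (rule P.product_integral_insert) (use insert PI.integrable_bounded[OF h' h(2)] in auto)
  qed
  note f = insert.prems(1,3,5) and g = insert.prems(2,4,6)
  have [measurable]: "f \<in> borel_measurable (PiM (insert i F) (\<lambda>_. borel))" "g \<in> borel_measurable (PiM (insert i F) (\<lambda>_. borel))"
    by fact+
  have fgb: "\<bar>f x * g x\<bar> \<le> B * B" for x
    by (auto simp: abs_mult intro!: mult_mono f g B0)
  have ptw: "sec f x * sec g x \<le> sec (\<lambda>x. f x * g x) x" for x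
    unfolding sec_def
    by (rule chebyshev_integral_inequality[OF \<nu>(1,2) slice[OF f(1,2)] slice[OF g(1,2)], where B=B])
       (auto intro!: monoI coord_monoD[OF f(2)] coord_monoD[OF g(2)] f g)
  have sm[measurable]: "sec f \<in> borel_measurable (PiM F \<nu>)" "sec g \<in> borel_measurable (PiM F \<nu>)"
    "sec (\<lambda>x. f x * g x) \<in> borel_measurable (PiM F \<nu>)"
    using meas[OF f(1)] meas[OF g(1)] meas[of "\<lambda>x. f x * g x"] measurable_cong_sets[OF seq refl]
    by auto
  have sb: "\<bar>sec (\<lambda>x. f x * g x) x\<bar> \<le> B * B" for x
  proof -
    have "integrable (\<nu> i) (\<lambda>y. f (x(i:=y)) * g (x(i:=y)))"
    proof (rule Ni.integrable_bounded[OF _ fgb])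
      have "(\<lambda>y. f (x(i:=y)) * g (x(i:=y))) \<in> borel_measurable borel"
        using slice[OF f(1,2)] slice[OF g(1,2)] by (rule borel_measurable_times)
      then show "(\<lambda>y. f (x(i:=y)) * g (x(i:=y))) \<in> borel_measurable (\<nu> i)"
        using measurable_cong_sets[OF \<nu>(2) refl] by blast
    qed
    then have "\<bar>sec (\<lambda>x. f x * g x) x\<bar> \<le> (\<integral>y. B*B \<partial>\<nu> i)" unfolding sec_def
      by (intro order_trans[OF integral_abs_bound] integral_mono) (use fgb in auto)
    then show ?thesis by (simp add: Ni.prob_space)
  qed
  have "(\<integral>x. f x \<partial>PiM (insert i F) \<nu>) * (\<integral>x. g x \<partial>PiM (insert i F) \<nu>)
     = (\<integral>x. sec f x \<partial>PiM F \<nu>) * (\<integral>x. sec g x \<partial>PiM F \<nu>)"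
    by (simp add: fub[OF f(1,3)] fub[OF g(1,3)])
  also have "\<dots> \<le> (\<integral>x. sec f x * sec g x \<partial>PiM F \<nu>)"
    by (rule insert.IH) (use meas f g mono bnd in auto)
  also have "\<dots> \<le> (\<integral>x. sec (\<lambda>x. f x * g x) x \<partial>PiM F \<nu>)"
  proof (rule integral_mono)
    show "integrable (PiM F \<nu>) (\<lambda>x. sec f x * sec g x)"
      by (rule PF.integrable_bounded[where B="B*B"]) (auto simp: abs_mult intro!: mult_mono bnd f g B0)
    show "integrable (PiM F \<nu>) (sec (\<lambda>x. f x * g x))"
      by (rule PF.integrable_bounded[OF _ sb]) auto
  qed (rule ptw)
  also have "\<dots> = (\<integral>x. f x * g x \<partial>PiM (insert i F) \<nu>)"
    by (rule fub[symmetric, OF _ fgb]) simp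
  finally show ?case .
qed

text \<open>The test functions are square integrable rather than bounded, because they will be
  partial sums and running maxima as well as indicators of events. The product of two of them is
  then integrable.\<close>

definition positively_associated :: "'e measure \<Rightarrow> 'i set \<Rightarrow> ('i \<Rightarrow> 'e \<Rightarrow> real) \<Rightarrow> bool" where
  "positively_associated M F \<xi> \<longleftrightarrow> (\<forall>f g.
     f \<in> borel_measurable (PiM F (\<lambda>_. borel)) \<and> g \<in> borel_measurable (PiM F (\<lambda>_. borel)) \<and>
     coord_mono F f \<and> coord_mono F g \<and>
     integrable M (\<lambda>x. (f (\<lambda>i. \<xi> i x))\<^sup>2) \<and> integrable M (\<lambda>x. (g (\<lambda>i. \<xi> i x))\<^sup>2) \<longrightarrow>
     (\<integral>x. f (\<lambda>i. \<xi> i x) \<partial>M) * (\<integral>x. g (\<lambda>i. \<xi> i x) \<partial>M)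
       \<le> (\<integral>x. f (\<lambda>i. \<xi> i x) * g (\<lambda>i. \<xi> i x) \<partial>M))"

lemma measurable_coord_mono_compose:
  assumes f: "f \<in> borel_measurable (PiM F (\<lambda>_. borel))" "coord_mono F f"
    and \<xi>: "\<And>i. i \<in> F \<Longrightarrow> \<xi> i \<in> borel_measurable M"
  shows "(\<lambda>x. f (\<lambda>i. \<xi> i x)) \<in> borel_measurable M"
proof -
  have "(\<lambda>x. f (\<lambda>i. \<xi> i x)) = (\<lambda>x. f (\<lambda>i\<in>F. \<xi> i x))"
    by (intro ext coord_mono_cong[OF f(2)]) auto
  moreover have "(\<lambda>x. \<lambda>i\<in>F. \<xi> i x) \<in> measurable M (PiM F (\<lambda>_. borel))"
    by (rule measurable_restrict) (rule \<xi>)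
  ultimately show ?thesis using f(1) by (metis measurable_compose)
qed

lemma integrable_mult_of_squares:
  fixes f g :: "'a \<Rightarrow> real"
  assumes [measurable]: "f \<in> borel_measurable M" "g \<in> borel_measurable M"
    and i: "integrable M (\<lambda>x. (f x)\<^sup>2)" "integrable M (\<lambda>x. (g x)\<^sup>2)"
  shows "integrable M (\<lambda>x. f x * g x)"
proof (rule Bochner_Integration.integrable_bound[OF Bochner_Integration.integrable_add[OF i]])
  have "\<bar>a * b\<bar> \<le> a\<^sup>2 + b\<^sup>2" for a b :: real
  proof -
    have "\<bar>a * b\<bar> \<le> 2 * \<bar>a * b\<bar>" by simp
    also have "\<dots> \<le> a\<^sup>2 + b\<^sup>2"
      using sum_squares_bound[of "\<bar>a\<bar>" "\<bar>b\<bar>"] by (simp add: abs_mult mult.assoc)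
    finally show ?thesis .
  qed
  then show "AE x in M. norm (f x * g x) \<le> norm ((f x)\<^sup>2 + (g x)\<^sup>2)"
    by (auto intro!: AE_I2)
qed simp

text \<open>The Harris inequality is for bounded functions. Clipping at level n preserves
  monotonicity and is dominated by |f|, |g| and, for the product, |f| |g|, so both sides pass to the
  limit.\<close>

lemma (in prob_space) indep_vars_positively_associated:
  assumes ind: "indep_vars (\<lambda>_. borel) \<xi> F" and F: "finite F" "F \<noteq> {}"
  shows "positively_associated M F \<xi>"
  unfolding positively_associated_def
proof (intro allI impI; elim conjE)
  fix f g :: "('b \<Rightarrow> real) \<Rightarrow> real"
  assume f: "f \<in> borel_measurable (PiM F (\<lambda>_. borel))" "coord_mono F f" "integrable M (\<lambda>x. (f (\<lambda>i. \<xi> i x))\<^sup>2)"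
    and g: "g \<in> borel_measurable (PiM F (\<lambda>_. borel))" "coord_mono F g" "integrable M (\<lambda>x. (g (\<lambda>i. \<xi> i x))\<^sup>2)"
  have \<xi>[measurable]: "i \<in> F \<Longrightarrow> \<xi> i \<in> borel_measurable M" for i
    using ind by (auto simp: indep_vars_def)
  let ?f = "\<lambda>x. f (\<lambda>i. \<xi> i x)" and ?g = "\<lambda>x. g (\<lambda>i. \<xi> i x)"
  have [measurable]: "?f \<in> borel_measurable M" "?g \<in> borel_measurable M"
    by (rule measurable_coord_mono_compose[OF f(1,2) \<xi>] measurable_coord_mono_compose[OF g(1,2) \<xi>]; assumption)+
  define cl where "cl n t = max (- real n) (min (real n) t)" for n :: nat and t :: real
  have clb: "\<bar>cl n t\<bar> \<le> real n" "\<bar>cl n t\<bar> \<le> \<bar>t\<bar>" for n t by (auto simp: cl_def)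
  have [measurable]: "cl n \<in> borel_measurable borel" for n
    unfolding cl_def by measurable
  have lim: "(\<lambda>n. cl n t) \<longlonglongrightarrow> t" for t
  proof (rule tendsto_eventually)
    show "\<forall>\<^sub>F n in sequentially. cl n t = t"
      using eventually_ge_at_top[of "nat \<lceil>\<bar>t\<bar>\<rceil>"] by eventually_elim (auto simp: cl_def nat_ceiling_le_eq)
  qed
  \<comment> \<open>\<open>harris_inequality\<close> wants a probability measure at every index; off
    \<open>F\<close> a point mass fills in.\<close>
  define \<nu> where "\<nu> i = (if i \<in> F then distr M borel (\<xi> i) else return borel 0)" for i
  have \<nu>: "prob_space (\<nu> i)" "sets (\<nu> i) = sets borel" for i
    by (auto simp: \<nu>_def intro!: prob_space_distr prob_space_return)
  have dist: "distr M (PiM F (\<lambda>_. borel)) (\<lambda>x. \<lambda>i\<in>F. \<xi> i x) = PiM F \<nu>"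
    using indep_vars_iff_distr_eq_PiM'[OF F(2) \<xi>, THEN iffD1, OF _ ind]
    by (auto simp: \<nu>_def intro!: PiM_cong)
  have tr: "(\<integral>x. h (\<lambda>i. \<xi> i x) \<partial>M) = (\<integral>y. h y \<partial>PiM F \<nu>)"
    if h: "h \<in> borel_measurable (PiM F (\<lambda>_. borel))" "\<And>x. h (\<lambda>i. \<xi> i x) = h (\<lambda>i\<in>F. \<xi> i x)" for h :: "('b \<Rightarrow> real) \<Rightarrow> real"
    unfolding dist[symmetric] h(2)
    by (rule integral_distr[symmetric, OF measurable_restrict[OF \<xi>] h(1)])
  have clm: "coord_mono F (\<lambda>y. cl n (h y))" if "coord_mono F h" for h n
    using that by (fastforce simp: coord_mono_def cl_def)
  have bdd: "(\<integral>x. cl n (?f x) \<partial>M) * (\<integral>x. cl n (?g x) \<partial>M) \<le> (\<integral>x. cl n (?f x) * cl n (?g x) \<partial>M)" for n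
  proof -
    note [measurable] = f(1) g(1)
    have e: "f (\<lambda>i. \<xi> i x) = f (\<lambda>i\<in>F. \<xi> i x)" "g (\<lambda>i. \<xi> i x) = g (\<lambda>i\<in>F. \<xi> i x)" for x
      by (rule coord_mono_cong[OF f(2)], simp, rule coord_mono_cong[OF g(2)], simp)
    have "(\<integral>x. cl n (?f x) \<partial>M) = (\<integral>y. cl n (f y) \<partial>PiM F \<nu>)"
      by (rule tr) (auto simp: e)
    moreover have "(\<integral>x. cl n (?g x) \<partial>M) = (\<integral>y. cl n (g y) \<partial>PiM F \<nu>)"
      by (rule tr) (auto simp: e)
    moreover have "(\<integral>x. cl n (?f x) * cl n (?g x) \<partial>M) = (\<integral>y. cl n (f y) * cl n (g y) \<partial>PiM F \<nu>)"
      by (rule tr) (auto simp: e)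
    ultimately show ?thesis
      using harris_inequality[OF F(1) \<nu>, of "\<lambda>y. cl n (f y)" "\<lambda>y. cl n (g y)" "real n"]
      by (simp add: clm f(2) g(2) clb(1))
  qed
  have [simp]: "integrable M ?f" "integrable M ?g"
    using f g by (auto intro!: square_integrable_imp_integrable)
  have l1: "(\<lambda>n. \<integral>x. cl n (?f x) \<partial>M) \<longlonglongrightarrow> (\<integral>x. ?f x \<partial>M)" "(\<lambda>n. \<integral>x. cl n (?g x) \<partial>M) \<longlonglongrightarrow> (\<integral>x. ?g x \<partial>M)"
    by (rule integral_dominated_convergence[where w="\<lambda>x. \<bar>?f x\<bar>"], auto intro!: lim clb AE_I2)
       (rule integral_dominated_convergence[where w="\<lambda>x. \<bar>?g x\<bar>"], auto intro!: lim clb AE_I2)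
  have "integrable M (\<lambda>x. ?f x * ?g x)"
    by (rule integrable_mult_of_squares) (use f g in auto)
  then have "integrable M (\<lambda>x. \<bar>?f x\<bar> * \<bar>?g x\<bar>)"
    unfolding abs_mult[symmetric] by (rule integrable_abs)
  then have l2: "(\<lambda>n. \<integral>x. cl n (?f x) * cl n (?g x) \<partial>M) \<longlonglongrightarrow> (\<integral>x. ?f x * ?g x \<partial>M)"
    by (intro integral_dominated_convergence[where w="\<lambda>x. \<bar>?f x\<bar> * \<bar>?g x\<bar>"])
       (auto intro!: AE_I2 tendsto_mult lim mult_mono clb simp: abs_mult)
  show "(\<integral>x. ?f x \<partial>M) * (\<integral>x. ?g x \<partial>M) \<le> (\<integral>x. ?f x * ?g x \<partial>M)"
    by (rule LIMSEQ_le[OF tendsto_mult[OF l1] l2]) (use bdd in auto)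
qed

section \<open>The Newman-Wright maximal inequality for sums along a path\<close>

fun max_prefix_sum :: "'i list \<Rightarrow> ('i \<Rightarrow> real) \<Rightarrow> real" where
  "max_prefix_sum [] y = 0"
| "max_prefix_sum (z # zs) y = max 0 (y z + max_prefix_sum zs y)"

abbreviation path_sum :: "'i list \<Rightarrow> ('i \<Rightarrow> real) \<Rightarrow> real" where
  "path_sum zs y \<equiv> sum_list (map y zs)"

text \<open>The defining recursion peels off the first step, which suits the monotonicity proofs;
  the moment induction appends a last step. The empty prefix counts, so the maximum is never
  negative.\<close>

lemma max_prefix_sum_snoc:
  "max_prefix_sum (zs @ [z]) y = max (max_prefix_sum zs y) (path_sum zs y + y z)"
  by (induction zs) auto

lemma path_sum_take_le_max_prefix_sum: "path_sum (take k zs) y \<le> max_prefix_sum zs y"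
proof (induction zs arbitrary: k)
  case (Cons z zs)
  then show ?case by (cases k) (auto simp: le_max_iff_disj)
qed simp

lemma coord_mono_path_sum: "set zs \<subseteq> F \<Longrightarrow> coord_mono F (path_sum zs)"
  by (auto simp: coord_mono_def intro!: sum_list_mono)

lemma coord_mono_max_prefix_sum: "set zs \<subseteq> F \<Longrightarrow> coord_mono F (max_prefix_sum zs)"
proof (induction zs)
  case (Cons z zs)
  then have IH: "coord_mono F (max_prefix_sum zs)" by auto
  show ?case unfolding coord_mono_def
  proof (intro allI impI)
    fix x y :: "'a \<Rightarrow> real" assume "\<forall>i\<in>F. x i \<le> y i"
    then show "max_prefix_sum (z # zs) x \<le> max_prefix_sum (z # zs) y"
      using coord_monoD[OF IH, of x y] Cons.prems by (auto intro!: max.mono add_mono)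
  qed
qed (simp add: coord_mono_def)

text \<open>The difference is the minimal suffix sum.\<close>
lemma coord_mono_path_sum_minus_max:
  "set zs \<subseteq> F \<Longrightarrow> coord_mono F (\<lambda>y. path_sum zs y - max_prefix_sum zs y)"
proof (induction zs)
  case (Cons z zs)
  then have IH: "coord_mono F (\<lambda>y. path_sum zs y - max_prefix_sum zs y)" by auto
  have eq: "path_sum (z # zs) y - max_prefix_sum (z # zs) y
      = min (path_sum (z # zs) y) (path_sum zs y - max_prefix_sum zs y)" for y :: "'a \<Rightarrow> real"
    by auto
  show ?case unfolding eq coord_mono_def
    by (intro allI impI min.mono coord_monoD[OF IH] coord_monoD[OF coord_mono_path_sum[OF Cons.prems]]) auto
qed (simp add: coord_mono_def)

lemma measurable_path_sum[measurable]:
  "set zs \<subseteq> F \<Longrightarrow> path_sum zs \<in> borel_measurable (PiM F (\<lambda>_. borel))"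
  by (induction zs) (auto intro!: borel_measurable_add)

lemma measurable_max_prefix_sum[measurable]:
  "set zs \<subseteq> F \<Longrightarrow> max_prefix_sum zs \<in> borel_measurable (PiM F (\<lambda>_. borel))"
proof (induction zs)
  case Nil
  have "max_prefix_sum [] = (\<lambda>_. 0)" by auto
  then show ?case by simp
next
  case (Cons z zs)
  have "max_prefix_sum (z # zs) = (\<lambda>y. max 0 (y z + max_prefix_sum zs y))" by auto
  with Cons show ?case by simp
qed

text \<open>The argument uses association and second moments alone, so that the locale can be
  entered twice, with \<xi> and with -\<xi>. A path may revisit a site: its successive steps are
  dependent even when the family is independent.\<close>

locale associated_family = prob_space M for M :: "'e measure" +
  fixes F :: "'i set" and \<xi> :: "'i \<Rightarrow> 'e \<Rightarrow> real"
  assumes assoc: "positively_associated M F \<xi>"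
    and meas[measurable]: "\<And>i. i \<in> F \<Longrightarrow> \<xi> i \<in> borel_measurable M"
    and L2: "\<And>i. i \<in> F \<Longrightarrow> integrable M (\<lambda>x. (\<xi> i x)\<^sup>2)"
    and centered: "\<And>i. i \<in> F \<Longrightarrow> expectation (\<xi> i) = 0"
begin

abbreviation S :: "'i list \<Rightarrow> 'e \<Rightarrow> real" where "S zs x \<equiv> path_sum zs (\<lambda>i. \<xi> i x)"
abbreviation J :: "'i list \<Rightarrow> 'e \<Rightarrow> real" where "J zs x \<equiv> max_prefix_sum zs (\<lambda>i. \<xi> i x)"

lemma S_meas[measurable]: "set zs \<subseteq> F \<Longrightarrow> S zs \<in> borel_measurable M"
  by (rule measurable_coord_mono_compose[OF measurable_path_sum coord_mono_path_sum meas])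

lemma J_meas[measurable]: "set zs \<subseteq> F \<Longrightarrow> J zs \<in> borel_measurable M"
  by (rule measurable_coord_mono_compose[OF measurable_max_prefix_sum coord_mono_max_prefix_sum meas])

lemma square_integrable_add:
  assumes [measurable]: "f \<in> borel_measurable M" "g \<in> borel_measurable M"
    and i: "integrable M (\<lambda>x. (f x)\<^sup>2)" "integrable M (\<lambda>x. (g x :: real)\<^sup>2)"
  shows "integrable M (\<lambda>x. (f x + g x)\<^sup>2)"
  unfolding power2_sum
  using integrable_mult_of_squares[OF assms] i by (auto simp: mult.assoc)

lemma S_L2: "set zs \<subseteq> F \<Longrightarrow> integrable M (\<lambda>x. (S zs x)\<^sup>2)"
  by (induction zs) (auto intro!: square_integrable_add L2)

lemma J_L2: "set zs \<subseteq> F \<Longrightarrow> integrable M (\<lambda>x. (J zs x)\<^sup>2)"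
proof (induction zs)
  case (Cons z zs)
  have 1: "integrable M (\<lambda>x. (\<xi> z x + J zs x)\<^sup>2)"
    by (rule square_integrable_add) (use Cons in \<open>auto intro!: L2\<close>)
  show ?case
    by (rule Bochner_Integration.integrable_bound[OF 1])
       (use Cons.prems in \<open>auto intro!: AE_I2 J_meas[of "z # zs", simplified] abs_le_square_iff[THEN iffD1]\<close>)
qed simp

lemma SJ_L2: "set zs \<subseteq> F \<Longrightarrow> integrable M (\<lambda>x. (S zs x - J zs x)\<^sup>2)"
  using square_integrable_add[of "S zs" "\<lambda>x. - J zs x"] S_L2 J_L2 by simp

text \<open>In the association inequality for the coordinate \<open>z\<close> and \<open>h\<close>,
  the product of expectations vanishes because \<open>\<xi> z\<close> is centered.\<close>

lemma mean_mult_nonneg: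
  assumes z: "z \<in> F" and h: "h \<in> borel_measurable (PiM F (\<lambda>_. borel))" "coord_mono F h"
    and "integrable M (\<lambda>x. (h (\<lambda>i. \<xi> i x))\<^sup>2)"
  shows "0 \<le> expectation (\<lambda>x. \<xi> z x * h (\<lambda>i. \<xi> i x))"
proof -
  have "coord_mono F (\<lambda>y. y z)" "(\<lambda>y. y z) \<in> borel_measurable (PiM F (\<lambda>_. borel))"
    using z by (auto simp: coord_mono_def)
  from assoc[unfolded positively_associated_def, rule_format, of "\<lambda>y. y z" h] this assms
  show ?thesis by (simp add: centered L2)
qed

text \<open>Appending \<open>z\<close> turns S - J into min 0 (\<xi> z + S - J), whose square is at
  most that of \<xi> z + S - J. In the expansion, E (\<xi> z (S - J)) is at most E (\<xi> z S),
  because J is increasing and hence E (\<xi> z J) is nonnegative.\<close>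

lemma second_moment_sum_minus_max_le:
  "set zs \<subseteq> F \<Longrightarrow> expectation (\<lambda>x. (S zs x - J zs x)\<^sup>2) \<le> expectation (\<lambda>x. (S zs x)\<^sup>2)"
proof (induction zs rule: rev_induct)
  case (snoc z zs)
  then have z[simp]: "z \<in> F" and zs[simp]: "set zs \<subseteq> F" by auto
  note [intro] = subsetD[OF zs]
  note [simp] = L2[OF z] S_L2[OF zs] J_L2[OF zs] SJ_L2[OF zs]
  have [simp]: "integrable M (\<lambda>x. \<xi> z x * J zs x)" "integrable M (\<lambda>x. \<xi> z x * S zs x)"
    by (auto intro!: integrable_mult_of_squares)
  then have [simp]: "integrable M (\<lambda>x. \<xi> z x * (S zs x - J zs x))"
    by (simp add: right_diff_distrib)
  have "0 \<le> expectation (\<lambda>x. \<xi> z x * J zs x)"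
    by (rule mean_mult_nonneg) (auto intro!: coord_mono_max_prefix_sum)
  then have c: "expectation (\<lambda>x. \<xi> z x * (S zs x - J zs x)) \<le> expectation (\<lambda>x. \<xi> z x * S zs x)"
    by (simp add: right_diff_distrib)
  have "expectation (\<lambda>x. (S (zs @ [z]) x - J (zs @ [z]) x)\<^sup>2) \<le> expectation (\<lambda>x. (\<xi> z x + (S zs x - J zs x))\<^sup>2)"
    by (rule integral_mono[OF SJ_L2[OF snoc.prems] square_integrable_add])
       (auto intro!: abs_le_square_iff[THEN iffD1] simp: max_prefix_sum_snoc)
  also have "\<dots> = expectation (\<lambda>x. (\<xi> z x)\<^sup>2) + expectation (\<lambda>x. (S zs x - J zs x)\<^sup>2) + 2 * expectation (\<lambda>x. \<xi> z x * (S zs x - J zs x))"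
    unfolding power2_sum mult.assoc by simp
  also have "\<dots> \<le> expectation (\<lambda>x. (\<xi> z x)\<^sup>2) + expectation (\<lambda>x. (S zs x)\<^sup>2) + 2 * expectation (\<lambda>x. \<xi> z x * S zs x)"
    using c snoc.IH by simp
  also have "\<dots> = expectation (\<lambda>x. (S (zs @ [z]) x)\<^sup>2)"
    by (simp add: power2_sum mult.assoc algebra_simps)
  finally show ?case .
qed simp

text \<open>{J >= b} and {S - J > -c} are increasing events, so {J >= b} meets the complement of the
  second one with at most the probability that independence would give. For c = sqrt 2 * s this
  complement has probability at most s^2 / c^2 = 1/2, and off it J >= b implies S >= b - c. Half of
  P(J >= b) is absorbed on the left, whence the factor 2.\<close>

lemma newman_wright_one_sided:
  assumes zs: "set zs \<subseteq> F" and s: "s > 0" "expectation (\<lambda>x. (S zs x)\<^sup>2) \<le> s\<^sup>2"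
  shows "prob {x \<in> space M. J zs x \<ge> b} \<le> 2 * prob {x \<in> space M. S zs x \<ge> b - sqrt 2 * s}"
proof -
  note [measurable] = S_meas[OF zs] J_meas[OF zs]
  let ?c = "sqrt 2 * s"
  let ?A = "{x \<in> space M. J zs x \<ge> b}" and ?B = "{x \<in> space M. S zs x - J zs x > - ?c}"
  let ?D = "{x \<in> space M. S zs x - J zs x \<le> - ?c}"
  define f where "f y = (if max_prefix_sum zs y \<ge> b then 1 else 0::real)" for y :: "'i \<Rightarrow> real"
  define g where "g y = (if path_sum zs y - max_prefix_sum zs y > - ?c then 1 else 0::real)" for y :: "'i \<Rightarrow> real"
  note [measurable] = measurable_path_sum[OF zs] measurable_max_prefix_sum[OF zs]
  have fg[measurable]: "f \<in> borel_measurable (PiM F (\<lambda>_. borel))" "g \<in> borel_measurable (PiM F (\<lambda>_. borel))"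
    unfolding f_def g_def by measurable
  have m: "coord_mono F f" "coord_mono F g"
    using coord_mono_max_prefix_sum[OF zs] coord_mono_path_sum_minus_max[OF zs]
    by (auto simp: coord_mono_def f_def g_def intro: order_trans less_le_trans)
  have fi: "f (\<lambda>i. \<xi> i x) = indicator ?A x" "g (\<lambda>i. \<xi> i x) = indicator ?B x" if "x \<in> space M" for x
    using that by (auto simp: f_def g_def)
  have i: "expectation (\<lambda>x. f (\<lambda>i. \<xi> i x)) = prob ?A" "expectation (\<lambda>x. g (\<lambda>i. \<xi> i x)) = prob ?B"
    "expectation (\<lambda>x. f (\<lambda>i. \<xi> i x) * g (\<lambda>i. \<xi> i x)) = prob (?A \<inter> ?B)"
    by (subst Bochner_Integration.integral_cong[OF refl, of M _ "indicator ?A"], simp add: fi, simp,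
        subst Bochner_Integration.integral_cong[OF refl, of M _ "indicator ?B"], simp add: fi, simp,
        subst Bochner_Integration.integral_cong[OF refl, of M _ "indicator (?A \<inter> ?B)"], simp add: fi indicator_inter_arith, simp)
  have f1: "prob ?A * prob ?B \<le> prob (?A \<inter> ?B)"
    unfolding i[symmetric]
  proof (rule assoc[unfolded positively_associated_def, rule_format], intro conjI fg m)
    have "(\<lambda>x. f (\<lambda>i. \<xi> i x)) \<in> borel_measurable M" "(\<lambda>x. g (\<lambda>i. \<xi> i x)) \<in> borel_measurable M"
      by (rule measurable_coord_mono_compose[OF fg(1) m(1) meas] measurable_coord_mono_compose[OF fg(2) m(2) meas]; assumption)+
    from this[THEN borel_measurable_power, of 2] show "integrable M (\<lambda>x. (f (\<lambda>i. \<xi> i x))\<^sup>2)" "integrable M (\<lambda>x. (g (\<lambda>i. \<xi> i x))\<^sup>2)"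
      by (auto intro!: integrable_bounded[where B=1] simp: f_def g_def)
  qed
  have f2: "prob ?B = 1 - prob ?D"
  proof -
    have "?B = space M - ?D" by auto
    then show ?thesis by (simp add: prob_compl)
  qed
  have f3: "prob ?A = prob (?A \<inter> ?B) + prob (?A \<inter> ?D)"
    by (subst finite_measure_Union[symmetric]) (auto intro!: arg_cong[where f=prob])
  have 1: "prob (?A \<inter> ?D) \<le> prob ?A * prob ?D"
    using f1 f3 unfolding f2 right_diff_distrib by linarith
  have "prob ?D \<le> prob {x \<in> space M. \<bar>S zs x - J zs x\<bar> \<ge> ?c}"
    by (rule finite_measure_mono) auto
  also have "\<dots> \<le> expectation (\<lambda>x. (S zs x - J zs x)\<^sup>2) / ?c\<^sup>2"
    by (rule second_moment_method) (use s SJ_L2[OF zs] in auto)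
  also have "\<dots> \<le> s\<^sup>2 / ?c\<^sup>2"
    by (rule divide_right_mono[OF order_trans[OF second_moment_sum_minus_max_le[OF zs] s(2)]]) simp
  also have "\<dots> = 1/2" using s by (simp add: power_mult_distrib)
  finally have "prob (?A \<inter> ?D) \<le> prob ?A * (1/2)"
    using 1 mult_left_mono[of "prob ?D" "1/2" "prob ?A"] by simp
  moreover have "prob ?A \<le> prob ({x \<in> space M. S zs x \<ge> b - ?c} \<union> (?A \<inter> ?D))"
    by (rule finite_measure_mono) auto
  then have "prob ?A \<le> prob {x \<in> space M. S zs x \<ge> b - ?c} + prob (?A \<inter> ?D)"
    by (rule order_trans) (rule measure_Un_le, auto)
  ultimately show ?thesis by simp
qed

end

text \<open>The one-sided bound is used for \<xi> and for -\<xi>, with a factor 2 each; the family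
  -\<xi> is again independent and therefore associated.\<close>

theorem (in prob_space) newman_wright_inequality:
  assumes ind: "indep_vars (\<lambda>_. borel) \<xi> (set zs)"
    and L2: "\<And>i. i \<in> set zs \<Longrightarrow> integrable M (\<lambda>x. (\<xi> i x)\<^sup>2)"
    and mean: "\<And>i. i \<in> set zs \<Longrightarrow> expectation (\<xi> i) = 0"
    and s: "s > 0" "expectation (\<lambda>x. (path_sum zs (\<lambda>i. \<xi> i x))\<^sup>2) \<le> s\<^sup>2" and b: "b > sqrt 2 * s"
  shows "prob {x \<in> space M. \<exists>k. \<bar>path_sum (take k zs) (\<lambda>i. \<xi> i x)\<bar> \<ge> b}
       \<le> 4 * prob {x \<in> space M. \<bar>path_sum zs (\<lambda>i. \<xi> i x)\<bar> \<ge> b - sqrt 2 * s}"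
proof (cases "zs = []")
  case True
  have "0 < sqrt 2 * s" using s by simp
  with b have "0 < b" by linarith
  with True show ?thesis by simp
next
  case False
  have \<xi>[measurable]: "i \<in> set zs \<Longrightarrow> \<xi> i \<in> borel_measurable M" for i
    using ind by (auto simp: indep_vars_def)
  have ind': "indep_vars (\<lambda>_. borel) (\<lambda>i x. - \<xi> i x) (set zs)"
    by (rule indep_vars_compose2[OF ind]) auto
  interpret A: associated_family M "set zs" \<xi>
    by standard (use assms False in \<open>auto intro!: indep_vars_positively_associated\<close>)
  interpret B: associated_family M "set zs" "\<lambda>i x. - \<xi> i x"
    by standard (use assms ind' False in \<open>auto intro!: indep_vars_positively_associated\<close>)
  have neg: "path_sum ws (\<lambda>i. - \<xi> i x) = - path_sum ws (\<lambda>i. \<xi> i x)" for ws x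
    by (induction ws) auto
  note [measurable] = A.S_meas[OF order_refl] A.J_meas[OF order_refl] B.J_meas[OF order_refl]
  have "prob {x \<in> space M. \<exists>k. \<bar>path_sum (take k zs) (\<lambda>i. \<xi> i x)\<bar> \<ge> b}
      \<le> prob ({x \<in> space M. A.J zs x \<ge> b} \<union> {x \<in> space M. B.J zs x \<ge> b})"
  proof (rule finite_measure_mono, safe)
    fix x k assume *: "\<bar>path_sum (take k zs) (\<lambda>i. \<xi> i x)\<bar> \<ge> b" "\<not> B.J zs x \<ge> b"
    then show "A.J zs x \<ge> b"
      using path_sum_take_le_max_prefix_sum[where k=k and zs=zs and y="\<lambda>i. \<xi> i x"]
        path_sum_take_le_max_prefix_sum[where k=k and zs=zs and y="\<lambda>i. - \<xi> i x"]
      by (auto simp: neg)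
  qed auto
  also have "\<dots> \<le> prob {x \<in> space M. A.J zs x \<ge> b} + prob {x \<in> space M. B.J zs x \<ge> b}"
    by (rule measure_Un_le) auto
  also have "\<dots> \<le> 2 * prob {x \<in> space M. \<bar>A.S zs x\<bar> \<ge> b - sqrt 2 * s} + 2 * prob {x \<in> space M. \<bar>A.S zs x\<bar> \<ge> b - sqrt 2 * s}"
  proof (rule add_mono)
    show "prob {x \<in> space M. A.J zs x \<ge> b} \<le> 2 * prob {x \<in> space M. \<bar>A.S zs x\<bar> \<ge> b - sqrt 2 * s}"
      by (rule order_trans[OF A.newman_wright_one_sided[OF order_refl s]])
         (auto intro!: mult_left_mono finite_measure_mono)
    show "prob {x \<in> space M. B.J zs x \<ge> b} \<le> 2 * prob {x \<in> space M. \<bar>A.S zs x\<bar> \<ge> b - sqrt 2 * s}"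
      by (rule order_trans[OF B.newman_wright_one_sided[OF order_refl s(1)]])
         (use s(2) in \<open>auto intro!: mult_left_mono finite_measure_mono simp: neg\<close>)
  qed
  finally show ?thesis by simp
qed

section \<open>Weak convergence of finite-dimensional distributions\<close>

text \<open>The span of the characters of the first \<open>k\<close> coordinates. Convergence of
  characteristic functions extends to it by linearity, and its closure under products makes it the
  source of a Stone-Weierstrass algebra.\<close>

inductive_set trig_functions :: "nat \<Rightarrow> ((nat \<Rightarrow> real) \<Rightarrow> complex) set" for k where
  trig_exp: "(\<lambda>y. a * iexp (\<Sum>j<k. u j * y j)) \<in> trig_functions k"
| trig_add: "f \<in> trig_functions k \<Longrightarrow> g \<in> trig_functions k \<Longrightarrow> (\<lambda>y. f y + g y) \<in> trig_functions k"

lemma trig_functions_const: "(\<lambda>y. a) \<in> trig_functions k"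
  using trig_exp[of a "\<lambda>_. 0" k] by simp

lemma trig_functions_mult_exp:
  assumes "f \<in> trig_functions k"
  shows "(\<lambda>y. f y * (a * iexp (\<Sum>j<k. u j * y j))) \<in> trig_functions k"
  using assms
proof induction
  case (trig_exp b v)
  have "(\<lambda>y. b * iexp (\<Sum>j<k. v j * y j) * (a * iexp (\<Sum>j<k. u j * y j)))
      = (\<lambda>y. (b * a) * iexp (\<Sum>j<k. (v j + u j) * y j))"
    by (simp add: exp_add[symmetric] distrib_left distrib_right sum.distrib fun_eq_iff)
  then show ?case by (simp only: trig_functions.trig_exp)
next
  case (trig_add f g)
  then show ?case using trig_functions.trig_add by (simp add: distrib_right)
qed

lemma trig_functions_mult:
  assumes "f \<in> trig_functions k" "g \<in> trig_functions k"
  shows "(\<lambda>y. f y * g y) \<in> trig_functions k"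
  using assms(2)
proof induction
  case (trig_exp a u)
  show ?case by (rule trig_functions_mult_exp[OF assms(1)])
next
  case (trig_add g h)
  then show ?case using trig_functions.trig_add by (simp add: distrib_left)
qed

text \<open>Sines of single coordinates are what will separate points.\<close>

lemma trig_functions_sin:
  assumes "j < k" shows "(\<lambda>y. complex_of_real (sin (c * y j))) \<in> trig_functions k"
proof -
  have eq: "(\<Sum>i<k. (if i = j then d else 0) * y i) = d * y j" for d and y :: "nat \<Rightarrow> real"
    using assms by (simp add: sum.delta' if_distrib[of "\<lambda>x. x * _"] cong: if_cong)
  have "(\<lambda>y. (1 / (2 * \<i>)) * iexp (\<Sum>i<k. (if i = j then c else 0) * y i)
      + (- 1 / (2 * \<i>)) * iexp (\<Sum>i<k. (if i = j then - c else 0) * y i)) \<in> trig_functions k"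
    by (intro trig_add trig_exp)
  also have "(\<lambda>y. (1 / (2 * \<i>)) * iexp (\<Sum>i<k. (if i = j then c else 0) * y i)
      + (- 1 / (2 * \<i>)) * iexp (\<Sum>i<k. (if i = j then - c else 0) * y i))
      = (\<lambda>y. complex_of_real (sin (c * y j)))"
    unfolding eq by (auto simp: fun_eq_iff sin_of_real[symmetric] sin_exp_eq field_simps)
  finally show ?thesis .
qed

lemma trig_functions_continuous: "f \<in> trig_functions k \<Longrightarrow> continuous_on UNIV f"
  by (induction rule: trig_functions.induct) (auto intro!: continuous_intros)

lemma trig_functions_bounded: "f \<in> trig_functions k \<Longrightarrow> \<exists>B. \<forall>y. norm (f y) \<le> B"
proof (induction rule: trig_functions.induct)
  case (trig_exp a u)
  then show ?case by (intro exI[of _ "norm a"]) (simp add: norm_mult)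
next
  case (trig_add f g)
  then obtain B C where "\<And>y. norm (f y) \<le> B" "\<And>y. norm (g y) \<le> C" by auto
  then have "\<forall>y. norm (f y + g y) \<le> B + C" by (auto intro: norm_triangle_mono)
  then show ?case ..
qed

lemma trig_functions_integrable:
  fixes M :: "(nat \<Rightarrow> real) measure"
  assumes "f \<in> trig_functions k" "prob_space M" "sets M = sets borel"
  shows "integrable M f"
proof -
  interpret prob_space M by fact
  obtain B where B: "\<And>y. norm (f y) \<le> B" using trig_functions_bounded[OF assms(1)] by auto
  have "f \<in> borel_measurable M"
    using borel_measurable_continuous_onI[OF trig_functions_continuous[OF assms(1)]]
    by (simp add: measurable_cong_sets[OF assms(3) refl])
  then show ?thesis by (intro integrable_const_bound[where B=B]) (use B in auto)
qed

text \<open>The Levy continuity theorem by way of Stone-Weierstrass. Taking sines of the scaled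
  coordinates maps everything into a compact cube, and on the box |y j| <= b this map is inverted by
  a continuous function. So \<open>g\<close> agrees on the box with a continuous function on the
  cube, which is a uniform limit of functions that pull back to trigonometric sums; tightness pays
  for the complement of the box.\<close>

lemma weak_conv_top_iexpI:
  fixes Mn :: "nat \<Rightarrow> (nat \<Rightarrow> real) measure" and M :: "(nat \<Rightarrow> real) measure"
  assumes pn: "\<And>n. prob_space (Mn n)" "\<And>n. sets (Mn n) = sets borel"
    and p: "prob_space M" "sets M = sets borel"
    and zn: "\<And>n. AE y in Mn n. \<forall>j\<ge>k. y j = 0" and z: "AE y in M. \<forall>j\<ge>k. y j = 0"
    and tight: "\<And>e::real. e > 0 \<Longrightarrow> \<exists>b>0. (\<forall>n. measure (Mn n) {y. \<exists>j<k. \<bar>y j\<bar> > b} \<le> e)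
        \<and> measure M {y. \<exists>j<k. \<bar>y j\<bar> > b} \<le> e"
    and conv: "\<And>u. (\<lambda>n. \<integral>y. iexp (\<Sum>j<k. u j * y j) \<partial>Mn n) \<longlonglongrightarrow> (\<integral>y. iexp (\<Sum>j<k. u j * y j) \<partial>M)"
  shows "weak_conv_top Mn M"
  unfolding weak_conv_top_def
proof (intro allI impI; elim conjE)
  fix g :: "(nat \<Rightarrow> real) \<Rightarrow> real"
  assume g: "continuous_on UNIV g" and "bounded (range g)"
  then obtain G where G: "\<And>y. \<bar>g y\<bar> \<le> G" by (auto simp: bounded_iff)
  have G0: "0 \<le> G" using G[of undefined] by linarith
  have trig_conv: "(\<lambda>n. \<integral>y. f y \<partial>Mn n) \<longlonglongrightarrow> (\<integral>y. f y \<partial>M)" if "f \<in> trig_functions k" for f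
    using that
  proof induction
    case (trig_exp a u)
    show ?case unfolding integral_mult_right_zero by (intro tendsto_mult tendsto_const conv)
  next
    case (trig_add f g)
    then show ?case
      using trig_functions_integrable[OF _ pn] trig_functions_integrable[OF _ p]
      by (simp add: tendsto_add)
  qed
  have gm: "g \<in> borel_measurable borel" by (rule borel_measurable_continuous_onI[OF g])
  show "(\<lambda>n. \<integral>y. g y \<partial>Mn n) \<longlonglongrightarrow> (\<integral>y. g y \<partial>M)"
  proof (rule LIMSEQ_I)
    fix r :: real assume "r > 0"
    define e where "e = r / (3 + 4 * G)"
    have e: "e > 0" using \<open>r > 0\<close> G0 by (simp add: e_def)
    obtain b where b: "b > 0" "\<And>n. measure (Mn n) {y. \<exists>j<k. \<bar>y j\<bar> > b} \<le> e"
        "measure M {y. \<exists>j<k. \<bar>y j\<bar> > b} \<le> e"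
      using tight[OF e] by blast
    \<comment> \<open>Makes c b = pi / 2, so that arcsin inverts the sine on the whole box.\<close>
    define c where "c = pi / (2 * b)"
    have c: "c > 0" "c * b = pi / 2" using b(1) by (auto simp: c_def)
    define S where "S = {z :: nat \<Rightarrow> real. \<forall>j. z j \<in> (if j < k then {-1..1} else {0})}"
    define \<psi> where "\<psi> z j = (if j < k then arcsin (max (-1) (min 1 (z j))) / c else 0)" for z :: "nat \<Rightarrow> real" and j
    define si where "si y j = (if j < k then sin (c * y j) else 0)" for y :: "nat \<Rightarrow> real" and j
    \<comment> \<open>The algebra for Stone-Weierstrass: continuous functions on the cube whose
      pullback under \<open>si\<close> is trigonometric. The first \<open>k\<close> coordinates
      belong to it, since they pull back to sines.\<close>
    define R where "R = {f :: (nat \<Rightarrow> real) \<Rightarrow> real. continuous_on S f \<and> (\<lambda>y. complex_of_real (f (si y))) \<in> trig_functions k}"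
    have "S = PiE UNIV (\<lambda>j. if j < k then {-1..1} else {0})"
      by (auto simp: S_def PiE_def Pi_def)
    then have "compactin (product_topology (\<lambda>_. euclidean) UNIV) S"
      by (auto simp: compactin_PiE)
    then have cS: "compact S" by (simp add: euclidean_product_topology)
    have si_S: "si y \<in> S" for y by (auto simp: si_def S_def)
    interpret fr: function_ring_on R S
    proof
      show "compact S" by (rule cS)
      show "\<exists>f\<in>R. f x \<noteq> f y" if xy: "x \<in> S" "y \<in> S" "x \<noteq> y" for x y
      proof -
        obtain j where j: "x j \<noteq> y j" using xy(3) by blast
        have jk: "j < k" using j xy(1,2) unfolding S_def by (auto split: if_splits) (metis singletonD)
        have "(\<lambda>z. z j) \<in> R"
          using trig_functions_sin[OF jk, of c] jk by (auto simp: R_def si_def intro!: continuous_on_subset[OF continuous_on_product_coordinates])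
        then show ?thesis using j by (intro bexI[of _ "\<lambda>z. z j"])
      qed
    qed (auto simp: R_def intro!: continuous_intros trig_functions_mult trig_functions_const trig_add)
    have "continuous_on S \<psi>"
    proof (rule continuous_on_coordinatewise_then_product)
      fix j show "continuous_on S (\<lambda>z. \<psi> z j)"
        unfolding \<psi>_def using c(1)
        by (cases "j < k") (auto intro!: continuous_intros continuous_on_subset[OF continuous_on_product_coordinates])
    qed
    then have "continuous_on S (\<lambda>z. g (\<psi> z))"
      using continuous_on_compose2[OF g] by blast
    from fr.Stone_Weierstrass_basic[OF this e] obtain f where
      f: "f \<in> R" "\<And>z. z \<in> S \<Longrightarrow> \<bar>g (\<psi> z) - f z\<bar> < e" by blast
    have ft: "(\<lambda>y. complex_of_real (f (si y))) \<in> trig_functions k" using f(1) by (simp add: R_def)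
    let ?F = "\<lambda>y. f (si y)"
    have good: "\<psi> (si y) = y" if "\<forall>j\<ge>k. y j = 0" "\<not> (\<exists>j<k. \<bar>y j\<bar> > b)" for y
    proof
      fix j
      show "\<psi> (si y) j = y j"
      proof (cases "j < k")
        case True
        then have "\<bar>y j\<bar> \<le> b" using that(2) by force
        then have "\<bar>c * y j\<bar> \<le> c * b" using c(1) by (simp add: abs_mult)
        then have "- (pi/2) \<le> c * y j" "c * y j \<le> pi / 2" unfolding c(2) by auto
        then have "arcsin (sin (c * y j)) = c * y j" by (rule arcsin_sin)
        then show ?thesis using True c(1) by (simp add: \<psi>_def si_def)
      qed (use that in \<open>auto simp: \<psi>_def\<close>)
    qed
    have approx: "\<bar>(\<integral>y. g y \<partial>N) - (\<integral>y. ?F y \<partial>N)\<bar> \<le> e + 2 * G * e"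
      if N: "prob_space N" "sets N = sets borel" "AE y in N. \<forall>j\<ge>k. y j = 0" "measure N {y. \<exists>j<k. \<bar>y j\<bar> > b} \<le> e" for N
    proof -
      interpret prob_space N by fact
      let ?B = "{y :: nat \<Rightarrow> real. \<exists>j<k. \<bar>y j\<bar> > b}"
      have spN: "space N = UNIV" using sets_eq_imp_space_eq[OF N(2)] by simp
      have "open ?B"
        by (intro open_Collect_ex open_Collect_conj open_Collect_const open_Collect_less continuous_intros
            continuous_on_product_coordinates)
      then have B: "?B \<in> sets N" unfolding N(2) by simp
      have gi: "integrable N g"
        by (rule integrable_const_bound[where B=G]) (use G gm in \<open>auto simp: measurable_cong_sets[OF N(2) refl]\<close>)
      have "integrable N (\<lambda>y. complex_of_real (?F y))" by (rule trig_functions_integrable[OF ft N(1,2)])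
      from integrable_Re[OF this] have Fi: "integrable N ?F" by simp
      have "\<bar>(\<integral>y. g y \<partial>N) - (\<integral>y. ?F y \<partial>N)\<bar> = \<bar>\<integral>y. g y - ?F y \<partial>N\<bar>"
        using gi Fi by simp
      also have "\<dots> \<le> (\<integral>y. \<bar>g y - ?F y\<bar> \<partial>N)" by (rule integral_abs_bound)
      also have "\<dots> \<le> (\<integral>y. e + 2 * G * indicator ?B y \<partial>N)"
      proof (rule integral_mono_AE)
        show "AE y in N. \<bar>g y - ?F y\<bar> \<le> e + 2 * G * indicator ?B y"
          using N(3)
        proof eventually_elim
          case (elim y)
          have 1: "\<bar>g (\<psi> (si y)) - ?F y\<bar> < e" by (rule f(2)[OF si_S])
          show ?case
          proof (cases "y \<in> ?B")
            case True
            have "\<bar>g y - ?F y\<bar> \<le> \<bar>g y\<bar> + \<bar>g (\<psi> (si y))\<bar> + \<bar>g (\<psi> (si y)) - ?F y\<bar>" by linarith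
            also have "\<dots> \<le> G + G + e" using G[of y] G[of "\<psi> (si y)"] 1 by linarith
            finally show ?thesis using True by simp
          next
            case False
            then show ?thesis using good[OF elim] 1 by simp
          qed
        qed
        show "integrable N (\<lambda>y. e + 2 * G * indicator ?B y)"
          using B by (intro Bochner_Integration.integrable_add integrable_const integrable_mult_right integrable_real_indicator)
            (auto simp: less_top[symmetric])
      qed (use gi Fi in auto)
      also have "\<dots> = e + 2 * G * measure N ?B"
        using B by (subst Bochner_Integration.integral_add) (auto simp: prob_space[unfolded spN] spN less_top[symmetric])
      also have "\<dots> \<le> e + 2 * G * e" using N(4) G0 by (intro add_left_mono mult_left_mono) auto
      finally show ?thesis .
    qed
    have "(\<lambda>n. complex_of_real (\<integral>y. ?F y \<partial>Mn n)) \<longlonglongrightarrow> complex_of_real (\<integral>y. ?F y \<partial>M)"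
      using trig_conv[OF ft] by simp
    then have "(\<lambda>n. \<integral>y. ?F y \<partial>Mn n) \<longlonglongrightarrow> (\<integral>y. ?F y \<partial>M)"
      by (simp add: tendsto_of_real_iff)
    from LIMSEQ_D[OF this e] obtain n0 where n0: "\<And>n. n \<ge> n0 \<Longrightarrow> \<bar>(\<integral>y. ?F y \<partial>Mn n) - (\<integral>y. ?F y \<partial>M)\<bar> < e"
      by auto
    have tri: "\<bar>a - a'\<bar> \<le> q \<Longrightarrow> \<bar>b - b'\<bar> \<le> q \<Longrightarrow> \<bar>a' - b'\<bar> < e \<Longrightarrow> \<bar>a - b\<bar> < 2 * q + e" for a a' b b' q :: real
      by linarith
    have "norm ((\<integral>y. g y \<partial>Mn n) - (\<integral>y. g y \<partial>M)) < r" if "n \<ge> n0" for n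
    proof -
      have "\<bar>(\<integral>y. g y \<partial>Mn n) - (\<integral>y. g y \<partial>M)\<bar> < 2 * (e + 2 * G * e) + e"
        by (rule tri[OF approx[OF pn zn b(2), of n] approx[OF p z b(3)] n0[OF that]])
      also have "\<dots> = e * (3 + 4 * G)" by (simp add: algebra_simps)
      also have "\<dots> = r" using G0 by (simp add: e_def)
      finally show ?thesis by simp
    qed
    then show "\<exists>no. \<forall>n\<ge>no. norm ((\<integral>y. g y \<partial>Mn n) - (\<integral>y. g y \<partial>M)) < r" by blast
  qed
qed

section \<open>A central limit theorem for weighted sums\<close>

lemma abs_exp_minus_linear_le:
  fixes x :: real assumes "0 \<le> x" shows "\<bar>exp (- x) - (1 - x)\<bar> \<le> x\<^sup>2"
proof -
  have "exp (- x) * (1 + x) \<le> exp (- x) * exp x"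
    by (intro mult_left_mono) auto
  then have "exp (- x) * (1 + x) \<le> 1" by (simp add: exp_add[symmetric])
  also have "1 \<le> (1 - x + x\<^sup>2) * (1 + x)"
    using assms by (simp add: algebra_simps power2_eq_square)
  finally have "exp (- x) \<le> 1 - x + x\<^sup>2" using assms by (simp add: mult_le_cancel_right)
  moreover have "1 - x \<le> exp (- x)" using exp_ge_add_one_self[of "- x"] by simp
  ultimately show ?thesis by simp
qed

text \<open>Independence turns the characteristic function into a product, which is compared factor
  by factor with exp (- a^2 / 2). All factors have modulus at most 1, so the errors add; each is a^2
  times a quantity that vanishes with the largest weight, and the sum of the a^2 converges.\<close>

lemma (in prob_space) expectation_iexp_weighted_sum_tendsto:
  fixes X :: "'i \<Rightarrow> 'a \<Rightarrow> real" and a :: "nat \<Rightarrow> 'i \<Rightarrow> real" and F :: "nat \<Rightarrow> 'i set"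
  assumes indep: "indep_vars (\<lambda>_. borel) X UNIV"
    and ident: "\<And>l. distr M borel (X l) = \<nu>"
    and L2: "\<And>l. integrable M (\<lambda>x. (X l x)\<^sup>2)"
    and mean: "\<And>l. expectation (X l) = 0"
    and var: "\<And>l. expectation (\<lambda>x. (X l x)\<^sup>2) = 1"
    and fin: "\<And>n. finite (F n)"
    and sq: "(\<lambda>n. \<Sum>l\<in>F n. (a n l)\<^sup>2) \<longlonglongrightarrow> \<tau>"
    and small: "m \<longlonglongrightarrow> 0" "\<And>n l. l \<in> F n \<Longrightarrow> \<bar>a n l\<bar> \<le> m n"
  shows "(\<lambda>n. expectation (\<lambda>x. iexp (\<Sum>l\<in>F n. a n l * X l x))) \<longlonglongrightarrow> exp (- \<tau> / 2)"
proof -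
  have Xm[measurable]: "X l \<in> borel_measurable M" for l
    using indep by (auto simp: indep_vars_def)
  obtain l0 :: 'i where True by simp
  have X1: "integrable M (X l)" for l
    by (rule square_integrable_imp_integrable[OF Xm L2])
  \<comment> \<open>The remainder of \<open>char_approx3'\<close> in Lindeberg form: the minimum
    with 6 X^2 makes it tend to 0 by dominated convergence although X may have no third
    moment.\<close>
  define h where "h t = expectation (\<lambda>x. min (6 * (X l0 x)^2) (\<bar>t\<bar> * \<bar>X l0 x\<bar>^3))" for t :: real
  have hint: "integrable M (\<lambda>x. min (6 * (X l0 x)^2) (\<bar>t\<bar> * \<bar>X l0 x\<bar>^3))" for t
    by (rule Bochner_Integration.integrable_bound[of _ "\<lambda>x. 6 * (X l0 x)\<^sup>2"]) (use L2 in \<open>auto intro!: AE_I2\<close>)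
  have hmono: "h s \<le> h t" if "\<bar>s\<bar> \<le> \<bar>t\<bar>" for s t
    unfolding h_def by (intro integral_mono hint min.mono mult_right_mono that) auto
  have hlim: "(\<lambda>n. h (m n)) \<longlonglongrightarrow> 0"
  proof -
    have "(\<lambda>n. min (6 * (X l0 x)^2) (\<bar>m n\<bar> * \<bar>X l0 x\<bar>^3)) \<longlonglongrightarrow> min (6 * (X l0 x)^2) (\<bar>0\<bar> * \<bar>X l0 x\<bar>^3)" for x
      by (intro tendsto_intros small)
    then have "(\<lambda>n. h (m n)) \<longlonglongrightarrow> expectation (\<lambda>x. 0)"
      unfolding h_def
      by (intro integral_dominated_convergence[where w="\<lambda>x. 6 * (X l0 x)\<^sup>2"]) (use L2 in \<open>auto intro!: AE_I2 simp: min_absorb2\<close>)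
    then show ?thesis by simp
  qed
  have \<psi>: "cmod (char \<nu> t - (1 - t^2 / 2)) \<le> t^2 / 6 * h t" for t
    using char_approx3'[OF Xm X1 L2 mean, of l0 1 \<nu> t] var ident[of l0] by (simp add: h_def mean)
  have chX: "expectation (\<lambda>x. iexp (t * X l x)) = char \<nu> t" for l t
    unfolding ident[of l, symmetric] char_def by (subst integral_distr) auto
  have prod: "expectation (\<lambda>x. iexp (\<Sum>l\<in>F n. a n l * X l x)) = (\<Prod>l\<in>F n. char \<nu> (a n l))" for n
  proof -
    have "expectation (\<lambda>x. iexp (\<Sum>l\<in>F n. a n l * X l x)) = expectation (\<lambda>x. \<Prod>l\<in>F n. iexp (a n l * X l x))"
      by (simp add: sum_distrib_left exp_sum fin)
    also have "\<dots> = (\<Prod>l\<in>F n. expectation (\<lambda>x. iexp (a n l * X l x)))"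
    proof (rule indep_vars_lebesgue_integral[OF fin])
      show "indep_vars (\<lambda>_. borel) (\<lambda>l x. iexp (a n l * X l x)) (F n)"
        by (rule indep_vars_compose2[OF indep_vars_subset[OF indep], where Y="\<lambda>l y. iexp (a n l * y)"]) auto
      show "integrable M (\<lambda>x. iexp (a n l * X l x))" for l
        by (rule integrable_const_bound[where B=1]) auto
    qed
    finally show ?thesis by (simp only: chX)
  qed
  define b where "b n = (\<Sum>l\<in>F n. (a n l)\<^sup>2)" for n
  have bound: "cmod ((\<Prod>l\<in>F n. char \<nu> (a n l)) - complex_of_real (exp (- b n / 2)))
      \<le> b n * (h (m n) / 6 + (m n)\<^sup>2 / 4)" for n
  proof -
    have "complex_of_real (exp (- b n / 2)) = (\<Prod>l\<in>F n. complex_of_real (exp (- (a n l)\<^sup>2 / 2)))"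
      by (simp add: b_def exp_sum[symmetric] fin sum_negf sum_divide_distrib del: of_real_exp flip: of_real_prod)
    then have "cmod ((\<Prod>l\<in>F n. char \<nu> (a n l)) - complex_of_real (exp (- b n / 2)))
      \<le> (\<Sum>l\<in>F n. cmod (char \<nu> (a n l) - complex_of_real (exp (- (a n l)\<^sup>2 / 2))))"
    proof (simp only:, intro norm_prod_diff)
      fix l
      interpret \<nu>: real_distribution \<nu> unfolding ident[of l0, symmetric] by (rule real_distribution_distr) simp
      show "cmod (char \<nu> (a n l)) \<le> 1" by (rule \<nu>.cmod_char_le_1)
    qed (auto simp del: of_real_exp)
    also have "\<dots> \<le> (\<Sum>l\<in>F n. (a n l)\<^sup>2 * (h (m n) / 6 + (m n)\<^sup>2 / 4))"
    proof (rule sum_mono)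
      fix l assume l: "l \<in> F n"
      let ?t = "a n l"
      have tm: "\<bar>?t\<bar> \<le> \<bar>m n\<bar>" using small(2)[OF l] by linarith
      have "cmod (char \<nu> ?t - complex_of_real (exp (- ?t\<^sup>2 / 2)))
          \<le> cmod (char \<nu> ?t - (1 - ?t^2 / 2)) + cmod (complex_of_real (exp (- (?t\<^sup>2 / 2)) - (1 - ?t\<^sup>2 / 2)))"
        by (rule order_trans[OF _ norm_triangle_ineq4]) simp
      also have "cmod (complex_of_real (exp (- (?t\<^sup>2 / 2)) - (1 - ?t\<^sup>2 / 2))) \<le> (?t\<^sup>2 / 2)\<^sup>2"
        unfolding norm_of_real by (rule abs_exp_minus_linear_le) simp
      also have "cmod (char \<nu> ?t - (1 - ?t^2 / 2)) \<le> ?t\<^sup>2 / 6 * h (m n)"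
        by (rule order_trans[OF \<psi>]) (intro mult_left_mono hmono tm, auto)
      also have "(?t\<^sup>2 / 2)\<^sup>2 = ?t\<^sup>2 * (?t\<^sup>2 / 4)" by (simp add: power2_eq_square)
      also have "\<dots> \<le> ?t\<^sup>2 * ((m n)\<^sup>2 / 4)"
        using tm by (intro mult_left_mono divide_right_mono) (auto simp: abs_le_square_iff)
      finally show "cmod (char \<nu> ?t - complex_of_real (exp (- ?t\<^sup>2 / 2))) \<le> ?t\<^sup>2 * (h (m n) / 6 + (m n)\<^sup>2 / 4)"
        by (simp add: algebra_simps)
    qed
    finally show ?thesis by (simp add: b_def sum_distrib_right)
  qed
  have "(\<lambda>n. b n * (h (m n) / 6 + (m n)\<^sup>2 / 4)) \<longlonglongrightarrow> \<tau> * (0 / 6 + 0\<^sup>2 / 4)"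
    unfolding b_def by (intro tendsto_intros sq hlim small) auto
  then have "(\<lambda>n. b n * (h (m n) / 6 + (m n)\<^sup>2 / 4)) \<longlonglongrightarrow> 0" by simp
  then have 1: "(\<lambda>n. (\<Prod>l\<in>F n. char \<nu> (a n l)) - complex_of_real (exp (- b n / 2))) \<longlonglongrightarrow> 0"
    by (rule Lim_null_comparison[rotated]) (use bound in auto)
  have "(\<lambda>n. complex_of_real (exp (- b n / 2))) \<longlonglongrightarrow> complex_of_real (exp (- \<tau> / 2))"
    unfolding b_def by (intro tendsto_of_real tendsto_intros sq) auto
  from tendsto_add[OF 1 this] show ?thesis by (simp only: prod diff_add_cancel add_0_left)
qed

section \<open>Finite-dimensional laws of the Wiener process\<close>

abbreviation "std_normal_product k \<equiv> PiM {..<k::nat} (\<lambda>_. std_normal_distribution)"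

lemma measurable_wiener_map:
  "(\<lambda>y j. if j < k then c * (\<Sum>i\<le>j. sqrt (ts i - (if i = 0 then 0 else ts (i - 1))) * y i) else 0)
     \<in> measurable (std_normal_product k) (borel :: (nat \<Rightarrow> real) measure)"
proof (rule measurable_coordinatewise_then_product)
  fix j
  show "(\<lambda>y. if j < k then c * (\<Sum>i\<le>j. sqrt (ts i - (if i = 0 then 0 else ts (i - 1))) * y i) else 0)
      \<in> borel_measurable (std_normal_product k)"
  proof (cases "j < k")
    case True
    have "(\<lambda>y. y i) \<in> borel_measurable (std_normal_product k)" if "i \<le> j" for i
      using measurable_component_singleton[of i "{..<k}" "\<lambda>_. std_normal_distribution"] that True by simp
    then show ?thesis using True by (auto intro!: borel_measurable_times borel_measurable_sum)
  qed auto
qed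

lemma prob_space_std_normal_product: "prob_space (std_normal_product k)"
  by (rule prob_space_PiM) (rule prob_space_normal_density, simp)

lemma prob_space_wiener_fdd: "prob_space (wiener_fdd c ts k)"
  unfolding wiener_fdd_def
  by (rule prob_space.prob_space_distr[OF prob_space_std_normal_product measurable_wiener_map])

lemma sets_wiener_fdd: "sets (wiener_fdd c ts k) = sets borel"
  by (simp add: wiener_fdd_def)

lemma AE_wiener_fdd_zero: "AE y in wiener_fdd c ts k. \<forall>j\<ge>k. y j = 0"
  unfolding wiener_fdd_def
proof (subst AE_distr_iff[OF measurable_wiener_map])
  have "closed {y :: nat \<Rightarrow> real. \<forall>j\<ge>k. y j = 0}"
    by (intro closed_Collect_all closed_Collect_imp open_Collect_const closed_Collect_eq continuous_on_product_coordinates) auto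
  then show "{x \<in> space borel. \<forall>j\<ge>k. x j = (0::real)} \<in> sets borel" by simp
qed simp

lemma sum_increments: "(\<Sum>i\<le>j. (ts i - (if i = 0 then 0 else ts (i - 1)))) = (ts j :: real)" for j :: nat
  by (induction j) auto

text \<open>The variance of a linear combination of W(ts j), computed from independent increments on
  the left and from the covariance on the right. After exchanging the sums, the increments up to
  index min j j' telescope to the time there.\<close>

lemma sum_increments_squares:
  fixes ts u :: "nat \<Rightarrow> real"
  shows "(\<Sum>i<k. (ts i - (if i = 0 then 0 else ts (i - 1))) * (\<Sum>j\<in>{i..<k}. u j)\<^sup>2)
     = (\<Sum>j<k. \<Sum>j'<k. u j * u j' * ts (min j j'))"
proof -
  define d where "d i = ts i - (if i = 0 then 0 else ts (i - 1))" for i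
  have "(\<Sum>i<k. d i * (\<Sum>j\<in>{i..<k}. u j)\<^sup>2)
      = (\<Sum>i<k. \<Sum>j<k. \<Sum>j'<k. (if i \<le> j \<and> i \<le> j' then u j * u j' * d i else 0))"
  proof (rule sum.cong[OF refl])
    fix i
    have "(\<Sum>j\<in>{i..<k}. u j) = (\<Sum>j<k. if i \<le> j then u j else 0)"
      by (subst sum.inter_filter[symmetric]) (auto intro!: sum.cong)
    then have "d i * (\<Sum>j\<in>{i..<k}. u j)\<^sup>2
        = (\<Sum>j<k. \<Sum>j'<k. d i * ((if i \<le> j then u j else 0) * (if i \<le> j' then u j' else 0)))"
      by (simp only: power2_eq_square sum_product) (simp only: sum_distrib_left)
    also have "\<dots> = (\<Sum>j<k. \<Sum>j'<k. (if i \<le> j \<and> i \<le> j' then u j * u j' * d i else 0))"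
      by (intro sum.cong refl) auto
    finally show "d i * (\<Sum>j\<in>{i..<k}. u j)\<^sup>2 = (\<Sum>j<k. \<Sum>j'<k. (if i \<le> j \<and> i \<le> j' then u j * u j' * d i else 0))" .
  qed
  also have "\<dots> = (\<Sum>j<k. \<Sum>j'<k. \<Sum>i<k. (if i \<le> j \<and> i \<le> j' then u j * u j' * d i else 0))"
    by (subst sum.swap, rule sum.cong[OF refl], rule sum.swap)
  also have "\<dots> = (\<Sum>j<k. \<Sum>j'<k. u j * u j' * ts (min j j'))"
  proof (intro sum.cong refl)
    fix j j' assume "j \<in> {..<k}" "j' \<in> {..<k}"
    then have "{i\<in>{..<k}. i \<le> j \<and> i \<le> j'} = {..min j j'}" by auto
    then have "(\<Sum>i<k. (if i \<le> j \<and> i \<le> j' then u j * u j' * d i else 0)) = (\<Sum>i\<le>min j j'. u j * u j' * d i)"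
      by (subst sum.inter_filter[symmetric]) auto
    also have "\<dots> = u j * u j' * ts (min j j')"
      using sum_increments[of ts "min j j'"] by (simp add: sum_distrib_left[symmetric] d_def)
    finally show "(\<Sum>i<k. (if i \<le> j \<and> i \<le> j' then u j * u j' * d i else 0)) = u j * u j' * ts (min j j')" .
  qed
  finally show ?thesis unfolding d_def .
qed

lemma wiener_fdd_iexp:
  fixes ts u :: "nat \<Rightarrow> real"
  assumes nonneg: "\<And>j. j < k \<Longrightarrow> 0 \<le> ts j" and mono: "\<And>i j. i \<le> j \<Longrightarrow> j < k \<Longrightarrow> ts i \<le> ts j"
  shows "(\<integral>y. iexp (\<Sum>j<k. u j * y j) \<partial>wiener_fdd c ts k)
     = exp (- (c\<^sup>2 * (\<Sum>j<k. \<Sum>j'<k. u j * u j' * ts (min j j'))) / 2)"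
proof -
  define d where "d i = ts i - (if i = 0 then 0 else ts (i - 1))" for i
  have d0: "0 \<le> d i" if "i < k" for i
    using nonneg[of 0] mono[of "i - 1" i] that by (auto simp: d_def)
  \<comment> \<open>The weight of the i-th normal variable after summation by parts: it enters W(ts
    j) for every j >= i.\<close>
  define w where "w i = c * sqrt (d i) * (\<Sum>j\<in>{i..<k}. u j)" for i
  interpret product_sigma_finite "\<lambda>_::nat. std_normal_distribution"
    by (auto simp: product_sigma_finite_def intro!: prob_space_imp_sigma_finite prob_space_normal_density)
  interpret sn: prob_space std_normal_distribution by (rule prob_space_normal_density) simp
  have lin: "(\<Sum>j<k. u j * (if j < k then c * (\<Sum>i\<le>j. sqrt (d i) * y i) else 0)) = (\<Sum>i<k. w i * y i)" for y
  proof -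
    have "(\<Sum>j<k. u j * (if j < k then c * (\<Sum>i\<le>j. sqrt (d i) * y i) else 0))
        = (\<Sum>j<k. \<Sum>i<k. if i \<le> j then u j * c * sqrt (d i) * y i else 0)"
    proof (rule sum.cong[OF refl])
      fix j assume "j \<in> {..<k}"
      then have "{i\<in>{..<k}. i \<le> j} = {..j}" by auto
      then show "u j * (if j < k then c * (\<Sum>i\<le>j. sqrt (d i) * y i) else 0)
          = (\<Sum>i<k. if i \<le> j then u j * c * sqrt (d i) * y i else 0)"
        using \<open>j \<in> {..<k}\<close> by (subst sum.inter_filter[symmetric]) (auto simp: sum_distrib_left mult.assoc)
    qed
    also have "\<dots> = (\<Sum>i<k. \<Sum>j<k. if i \<le> j then u j * c * sqrt (d i) * y i else 0)" by (rule sum.swap)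
    also have "\<dots> = (\<Sum>i<k. w i * y i)"
    proof (rule sum.cong[OF refl])
      fix i assume "i \<in> {..<k}"
      have "{j\<in>{..<k}. i \<le> j} = {i..<k}" by auto
      then show "(\<Sum>j<k. if i \<le> j then u j * c * sqrt (d i) * y i else 0) = w i * y i"
        by (subst sum.inter_filter[symmetric]) (auto simp: w_def sum_distrib_left sum_distrib_right mult_ac)
    qed
    finally show ?thesis .
  qed
  have "(\<integral>y. iexp (\<Sum>j<k. u j * y j) \<partial>wiener_fdd c ts k) = (\<integral>y. iexp (\<Sum>i<k. w i * y i) \<partial>std_normal_product k)"
    unfolding wiener_fdd_def
    by (subst integral_distr[OF measurable_wiener_map])
       (intro borel_measurable_continuous_onI continuous_intros continuous_on_product_coordinates, simp only: lin[unfolded d_def])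
  also have "\<dots> = (\<integral>y. (\<Prod>i<k. iexp (w i * y i)) \<partial>std_normal_product k)"
    by (simp add: sum_distrib_left exp_sum)
  also have "\<dots> = (\<Prod>i<k. \<integral>t. iexp (w i * t) \<partial>std_normal_distribution)"
    by (rule product_integral_prod) (auto intro!: sn.integrable_const_bound[where B=1])
  also have "\<dots> = (\<Prod>i<k. complex_of_real (exp (- (w i)\<^sup>2 / 2)))"
    using fun_cong[OF char_std_normal_distribution] unfolding char_def by simp
  also have "\<dots> = complex_of_real (exp (- (\<Sum>i<k. (w i)\<^sup>2) / 2))"
    by (simp add: exp_sum[symmetric] sum_negf sum_divide_distrib del: of_real_exp flip: of_real_prod)
  also have "(\<Sum>i<k. (w i)\<^sup>2) = c\<^sup>2 * (\<Sum>i<k. d i * (\<Sum>j\<in>{i..<k}. u j)\<^sup>2)"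
    unfolding w_def sum_distrib_left[of "c\<^sup>2"]
    by (intro sum.cong refl) (use d0 in \<open>simp add: power_mult_distrib\<close>)
  also have "(\<Sum>i<k. d i * (\<Sum>j\<in>{i..<k}. u j)\<^sup>2) = (\<Sum>j<k. \<Sum>j'<k. u j * u j' * ts (min j j'))"
    unfolding d_def by (rule sum_increments_squares)
  finally show ?thesis by simp
qed

text \<open>Truncation at 1 makes the fourth power a bounded continuous test function, fit for the
  weak limit; the factor 3 is the fourth moment of the standard normal law.\<close>

lemma wiener_fdd_increment_fourth_moment:
  assumes b: "b > 0" and ts: "0 \<le> ts 0" "ts 0 \<le> ts 1"
  shows "(\<integral>y. min 1 (((y 1 - y 0) / b) ^ 4) \<partial>wiener_fdd c ts 2) \<le> 3 * c ^ 4 * (ts 1 - ts 0)\<^sup>2 / b ^ 4"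
proof -
  interpret product_sigma_finite "\<lambda>_::nat. std_normal_distribution"
    by (auto simp: product_sigma_finite_def intro!: prob_space_imp_sigma_finite prob_space_normal_density)
  interpret sn: prob_space "std_normal_product 2" by (rule prob_space_std_normal_product)
  define A where "A = c * sqrt (ts 1 - ts 0) / b"
  have A4: "A ^ 4 = c ^ 4 * (ts 1 - ts 0)\<^sup>2 / b ^ 4"
    using ts by (simp add: A_def power_mult_distrib power_divide power4_eq_xxxx power2_eq_square mult_ac)
  have "(\<lambda>y. y (1::nat)) \<in> measurable (std_normal_product 2) std_normal_distribution"
    by (rule measurable_component_singleton) simp
  moreover have "measurable (std_normal_product 2) std_normal_distribution = borel_measurable (std_normal_product 2)"
    by (rule measurable_cong_sets) auto
  ultimately have y1[measurable]: "(\<lambda>y. y 1) \<in> borel_measurable (std_normal_product 2)"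
    "(\<lambda>y. y (Suc 0)) \<in> borel_measurable (std_normal_product 2)" by simp_all
  have distr: "distr (std_normal_product 2) std_normal_distribution (\<lambda>y. y 1) = std_normal_distribution"
    by (rule distr_PiM_component) (auto intro!: prob_space_normal_density)
  have i4: "integrable (std_normal_product 2) (\<lambda>y. (y 1) ^ 4)"
  proof -
    have "integrable (distr (std_normal_product 2) std_normal_distribution (\<lambda>y. y 1)) (\<lambda>t. t ^ 4)"
      unfolding distr by (rule integrable_std_normal_distribution_moment)
    then show ?thesis by (subst (asm) integrable_distr_eq) auto
  qed
  have "(\<integral>y. (y 1) ^ 4 \<partial>std_normal_product 2) = (\<integral>t. t ^ 4 \<partial>distr (std_normal_product 2) std_normal_distribution (\<lambda>y. y 1))"
    by (subst integral_distr) auto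
  also have "\<dots> = 3"
    unfolding distr using std_normal_distribution_even_moments(1)[of 2] by (simp add: fact_numeral)
  finally have m4: "(\<integral>y. (y 1) ^ 4 \<partial>std_normal_product 2) = 3" .
  have "(\<integral>y. min 1 (((y 1 - y 0) / b) ^ 4) \<partial>wiener_fdd c ts 2)
     = (\<integral>y. min 1 ((A * y 1) ^ 4) \<partial>std_normal_product 2)"
    unfolding wiener_fdd_def
    by (subst integral_distr[OF measurable_wiener_map])
       (use b in \<open>auto intro!: borel_measurable_continuous_onI continuous_intros Bochner_Integration.integral_cong
          simp: A_def algebra_simps diff_divide_distrib[symmetric]\<close>)
  also have "\<dots> \<le> (\<integral>y. A ^ 4 * (y 1) ^ 4 \<partial>std_normal_product 2)"
  proof (rule integral_mono)
    show "integrable (std_normal_product 2) (\<lambda>y. min 1 ((A * y 1) ^ 4))"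
      by (rule sn.integrable_const_bound[where B=1]) auto
    show "integrable (std_normal_product 2) (\<lambda>y. A ^ 4 * (y 1) ^ 4)"
      by (intro integrable_mult_right i4)
  qed (simp add: power_mult_distrib)
  also have "\<dots> = 3 * c ^ 4 * (ts 1 - ts 0)\<^sup>2 / b ^ 4" by (simp add: m4[unfolded One_nat_def] A4)
  finally show ?thesis .
qed

section \<open>Occupation counts and self-intersections\<close>

definition occupation :: "(nat \<Rightarrow> 'l) \<Rightarrow> nat set \<Rightarrow> 'l \<Rightarrow> real" where
  "occupation z A l = (\<Sum>i\<in>A. of_bool (z i = l))"

definition intersections :: "(nat \<Rightarrow> 'l) \<Rightarrow> nat set \<Rightarrow> nat set \<Rightarrow> real" where
  "intersections z A B = (\<Sum>i\<in>A. \<Sum>j\<in>B. of_bool (z i = z j))"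

definition time_block :: "nat \<Rightarrow> real \<Rightarrow> real \<Rightarrow> nat set" where
  "time_block n s t = {nat \<lfloor>real n * s\<rfloor>..<nat \<lfloor>real n * t\<rfloor>}"

definition nlogn :: "nat \<Rightarrow> real" where "nlogn n = real n * ln (real n)"

lemma nlogn_nonneg: "0 \<le> nlogn n"
  by (cases "n = 0") (auto simp: nlogn_def)

lemma nlogn_pos: "n \<ge> 2 \<Longrightarrow> 0 < nlogn n"
  by (auto simp: nlogn_def)

lemma finite_time_block[simp]: "finite (time_block n s t)" by (simp add: time_block_def)

text \<open>Only the sites visited at times in \<open>A\<close> have to lie in \<open>F\<close>: a
  site visited in \<open>B\<close> alone contributes zero.\<close>

lemma intersections_eq_sum_occupation:
  assumes "finite A" "finite B" "finite F" "z ` A \<subseteq> F"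
  shows "intersections z A B = (\<Sum>l\<in>F. occupation z A l * occupation z B l)"
proof -
  have "(\<Sum>l\<in>F. occupation z A l * occupation z B l)
      = (\<Sum>l\<in>F. \<Sum>i\<in>A. \<Sum>j\<in>B. of_bool (z i = l) * of_bool (z j = l))"
    by (simp add: occupation_def sum_product)
  also have "\<dots> = (\<Sum>i\<in>A. \<Sum>j\<in>B. \<Sum>l\<in>F. of_bool (z i = l) * of_bool (z j = l))"
    by (subst sum.swap, rule sum.cong[OF refl], rule sum.swap)
  also have "\<dots> = intersections z A B"
    unfolding intersections_def
  proof (intro sum.cong refl)
    fix i j assume "i \<in> A" "j \<in> B"
    then have "z i \<in> F" using assms by auto
    have "(\<Sum>l\<in>F. of_bool (z i = l) * of_bool (z j = l) :: real) = (\<Sum>l\<in>F. if z i = l then of_bool (z i = z j) else 0)"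
      by (intro sum.cong) auto
    also have "\<dots> = of_bool (z i = z j)" using \<open>z i \<in> F\<close> assms by simp
    finally show "(\<Sum>l\<in>F. of_bool (z i = l) * of_bool (z j = l) :: real) = of_bool (z i = z j)" .
  qed
  finally show ?thesis by simp
qed

lemma intersections_sym: "intersections z A B = intersections z B A"
  unfolding intersections_def by (subst sum.swap) (auto intro!: sum.cong simp: eq_commute)

lemma intersections_Un_left:
  "finite A \<Longrightarrow> finite B \<Longrightarrow> A \<inter> B = {} \<Longrightarrow> intersections z (A \<union> B) D = intersections z A D + intersections z B D"
  by (simp add: intersections_def sum.union_disjoint)

lemma intersections_Un_right:
  "finite A \<Longrightarrow> finite B \<Longrightarrow> A \<inter> B = {} \<Longrightarrow> intersections z D (A \<union> B) = intersections z D A + intersections z D B"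
  by (simp add: intersections_Un_left intersections_sym[of z D])

lemma occupation_nonneg: "0 \<le> occupation z A l" by (simp add: occupation_def sum_nonneg)

lemma intersections_nonneg: "0 \<le> intersections z A B" by (simp add: intersections_def sum_nonneg)

lemma occupation_mono: "A \<subseteq> B \<Longrightarrow> finite B \<Longrightarrow> occupation z A l \<le> occupation z B l"
  unfolding occupation_def by (rule sum_mono2) auto

lemma occupation_eq_0: "l \<notin> z ` A \<Longrightarrow> occupation z A l = 0"
  by (auto simp: occupation_def intro!: sum.neutral)

lemma occupation_square_le: "finite A \<Longrightarrow> (occupation z A l)\<^sup>2 \<le> intersections z A A"
proof -
  assume A: "finite A"
  have "(occupation z A l)\<^sup>2 \<le> (\<Sum>l'\<in>insert l (z ` A). (occupation z A l')\<^sup>2)"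
    by (rule member_le_sum) (use A in auto)
  also have "\<dots> = intersections z A A"
    by (subst intersections_eq_sum_occupation[where F="insert l (z ` A)"]) (use A in \<open>auto simp: power2_eq_square\<close>)
  finally show ?thesis .
qed

lemma sum_sites_eq_occupation:
  assumes "finite A" "finite F" "z ` A \<subseteq> F"
  shows "(\<Sum>i\<in>A. f (z i) :: real) = (\<Sum>l\<in>F. occupation z A l * f l)"
proof -
  have "(\<Sum>l\<in>F. occupation z A l * f l) = (\<Sum>i\<in>A. \<Sum>l\<in>F. of_bool (z i = l) * f l)"
    unfolding occupation_def sum_distrib_right by (rule sum.swap)
  also have "\<dots> = (\<Sum>i\<in>A. f (z i))"
  proof (rule sum.cong[OF refl])
    fix i assume "i \<in> A"
    then have "z i \<in> F" using assms by auto
    have "(\<Sum>l\<in>F. of_bool (z i = l) * f l) = (\<Sum>l\<in>F. if z i = l then f (z i) else 0)"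
      by (intro sum.cong) auto
    then show "(\<Sum>l\<in>F. of_bool (z i = l) * f l) = f (z i)" using \<open>z i \<in> F\<close> assms by simp
  qed
  finally show ?thesis by simp
qed

lemma time_block_Un:
  assumes "s \<le> t" "t \<le> u"
  shows "time_block n s u = time_block n s t \<union> time_block n t u" "time_block n s t \<inter> time_block n t u = {}"
proof -
  have "nat \<lfloor>real n * s\<rfloor> \<le> nat \<lfloor>real n * t\<rfloor>" "nat \<lfloor>real n * t\<rfloor> \<le> nat \<lfloor>real n * u\<rfloor>"
    using assms by (auto intro!: nat_mono floor_mono mult_left_mono)
  then show "time_block n s u = time_block n s t \<union> time_block n t u" "time_block n s t \<inter> time_block n t u = {}"
    unfolding time_block_def by auto
qed

text \<open>All that the quenched limit theorem knows about the walk, for one fixed trajectory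
  \<open>z\<close>. The asymptotics of mutual intersections and the smallness of local times are
  derived from it.\<close>

locale normalised_self_intersections =
  fixes z :: "nat \<Rightarrow> 'l" and C :: real
  assumes C_pos: "C > 0"
    and self_intersections: "\<And>s t. 0 \<le> s \<Longrightarrow> s \<le> t \<Longrightarrow> t \<le> 1 \<Longrightarrow>
      (\<lambda>n. intersections z (time_block n s t) (time_block n s t) / nlogn n) \<longlonglongrightarrow> C * (t - s)"
begin

lemma intersections_tendsto_le:
  assumes "0 \<le> s" "s \<le> t" "t \<le> 1"
  shows "(\<lambda>n. intersections z (time_block n 0 s) (time_block n 0 t) / nlogn n) \<longlonglongrightarrow> C * s"
proof -
  let ?A = "\<lambda>n. time_block n 0 s" and ?B = "\<lambda>n. time_block n s t"
  have eq: "intersections z (?A n) (time_block n 0 t) / nlogn n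
     = (intersections z (time_block n 0 t) (time_block n 0 t) / nlogn n + intersections z (?A n) (?A n) / nlogn n
        - intersections z (?B n) (?B n) / nlogn n) / 2" for n
    using time_block_Un[OF assms(1,2), of n] intersections_sym[of z "?A n" "?B n"]
    by (cases "nlogn n = 0") (auto simp: intersections_Un_left intersections_Un_right field_simps)
  have "(\<lambda>n. (intersections z (time_block n 0 t) (time_block n 0 t) / nlogn n + intersections z (?A n) (?A n) / nlogn n
        - intersections z (?B n) (?B n) / nlogn n) / 2) \<longlonglongrightarrow> (C * (t - 0) + C * (s - 0) - C * (t - s)) / 2"
    by (intro tendsto_intros self_intersections) (use assms in auto)
  then show ?thesis unfolding eq by (simp add: algebra_simps)
qed

text \<open>The limit is C times the covariance of Brownian motion, and this is how the Wiener law
  enters.\<close>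

lemma intersections_tendsto:
  assumes "0 \<le> s" "0 \<le> t" "s \<le> 1" "t \<le> 1"
  shows "(\<lambda>n. intersections z (time_block n 0 s) (time_block n 0 t) / nlogn n) \<longlonglongrightarrow> C * min s t"
  using intersections_tendsto_le[of s t] intersections_tendsto_le[of t s] assms
  by (cases "s \<le> t") (auto simp: min_def intersections_sym)

lemma blocks_decompose:
  fixes m K :: nat
  assumes "K > 0" "m \<le> K"
  shows "time_block n 0 (real m / real K) = (\<Union>b<m. time_block n (real b / K) (real (Suc b) / K))"
  using assms(2)
proof (induction m)
  case 0
  then show ?case by (simp add: time_block_def)
next
  case (Suc m)
  have "time_block n 0 (real (Suc m) / K) = time_block n 0 (real m / K) \<union> time_block n (real m / K) (real (Suc m) / K)"
    by (rule time_block_Un) (auto simp: divide_right_mono)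
  then show ?case using Suc by (simp add: lessThan_Suc Un_commute)
qed

lemma disjoint_blocks:
  fixes b b' K :: nat
  assumes "b < b'"
  shows "time_block n (real b / K) (real (Suc b) / K) \<inter> time_block n (real b' / K) (real (Suc b') / K) = {}"
proof (cases "K = 0")
  case True then show ?thesis by (simp add: time_block_def)
next
  case False
  have "real (Suc b) / K \<le> real b' / K" using assms by (intro divide_right_mono) auto
  then have "nat \<lfloor>real n * (real (Suc b) / real K)\<rfloor> \<le> nat \<lfloor>real n * (real b' / real K)\<rfloor>"
    by (intro nat_mono floor_mono mult_left_mono) auto
  then show ?thesis by (auto simp: time_block_def)
qed

text \<open>Cut the times below n into K blocks. Intersections between different blocks total o(n
  log n), since the whole and the sum over the blocks are both asymptotic to C n log n; and inside
  one block a site is visited at most sqrt (2 C / K * n log n) times. The square of a local time is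
  its cross-block part plus at most the largest block count times the local time itself, a quadratic
  inequality.\<close>

lemma occupation_small:
  assumes "\<epsilon> > 0"
  shows "eventually (\<lambda>n. \<forall>l. occupation z {..<n} l \<le> \<epsilon> * sqrt (nlogn n)) sequentially"
proof -
  \<comment> \<open>Large enough that 2 C / K, twice the limiting share of one block, is at most
    (\<epsilon> / 2)^2.\<close>
  define K where "K = Suc (nat \<lceil>8 * C / \<epsilon>\<^sup>2\<rceil>)"
  have K0: "K > 0" by (simp add: K_def)
  have "8 * C / \<epsilon>\<^sup>2 \<le> real K" unfolding K_def by linarith
  then have K: "2 * C / K \<le> (\<epsilon> / 2)\<^sup>2"
    using assms K0 by (simp add: field_simps power2_eq_square)
  let ?I = "\<lambda>n b. time_block n (real b / K) (real (Suc b) / K)"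
  have I: "time_block n 0 1 = {..<n}" for n by (auto simp: time_block_def)
  have lim1: "(\<lambda>n. intersections z (?I n b) (?I n b) / nlogn n) \<longlonglongrightarrow> C / K" if "b < K" for b
  proof -
    have "real (Suc b) / K \<le> 1" using that by (simp add: field_simps)
    moreover have "real (Suc b) / K - real b / K = 1 / K" by (simp add: add_divide_distrib)
    ultimately show ?thesis
      using self_intersections[of "real b / K" "real (Suc b) / K"] by (simp add: divide_right_mono)
  qed
  have "(\<lambda>n. intersections z {..<n} {..<n} / nlogn n - (\<Sum>b<K. intersections z (?I n b) (?I n b) / nlogn n))
     \<longlonglongrightarrow> C * (1 - 0) - (\<Sum>b<K. C / K)"
  proof (rule tendsto_diff)
    show "(\<lambda>n. intersections z {..<n} {..<n} / nlogn n) \<longlonglongrightarrow> C * (1 - 0)"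
      using self_intersections[of 0 1] by (simp add: I)
    show "(\<lambda>n. \<Sum>b<K. intersections z (?I n b) (?I n b) / nlogn n) \<longlonglongrightarrow> (\<Sum>b<K. C / K)"
      by (rule tendsto_sum) (use lim1 in auto)
  qed
  then have "(\<lambda>n. intersections z {..<n} {..<n} / nlogn n - (\<Sum>b<K. intersections z (?I n b) (?I n b) / nlogn n)) \<longlonglongrightarrow> 0"
    using K0 by simp
  then have ev1: "eventually (\<lambda>n. intersections z {..<n} {..<n} / nlogn n - (\<Sum>b<K. intersections z (?I n b) (?I n b) / nlogn n) < \<epsilon>\<^sup>2 / 2) sequentially"
    by (rule order_tendstoD) (use assms in auto)
  have ev2: "eventually (\<lambda>n. \<forall>b\<in>{..<K}. intersections z (?I n b) (?I n b) / nlogn n < 2 * C / K) sequentially"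
  proof (rule eventually_ball_finite, simp, rule ballI)
    fix b assume "b \<in> {..<K}"
    then have "b < K" by simp
    moreover have "C / K < 2 * C / K" using C_pos K0 by (intro divide_strict_right_mono) auto
    ultimately show "\<forall>\<^sub>F n in sequentially. intersections z (?I n b) (?I n b) / nlogn n < 2 * C / K"
      by (intro order_tendstoD(2)[OF lim1])
  qed
  show ?thesis
    using ev1 ev2 eventually_ge_at_top[of 2]
  proof eventually_elim
    case (elim n)
    define Q where "Q = nlogn n"
    have Q: "Q > 0" using elim(3) nlogn_pos by (simp add: Q_def)
    define F where "F = z ` {..<n}"
    have part: "{..<n} = (\<Union>b<K. ?I n b)" using blocks_decompose[OF K0 order_refl, of n] K0 by (simp add: I)
    have disj: "i \<noteq> j \<Longrightarrow> ?I n i \<inter> ?I n j = {}" for i j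
      using disjoint_blocks[of i j n K] disjoint_blocks[of j i n K] by (cases i j rule: linorder_cases) auto
    have occ: "occupation z {..<n} l = (\<Sum>b<K. occupation z (?I n b) l)" for l
      unfolding occupation_def part by (rule sum.UNION_disjoint) (use disj in auto)
    have sub: "?I n b \<subseteq> {..<n}" if "b < K" for b using part that by auto
    \<comment> \<open>The share of site \<open>l\<close> in the intersections between different
      blocks. It is nonnegative, so the sum over all sites controls each single one.\<close>
    define D where "D l = (occupation z {..<n} l)\<^sup>2 - (\<Sum>b<K. (occupation z (?I n b) l)\<^sup>2)" for l
    have D0: "0 \<le> D l" for l
    proof -
      have "(\<Sum>b<K. (occupation z (?I n b) l)\<^sup>2) \<le> (\<Sum>b<K. occupation z (?I n b) l * occupation z {..<n} l)"
        unfolding power2_eq_square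
        by (intro sum_mono mult_left_mono occupation_mono occupation_nonneg) (use sub in auto)
      also have "\<dots> = (occupation z {..<n} l)\<^sup>2"
        by (simp only: sum_distrib_right[symmetric] occ[symmetric] power2_eq_square)
      finally show ?thesis unfolding D_def by simp
    qed
    have finF: "finite F" "z ` {..<n} \<subseteq> F" by (auto simp: F_def)
    have sumD: "(\<Sum>l\<in>F. D l) = intersections z {..<n} {..<n} - (\<Sum>b<K. intersections z (?I n b) (?I n b))"
    proof -
      have 1: "intersections z {..<n} {..<n} = (\<Sum>l\<in>F. (occupation z {..<n} l)\<^sup>2)"
        by (subst intersections_eq_sum_occupation[OF _ _ finF]) (auto simp: power2_eq_square)
      have 2: "intersections z (?I n b) (?I n b) = (\<Sum>l\<in>F. (occupation z (?I n b) l)\<^sup>2)" if "b < K" for b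
        by (subst intersections_eq_sum_occupation[where F=F]) (use finF sub[OF that] in \<open>auto simp: power2_eq_square\<close>)
      have "(\<Sum>b<K. intersections z (?I n b) (?I n b)) = (\<Sum>l\<in>F. \<Sum>b<K. (occupation z (?I n b) l)\<^sup>2)"
        using 2 by (subst sum.swap) simp
      then show ?thesis by (simp add: D_def sum_subtractf 1)
    qed
    have Dle: "D l \<le> \<epsilon>\<^sup>2 / 2 * Q" for l
    proof (cases "l \<in> F")
      case True
      then have "D l \<le> (\<Sum>l\<in>F. D l)" by (intro member_le_sum D0 finF)
      also have "\<dots> = (intersections z {..<n} {..<n} / Q - (\<Sum>b<K. intersections z (?I n b) (?I n b) / Q)) * Q"
        using Q unfolding sumD sum_divide_distrib[symmetric] by (simp add: diff_divide_distrib[symmetric])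
      also have "\<dots> \<le> \<epsilon>\<^sup>2 / 2 * Q" using elim(1) Q unfolding Q_def by (intro mult_right_mono) auto
      finally show ?thesis .
    next
      case False
      then have "occupation z {..<n} l = 0" by (intro occupation_eq_0) (simp add: F_def)
      then have "D l \<le> 0" by (simp add: D_def sum_nonneg)
      also have "0 \<le> \<epsilon>\<^sup>2 / 2 * Q" using Q by simp
      finally show ?thesis .
    qed
    show ?case
    proof
      fix l
      define x where "x = occupation z {..<n} l"
      have x0: "0 \<le> x" by (simp add: x_def occupation_nonneg)
      have ob: "occupation z (?I n b) l \<le> \<epsilon> / 2 * sqrt Q" if "b < K" for b
      proof -
        have "(occupation z (?I n b) l)\<^sup>2 \<le> intersections z (?I n b) (?I n b)" by (rule occupation_square_le) simp
        also have "\<dots> \<le> 2 * C / K * Q" using elim(2) that Q by (auto simp: Q_def divide_less_eq intro!: less_imp_le)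
        also have "\<dots> \<le> (\<epsilon> / 2)\<^sup>2 * Q" using K Q by (intro mult_right_mono) auto
        also have "\<dots> = (\<epsilon> / 2 * sqrt Q)\<^sup>2" using Q by (simp add: power_mult_distrib power_divide)
        finally show ?thesis by (rule power2_le_imp_le) (use assms Q in auto)
      qed
      have "x\<^sup>2 = D l + (\<Sum>b<K. (occupation z (?I n b) l)\<^sup>2)" by (simp add: D_def x_def)
      also have "\<dots> \<le> \<epsilon>\<^sup>2 / 2 * Q + (\<Sum>b<K. \<epsilon> / 2 * sqrt Q * occupation z (?I n b) l)"
        unfolding power2_eq_square[of "occupation _ _ _"]
        by (intro add_mono Dle sum_mono mult_right_mono ob occupation_nonneg) auto
      also have "\<dots> = \<epsilon>\<^sup>2 / 2 * Q + \<epsilon> / 2 * sqrt Q * x"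
        by (simp add: x_def occ sum_distrib_left)
      finally have main: "x\<^sup>2 \<le> \<epsilon>\<^sup>2 / 2 * Q + \<epsilon> / 2 * sqrt Q * x" .
      show "occupation z {..<n} l \<le> \<epsilon> * sqrt (nlogn n)"
      proof (rule ccontr)
        \<comment> \<open>Beyond \<epsilon> sqrt Q the first term on the right of
          \<open>main\<close> is below x^2 / 2 and the second is at most x^2 / 2.\<close>
        assume "\<not> ?thesis"
        then have gt: "x > \<epsilon> * sqrt Q" by (simp add: x_def Q_def)
        have p: "0 < \<epsilon> * sqrt Q" using assms Q by simp
        have "\<epsilon>\<^sup>2 * Q = (\<epsilon> * sqrt Q) * (\<epsilon> * sqrt Q)" using Q by (simp add: power2_eq_square)
        also have "\<dots> < x * x" using gt p by (intro mult_strict_mono) auto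
        finally have 1: "\<epsilon>\<^sup>2 * Q < x\<^sup>2" by (simp add: power2_eq_square)
        have "\<epsilon> * sqrt Q * x \<le> x * x" using gt x0 by (intro mult_right_mono) auto
        then show False using 1 main by (simp add: power2_eq_square)
      qed
    qed
  qed
qed

end

section \<open>Quenched finite-dimensional convergence\<close>

lemma (in prob_space) measure_abs_gt_tendsto_0:
  fixes f :: "nat \<Rightarrow> 'a \<Rightarrow> real"
  assumes [measurable]: "\<And>j. f j \<in> borel_measurable M"
  shows "(\<lambda>i. prob {y \<in> space M. \<exists>j<k. \<bar>f j y\<bar> > real i}) \<longlonglongrightarrow> 0"
proof -
  have dec: "decseq (\<lambda>i. {y \<in> space M. \<exists>j<k. \<bar>f j y\<bar> > real i})"
    unfolding decseq_def by (auto intro: le_less_trans)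
  have "(\<Inter>i. {y \<in> space M. \<exists>j<k. \<bar>f j y\<bar> > real i}) = {}"
  proof (rule ccontr)
    assume "(\<Inter>i. {y \<in> space M. \<exists>j<k. \<bar>f j y\<bar> > real i}) \<noteq> {}"
    then obtain y where y: "\<And>i. \<exists>j<k. \<bar>f j y\<bar> > real i" by auto
    obtain i where "(\<Sum>j<k. \<bar>f j y\<bar>) \<le> real i" using real_arch_simple by blast
    moreover obtain j where "j < k" "\<bar>f j y\<bar> > real i" using y by blast
    moreover have "\<bar>f j y\<bar> \<le> (\<Sum>j<k. \<bar>f j y\<bar>)" using \<open>j < k\<close> by (intro member_le_sum) auto
    ultimately show False by linarith
  qed
  moreover have "range (\<lambda>i. {y \<in> space M. \<exists>j<k. \<bar>f j y\<bar> > real i}) \<subseteq> events" by auto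
  ultimately show ?thesis using Lim_measure_decseq[OF _ dec, of M] by simp
qed

locale random_scenery = prob_space M for M :: "'e measure" +
  fixes X :: "'l \<Rightarrow> 'e \<Rightarrow> real"
  assumes indep: "indep_vars (\<lambda>_. borel) X UNIV"
    and ident: "\<And>l l'. distr M borel (X l) = distr M borel (X l')"
    and L2: "\<And>l. integrable M (\<lambda>x. (X l x)\<^sup>2)"
    and mean: "\<And>l. expectation (X l) = 0"
    and var: "\<And>l. expectation (\<lambda>x. (X l x)\<^sup>2) = 1"
begin

lemma X_meas[measurable]: "X l \<in> borel_measurable M"
  using indep by (auto simp: indep_vars_def)

lemma X_int: "integrable M (X l)"
  by (rule square_integrable_imp_integrable[OF X_meas L2])

lemma second_moment_weighted_sum:
  assumes "finite F"
  shows "expectation (\<lambda>x. (\<Sum>l\<in>F. a l * X l x)\<^sup>2) = (\<Sum>l\<in>F. (a l)\<^sup>2)"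
    and "integrable M (\<lambda>x. (\<Sum>l\<in>F. a l * X l x)\<^sup>2)"
proof -
  have prod: "expectation (\<lambda>x. X l x * X l' x) = of_bool (l = l')" for l l'
  proof (cases "l = l'")
    case True
    then show ?thesis using var by (simp add: power2_eq_square)
  next
    case False
    have "expectation (\<lambda>x. \<Prod>i\<in>{l, l'}. X i x) = (\<Prod>i\<in>{l, l'}. expectation (X i))"
      by (rule indep_vars_lebesgue_integral[OF _ indep_vars_subset[OF indep]]) (auto intro: X_int)
    with False show ?thesis by (simp add: mean)
  qed
  have int: "integrable M (\<lambda>x. X l x * X l' x)" for l l'
    by (rule integrable_mult_of_squares[OF X_meas X_meas L2 L2])
  have eq: "(\<Sum>l\<in>F. a l * X l x)\<^sup>2 = (\<Sum>l\<in>F. \<Sum>l'\<in>F. (a l * a l') * (X l x * X l' x))" for x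
    by (simp add: power2_eq_square sum_product mult_ac)
  have int2: "integrable M (\<lambda>x. (a l * a l') * (X l x * X l' x))" for l l'
    by (rule integrable_mult_right[OF int])
  show "integrable M (\<lambda>x. (\<Sum>l\<in>F. a l * X l x)\<^sup>2)"
    unfolding eq by (intro Bochner_Integration.integrable_sum int2)
  have "expectation (\<lambda>x. (\<Sum>l\<in>F. a l * X l x)\<^sup>2) = (\<Sum>l\<in>F. \<Sum>l'\<in>F. (a l * a l') * of_bool (l = l'))"
    unfolding eq
    by (subst Bochner_Integration.integral_sum, intro Bochner_Integration.integrable_sum int2, intro sum.cong refl,
        subst Bochner_Integration.integral_sum, rule int2, intro sum.cong refl, simp add: prod)
  also have "\<dots> = (\<Sum>l\<in>F. \<Sum>l'\<in>F. if l = l' then (a l)\<^sup>2 else 0)"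
    by (intro sum.cong refl) (auto simp: power2_eq_square)
  also have "\<dots> = (\<Sum>l\<in>F. (a l)\<^sup>2)"
    by (intro sum.cong refl) (use assms in auto)
  finally show "expectation (\<lambda>x. (\<Sum>l\<in>F. a l * X l x)\<^sup>2) = (\<Sum>l\<in>F. (a l)\<^sup>2)" .
qed

lemma second_moment_path:
  assumes "finite A"
  shows "expectation (\<lambda>x. (\<Sum>i\<in>A. X (z i) x)\<^sup>2) = intersections z A A"
    and "integrable M (\<lambda>x. (\<Sum>i\<in>A. X (z i) x)\<^sup>2)"
proof -
  have eq: "(\<Sum>i\<in>A. X (z i) x) = (\<Sum>l\<in>z`A. occupation z A l * X l x)" for x
    by (rule sum_sites_eq_occupation[where f="\<lambda>l. X l x"]) (use assms in auto)
  show "expectation (\<lambda>x. (\<Sum>i\<in>A. X (z i) x)\<^sup>2) = intersections z A A"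
    "integrable M (\<lambda>x. (\<Sum>i\<in>A. X (z i) x)\<^sup>2)"
    unfolding eq using second_moment_weighted_sum[of "z`A" "occupation z A"]
      intersections_eq_sum_occupation[of A A "z`A" z] assms by (auto simp: power2_eq_square)
qed

end

locale quenched_scenery = random_scenery M X + normalised_self_intersections z C
  for M :: "'e measure" and X :: "'l \<Rightarrow> 'e \<Rightarrow> real" and z :: "nat \<Rightarrow> 'l" and C :: real
begin

definition Y :: "nat \<Rightarrow> 'e \<Rightarrow> real \<Rightarrow> real" where
  "Y n x t = (\<Sum>i<nat \<lfloor>real n * t\<rfloor>. X (z i) x) / sqrt (real n * ln (real n))"

lemma Y_meas[measurable]: "(\<lambda>x. Y n x t) \<in> borel_measurable M"
  unfolding Y_def by measurable

lemma time_block_0: "time_block n 0 t = {..<nat \<lfloor>real n * t\<rfloor>}"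
  by (auto simp: time_block_def)

lemma time_block_subset: "t \<le> 1 \<Longrightarrow> time_block n 0 t \<subseteq> {..<n}"
proof -
  assume "t \<le> 1"
  then have "real n * t \<le> real n" by (simp add: mult_left_le)
  then have "nat \<lfloor>real n * t\<rfloor> \<le> n" by linarith
  then show ?thesis by (auto simp: time_block_0)
qed

lemma Y_eq: "Y n x t = (\<Sum>i\<in>time_block n 0 t. X (z i) x) / sqrt (nlogn n)"
  by (simp add: Y_def time_block_0 nlogn_def)

lemma Y_second_moment: "expectation (\<lambda>x. (Y n x t)\<^sup>2) = intersections z (time_block n 0 t) (time_block n 0 t) / nlogn n"
    "integrable M (\<lambda>x. (Y n x t)\<^sup>2)"
  using second_moment_path[of "time_block n 0 t" z] nlogn_nonneg[of n]
  by (auto simp: Y_eq power_divide)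

lemma Y_iexp_tendsto:
  fixes ts u :: "nat \<Rightarrow> real"
  assumes ts: "\<And>j. j < k \<Longrightarrow> 0 \<le> ts j \<and> ts j \<le> 1"
  shows "(\<lambda>n. expectation (\<lambda>x. iexp (\<Sum>j<k. u j * Y n x (ts j))))
    \<longlonglongrightarrow> exp (- (C * (\<Sum>j<k. \<Sum>j'<k. u j * u j' * min (ts j) (ts j'))) / 2)"
proof -
  let ?I = "\<lambda>n j. time_block n 0 (ts j)"
  define F where "F n = z ` {..<n}" for n :: nat
  have F: "finite (F n)" "j < k \<Longrightarrow> z ` ?I n j \<subseteq> F n" for n j
    using time_block_subset[of "ts j" n] ts[of j] by (auto simp: F_def)
  define a where "a n l = (\<Sum>j<k. u j * occupation z (?I n j) l) / sqrt (nlogn n)" for n l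
  have lin: "(\<Sum>j<k. u j * Y n x (ts j)) = (\<Sum>l\<in>F n. a n l * X l x)" for n x
  proof -
    have "(\<Sum>j<k. u j * Y n x (ts j)) = (\<Sum>j<k. u j * (\<Sum>l\<in>F n. occupation z (?I n j) l * X l x)) / sqrt (nlogn n)"
      unfolding sum_divide_distrib
    proof (intro sum.cong refl)
      fix j assume "j \<in> {..<k}"
      then have "(\<Sum>i\<in>?I n j. X (z i) x) = (\<Sum>l\<in>F n. occupation z (?I n j) l * X l x)"
        by (intro sum_sites_eq_occupation[where f="\<lambda>l. X l x"] F) auto
      then show "u j * Y n x (ts j) = u j * (\<Sum>l\<in>F n. occupation z (?I n j) l * X l x) / sqrt (nlogn n)"
        by (simp add: Y_eq)
    qed
    also have "(\<Sum>j<k. u j * (\<Sum>l\<in>F n. occupation z (?I n j) l * X l x)) = (\<Sum>l\<in>F n. (\<Sum>j<k. u j * occupation z (?I n j) l) * X l x)"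
      unfolding sum_distrib_left sum_distrib_right by (subst sum.swap) (simp add: mult.assoc)
    finally show ?thesis unfolding a_def times_divide_eq_left sum_divide_distrib[of _ "F n"] .
  qed
  have sq: "(\<Sum>l\<in>F n. (a n l)\<^sup>2) = (\<Sum>j<k. \<Sum>j'<k. u j * u j' * (intersections z (?I n j) (?I n j') / nlogn n))" for n
  proof -
    have "(\<Sum>l\<in>F n. (a n l)\<^sup>2) = (\<Sum>l\<in>F n. (\<Sum>j<k. u j * occupation z (?I n j) l)\<^sup>2) / nlogn n"
      by (simp only: a_def power_divide real_sqrt_pow2[OF nlogn_nonneg] sum_divide_distrib[of _ "F n"])
    also have "(\<Sum>l\<in>F n. (\<Sum>j<k. u j * occupation z (?I n j) l)\<^sup>2)
        = (\<Sum>l\<in>F n. \<Sum>j<k. \<Sum>j'<k. u j * u j' * (occupation z (?I n j) l * occupation z (?I n j') l))"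
      by (simp add: power2_eq_square sum_product mult_ac)
    also have "\<dots> = (\<Sum>j<k. \<Sum>j'<k. \<Sum>l\<in>F n. u j * u j' * (occupation z (?I n j) l * occupation z (?I n j') l))"
      by (subst sum.swap, rule sum.cong[OF refl], rule sum.swap)
    also have "\<dots> = (\<Sum>j<k. \<Sum>j'<k. u j * u j' * intersections z (?I n j) (?I n j'))"
      unfolding sum_distrib_left[symmetric]
      by (intro sum.cong refl arg_cong2[where f="(*)"] intersections_eq_sum_occupation[symmetric] F) auto
    finally show ?thesis by (simp add: sum_divide_distrib)
  qed
  have sqlim: "(\<lambda>n. \<Sum>l\<in>F n. (a n l)\<^sup>2) \<longlonglongrightarrow> (\<Sum>j<k. \<Sum>j'<k. u j * u j' * (C * min (ts j) (ts j')))"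
    unfolding sq by (intro tendsto_sum tendsto_mult tendsto_const intersections_tendsto) (use ts in auto)
  define U where "U = (\<Sum>j<k. \<bar>u j\<bar>)"
  \<comment> \<open>Bounds all weights at once; the inserted 0 keeps \<open>Max\<close> meaningful
    at n = 0, where no site has been visited.\<close>
  define mx where "mx n = U * (Max (insert 0 (occupation z {..<n} ` F n)) / sqrt (nlogn n))" for n
  have U0: "0 \<le> U" by (simp add: U_def sum_nonneg)
  have occ_max: "occupation z {..<n} l \<le> Max (insert 0 (occupation z {..<n} ` F n))" if "l \<in> F n" for n l
    using F that by (intro Max_ge) auto
  have small: "\<bar>a n l\<bar> \<le> mx n" if l: "l \<in> F n" for n l
  proof -
    have "\<bar>\<Sum>j<k. u j * occupation z (?I n j) l\<bar> \<le> (\<Sum>j<k. \<bar>u j\<bar> * occupation z {..<n} l)"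
      by (rule order_trans[OF sum_abs])
         (use ts in \<open>auto simp: abs_mult occupation_nonneg intro!: sum_mono mult_left_mono occupation_mono time_block_subset\<close>)
    also have "\<dots> \<le> U * Max (insert 0 (occupation z {..<n} ` F n))"
      unfolding sum_distrib_right[symmetric] U_def[symmetric] by (intro mult_left_mono occ_max l U0)
    finally show ?thesis
      using nlogn_nonneg[of n] by (simp add: a_def mx_def abs_divide divide_right_mono)
  qed
  have mx0: "(\<lambda>n. Max (insert 0 (occupation z {..<n} ` F n)) / sqrt (nlogn n)) \<longlonglongrightarrow> 0"
  proof (rule tendstoI)
    fix e :: real assume "e > 0"
    then have "e / 2 > 0" by simp
    from occupation_small[OF this] eventually_ge_at_top[of 2]
    show "\<forall>\<^sub>F n in sequentially. dist (Max (insert 0 (occupation z {..<n} ` F n)) / sqrt (nlogn n)) 0 < e"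
    proof eventually_elim
      case (elim n)
      have Q: "0 < sqrt (nlogn n)" using nlogn_pos[OF elim(2)] by simp
      have "Max (insert 0 (occupation z {..<n} ` F n)) \<le> e / 2 * sqrt (nlogn n)"
        using elim F Q \<open>e > 0\<close> by (intro Max.boundedI) auto
      then have "Max (insert 0 (occupation z {..<n} ` F n)) / sqrt (nlogn n) \<le> e / 2"
        using Q by (simp add: divide_le_eq)
      moreover have "0 \<le> Max (insert 0 (occupation z {..<n} ` F n))"
        using F by (intro Max_ge) auto
      then have "0 \<le> Max (insert 0 (occupation z {..<n} ` F n)) / sqrt (nlogn n)" using Q by simp
      ultimately have "\<bar>Max (insert 0 (occupation z {..<n} ` F n)) / sqrt (nlogn n)\<bar> < e"
        using \<open>e > 0\<close> by linarith
      then show ?case by (simp only: dist_real_def diff_zero)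
    qed
  qed
  have "mx \<longlonglongrightarrow> U * 0" unfolding mx_def by (intro tendsto_mult tendsto_const mx0)
  then have mx: "mx \<longlonglongrightarrow> 0" by simp
  have "(\<lambda>n. expectation (\<lambda>x. iexp (\<Sum>l\<in>F n. a n l * X l x))) \<longlonglongrightarrow>
      exp (- (\<Sum>j<k. \<Sum>j'<k. u j * u j' * (C * min (ts j) (ts j'))) / 2)"
    by (rule expectation_iexp_weighted_sum_tendsto[OF indep ident L2 mean var F(1) sqlim mx small])
  also have "(\<Sum>j<k. \<Sum>j'<k. u j * u j' * (C * min (ts j) (ts j'))) = C * (\<Sum>j<k. \<Sum>j'<k. u j * u j' * min (ts j) (ts j'))"
    by (simp add: sum_distrib_left mult_ac)
  finally show ?thesis unfolding lin .
qed

lemma proc_meas: "(\<lambda>x j. if j < k then Y n x (ts j) else 0) \<in> measurable M (borel :: (nat \<Rightarrow> real) measure)"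
  by (rule measurable_coordinatewise_then_product) simp

text \<open>Beside the characteristic functions, the criterion asks for one box that serves all n.
  It exists because the second moments of \<open>Y n\<close> at the given times converge and so are
  bounded, which feeds Chebyshev's inequality.\<close>

lemma fdd_convergence:
  assumes ts: "\<And>j. j < k \<Longrightarrow> 0 \<le> ts j \<and> ts j \<le> 1" and mono: "\<And>i j. i \<le> j \<Longrightarrow> j < k \<Longrightarrow> ts i \<le> ts j"
  shows "weak_conv_top (\<lambda>n. proc_fdd M (Y n) ts k) (wiener_fdd (sqrt C) ts k)"
proof (rule weak_conv_top_iexpI[where k=k])
  show "prob_space (proc_fdd M (Y n) ts k)" for n
    unfolding proc_fdd_def by (rule prob_space_distr[OF proc_meas])
  show "sets (proc_fdd M (Y n) ts k) = sets borel" for n by (simp add: proc_fdd_def)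
  show "AE y in proc_fdd M (Y n) ts k. \<forall>j\<ge>k. y j = 0" for n
    unfolding proc_fdd_def
  proof (subst AE_distr_iff[OF proc_meas])
    have "closed {y :: nat \<Rightarrow> real. \<forall>j\<ge>k. y j = 0}"
      by (intro closed_Collect_all closed_Collect_imp open_Collect_const closed_Collect_eq continuous_on_product_coordinates) auto
    then show "{x \<in> space borel. \<forall>j\<ge>k. x j = (0::real)} \<in> sets borel" by simp
  qed simp
  have openB: "open {y :: nat \<Rightarrow> real. \<exists>j<k. \<bar>y j\<bar> > b}" for b
    by (intro open_Collect_ex open_Collect_conj open_Collect_const open_Collect_less continuous_intros
        continuous_on_product_coordinates)
  show "\<exists>b>0. (\<forall>n. measure (proc_fdd M (Y n) ts k) {y. \<exists>j<k. \<bar>y j\<bar> > b} \<le> e)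
        \<and> measure (wiener_fdd (sqrt C) ts k) {y. \<exists>j<k. \<bar>y j\<bar> > b} \<le> e" if "e > 0" for e :: real
  proof -
    interpret W: prob_space "wiener_fdd (sqrt C) ts k" by (rule prob_space_wiener_fdd)
    have spW: "space (wiener_fdd (sqrt C) ts k) = UNIV" by (simp add: wiener_fdd_def)
    have "(\<lambda>y. y j) \<in> borel_measurable (wiener_fdd (sqrt C) ts k)" for j
      by (simp add: measurable_cong_sets[OF sets_wiener_fdd refl] borel_measurable_continuous_onI)
    from W.measure_abs_gt_tendsto_0[of "\<lambda>j y. y j", OF this, of k]
    have "(\<lambda>i. measure (wiener_fdd (sqrt C) ts k) {y. \<exists>j<k. \<bar>y j\<bar> > real i}) \<longlonglongrightarrow> 0"
      by (simp add: spW)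
    from order_tendstoD(2)[OF this that] obtain i0 where i0:
      "\<And>i. i \<ge> i0 \<Longrightarrow> measure (wiener_fdd (sqrt C) ts k) {y. \<exists>j<k. \<bar>y j\<bar> > real i} < e"
      by (auto simp: eventually_sequentially)
    have "\<exists>B. \<forall>n. \<forall>j<k. expectation (\<lambda>x. (Y n x (ts j))\<^sup>2) \<le> B"
    proof -
      have "\<exists>B. \<forall>n. expectation (\<lambda>x. (Y n x (ts j))\<^sup>2) \<le> B" if "j < k" for j
      proof -
        have "Bseq (\<lambda>n. intersections z (time_block n 0 (ts j)) (time_block n 0 (ts j)) / nlogn n)"
          by (rule convergent_imp_Bseq, rule convergentI, rule self_intersections) (use ts[OF that] in auto)
        then obtain B where "\<And>n. norm (intersections z (time_block n 0 (ts j)) (time_block n 0 (ts j)) / nlogn n) \<le> B"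
          by (auto simp: Bseq_def)
        then show ?thesis unfolding Y_second_moment by (metis abs_le_D1 real_norm_def)
      qed
      then obtain B where B: "\<And>j n. j < k \<Longrightarrow> expectation (\<lambda>x. (Y n x (ts j))\<^sup>2) \<le> B j" by metis
      have B': "B j \<le> (\<Sum>j<k. \<bar>B j\<bar>)" if "j < k" for j
        using member_le_sum[of j "{..<k}" "\<lambda>j. \<bar>B j\<bar>"] that by auto
      show ?thesis using B B' by (meson order_trans)
    qed
    then obtain B where B: "\<And>n j. j < k \<Longrightarrow> expectation (\<lambda>x. (Y n x (ts j))\<^sup>2) \<le> B" by blast
    obtain i1 :: nat where i1: "i1 > real k * max 0 B / e" using reals_Archimedean2 by blast
    define i where "i = Suc (max i0 i1)"
    have i: "i \<ge> i0" "real i \<ge> 1" "real k * max 0 B / e \<le> real i" using i1 by (auto simp: i_def)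
    have bnd: "measure (proc_fdd M (Y n) ts k) {y. \<exists>j<k. \<bar>y j\<bar> > real i} \<le> e" for n
    proof -
      have "measure (proc_fdd M (Y n) ts k) {y. \<exists>j<k. \<bar>y j\<bar> > real i}
          = prob ((\<lambda>x j. if j < k then Y n x (ts j) else 0) -` {y. \<exists>j<k. \<bar>y j\<bar> > real i} \<inter> space M)"
        unfolding proc_fdd_def using openB[of "real i"] by (intro measure_distr proc_meas) auto
      also have "\<dots> \<le> prob (\<Union>j<k. {x \<in> space M. \<bar>Y n x (ts j)\<bar> \<ge> real i})"
        by (rule finite_measure_mono) (auto split: if_splits intro: less_imp_le)
      also have "\<dots> \<le> (\<Sum>j<k. prob {x \<in> space M. \<bar>Y n x (ts j)\<bar> \<ge> real i})"
        by (rule finite_measure_subadditive_finite) auto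
      also have "\<dots> \<le> (\<Sum>j<k. max 0 B / real i)"
      proof (rule sum_mono)
        fix j assume j: "j \<in> {..<k}"
        have "prob {x \<in> space M. \<bar>Y n x (ts j)\<bar> \<ge> real i} \<le> expectation (\<lambda>x. (Y n x (ts j))\<^sup>2) / (real i)\<^sup>2"
          by (rule second_moment_method) (use i Y_second_moment(2) in auto)
        also have "\<dots> \<le> max 0 B / (real i)\<^sup>2" using B[of j n] j by (intro divide_right_mono) auto
        also have "\<dots> \<le> max 0 B / real i"
          using i(2) by (intro divide_left_mono) (auto simp: power2_eq_square)
        finally show "prob {x \<in> space M. \<bar>Y n x (ts j)\<bar> \<ge> real i} \<le> max 0 B / real i" .
      qed
      also have "\<dots> = real k * max 0 B / real i" by simp
      also have "\<dots> \<le> e" using i that by (simp add: divide_le_eq mult.commute)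
      finally show ?thesis .
    qed
    show ?thesis
      by (intro exI[of _ "real i"]) (use i bnd i0[OF i(1)] in auto)
  qed
  fix u :: "nat \<Rightarrow> real"
  have meas: "(\<lambda>y. iexp (\<Sum>j<k. u j * y j)) \<in> borel_measurable (borel :: (nat \<Rightarrow> real) measure)"
    by (intro borel_measurable_continuous_onI continuous_intros continuous_on_product_coordinates)
  have 1: "(\<integral>y. iexp (\<Sum>j<k. u j * y j) \<partial>proc_fdd M (Y n) ts k) = expectation (\<lambda>x. iexp (\<Sum>j<k. u j * Y n x (ts j)))" for n
    unfolding proc_fdd_def by (subst integral_distr[OF proc_meas meas]) simp
  have 2: "(\<Sum>j<k. \<Sum>j'<k. u j * u j' * min (ts j) (ts j')) = (\<Sum>j<k. \<Sum>j'<k. u j * u j' * ts (min j j'))"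
    by (intro sum.cong refl arg_cong2[where f="(*)"]) (auto simp: min_def intro!: antisym mono)
  have 3: "(\<integral>y. iexp (\<Sum>j<k. u j * y j) \<partial>wiener_fdd (sqrt C) ts k)
      = exp (- (C * (\<Sum>j<k. \<Sum>j'<k. u j * u j' * ts (min j j'))) / 2)"
    by (subst wiener_fdd_iexp) (use ts mono C_pos in auto)
  show "(\<lambda>n. \<integral>y. iexp (\<Sum>j<k. u j * y j) \<partial>proc_fdd M (Y n) ts k)
      \<longlonglongrightarrow> (\<integral>y. iexp (\<Sum>j<k. u j * y j) \<partial>wiener_fdd (sqrt C) ts k)"
    unfolding 1 3 2[symmetric] by (rule Y_iexp_tendsto[OF ts])
qed (rule prob_space_wiener_fdd sets_wiener_fdd AE_wiener_fdd_zero)+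

end

section \<open>Quenched tightness\<close>

text \<open>Only the block of t and the next one can contain t', so the way from t to t' has at most
  three legs, each measured from the left end of a block; one of them carries a third of the
  oscillation.\<close>

lemma block_cover:
  fixes y :: "real \<Rightarrow> real" and m :: nat and e t t' :: real
  assumes m: "m > 0" and t: "0 \<le> t" "t \<le> t'" "t' \<le> 1" "t' - t \<le> 1 / m" and big: "\<bar>y t' - y t\<bar> \<ge> 3 * e"
  shows "\<exists>b<m. \<exists>s. real b / m \<le> s \<and> s \<le> real (Suc b) / m \<and> \<bar>y s - y (real b / m)\<bar> \<ge> e"
proof -
  \<comment> \<open>The cap at m - 1 puts t = 1 into the last block.\<close>
  define b where "b = min (nat \<lfloor>m * t\<rfloor>) (m - 1)"
  have bm: "b < m" using m by (simp add: b_def min_less_iff_disj)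
  have "0 \<le> m * t" using m t by simp
  then have "real b \<le> m * t" unfolding b_def by linarith
  then have b1: "real b / m \<le> t" using m by (simp add: field_simps)
  have "m * t \<le> real m" using t m by simp
  have "m * t \<le> real (Suc b)"
  proof (cases "nat \<lfloor>m * t\<rfloor> \<le> m - 1")
    case True
    then have "b = nat \<lfloor>m * t\<rfloor>" by (simp add: b_def)
    then show ?thesis by linarith
  next
    case False
    then have "b = m - 1" by (simp add: b_def)
    then show ?thesis using \<open>m * t \<le> real m\<close> m by simp
  qed
  then have b2: "t \<le> real (Suc b) / m" using m by (simp add: field_simps)
  show ?thesis
  proof (cases "t' \<le> real (Suc b) / m")
    case True
    have "\<bar>y t' - y (real b / m)\<bar> \<ge> e \<or> \<bar>y t - y (real b / m)\<bar> \<ge> e" using big by linarith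
    moreover have "real b / m \<le> t'" using b1 t by linarith
    ultimately show ?thesis using bm b1 b2 True by blast
  next
    case False
    then have lt: "real (Suc b) / m < t'" by simp
    have sb: "Suc b < m"
    proof (rule ccontr)
      assume "\<not> Suc b < m"
      then have "real (Suc b) / m = 1" using bm m by (simp add: not_less)
      then show False using lt t by simp
    qed
    have "t' \<le> real (Suc b) / m + 1 / m" using t b2 by linarith
    also have "\<dots> = real (Suc (Suc b)) / m" by (simp add: add_divide_distrib)
    finally have b3: "t' \<le> real (Suc (Suc b)) / m" .
    have "\<bar>y t - y (real b / m)\<bar> \<ge> e \<or> \<bar>y (real (Suc b) / m) - y (real b / m)\<bar> \<ge> e \<or> \<bar>y t' - y (real (Suc b) / m)\<bar> \<ge> e"
      using big by linarith
    then show ?thesis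
    proof (elim disjE)
      assume "\<bar>y t - y (real b / m)\<bar> \<ge> e"
      then show ?thesis using bm b1 b2 by blast
    next
      assume "\<bar>y (real (Suc b) / m) - y (real b / m)\<bar> \<ge> e"
      then show ?thesis using bm b1 b2 by (meson order_refl order_trans)
    next
      assume "\<bar>y t' - y (real (Suc b) / m)\<bar> \<ge> e"
      then show ?thesis using sb b3 less_imp_le[OF lt] by blast
    qed
  qed
qed

context quenched_scenery begin

lemma Y_diff:
  assumes "0 \<le> s" "s \<le> t"
  shows "Y n x t - Y n x s = (\<Sum>i\<in>time_block n s t. X (z i) x) / sqrt (nlogn n)"
  using time_block_Un[OF assms, of n]
  by (simp add: Y_eq sum.union_disjoint add_divide_distrib)

text \<open>Within a block the process runs through the partial sums over the list of visited sites,
  and Newman-Wright applies with s^2 the number of self-intersections of the block. By the bounds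
  \<open>V\<close>, the shift sqrt 2 * s costs at most half of the level 2 e; the remaining e is
  left for the endpoint, where Markov's inequality is applied to the truncated fourth power.\<close>

lemma block_maximal_inequality:
  fixes m b n :: nat and e :: real
  defines "B \<equiv> time_block n (real b / m) (real (Suc b) / m)"
  assumes m: "m > 0" and e: "e > 0" and n: "n \<ge> 2"
    and V: "0 < intersections z B B" "sqrt (2 * intersections z B B) \<le> e * sqrt (nlogn n)"
  shows "prob {x \<in> space M. \<exists>s. real b / m \<le> s \<and> s \<le> real (Suc b) / m \<and> \<bar>Y n x s - Y n x (real b / m)\<bar> \<ge> 2 * e}
    \<le> 4 * expectation (\<lambda>x. min 1 (((Y n x (real (Suc b) / m) - Y n x (real b / m)) / e) ^ 4))"
    and "{x \<in> space M. \<exists>s. real b / m \<le> s \<and> s \<le> real (Suc b) / m \<and> \<bar>Y n x s - Y n x (real b / m)\<bar> \<ge> 2 * e} \<in> events"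
proof -
  let ?E = "{x \<in> space M. \<exists>s. real b / m \<le> s \<and> s \<le> real (Suc b) / m \<and> \<bar>Y n x s - Y n x (real b / m)\<bar> \<ge> 2 * e}"
  let ?k = "\<lambda>t. nat \<lfloor>real n * t\<rfloor>"
  let ?s = "real b / m" and ?t = "real (Suc b) / m"
  have st: "0 \<le> ?s" "?s \<le> ?t" by (auto simp: divide_right_mono)
  define ks where "ks = [?k ?s..<?k ?t]"
  define zs where "zs = map z ks"
  define Q where "Q = sqrt (nlogn n)"
  have Q: "Q > 0" using nlogn_pos[OF n] by (simp add: Q_def)
  have kk: "?k a \<le> ?k c" if "a \<le> c" for a c
    using that by (intro nat_mono floor_mono mult_left_mono) auto
  have path: "path_sum (take r zs) (\<lambda>l. X l x) = (\<Sum>i\<in>{?k ?s..<min (?k ?s + r) (?k ?t)}. X (z i) x)" for r x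
  proof -
    have "take r ks = [?k ?s..<min (?k ?s + r) (?k ?t)]"
      unfolding ks_def by (cases "?k ?s + r \<le> ?k ?t") (auto simp: min_def)
    then show ?thesis
      by (simp add: zs_def take_map comp_def interv_sum_list_conv_sum_set_nat)
  qed
  have full: "path_sum zs (\<lambda>l. X l x) = (\<Sum>i\<in>B. X (z i) x)" for x
    using path[of x "length zs"] kk[OF st(2)] by (simp add: zs_def ks_def B_def time_block_def)
  have Yd: "Y n x ?t - Y n x ?s = path_sum zs (\<lambda>l. X l x) / Q" for x
    unfolding full Q_def B_def by (rule Y_diff[OF st])
  define s where "s = sqrt (intersections z B B)"
  have s: "s > 0" "s\<^sup>2 = intersections z B B" using V by (auto simp: s_def)
  have finB: "finite B" by (simp add: B_def)
  have s2: "sqrt 2 * s \<le> e * Q" using V by (simp add: s_def Q_def real_sqrt_mult)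
  \<comment> \<open>A condition on a continuum of times becomes one on prefix lengths, which also
    gives measurability.\<close>
  have Eeq: "?E = {x \<in> space M. \<exists>r. \<bar>path_sum (take r zs) (\<lambda>l. X l x)\<bar> \<ge> 2 * e * Q}"
  proof (intro Collect_cong conj_cong refl)
    fix x
    show "(\<exists>s. ?s \<le> s \<and> s \<le> ?t \<and> \<bar>Y n x s - Y n x ?s\<bar> \<ge> 2 * e)
      \<longleftrightarrow> (\<exists>r. \<bar>path_sum (take r zs) (\<lambda>l. X l x)\<bar> \<ge> 2 * e * Q)" (is "?L = ?R")
    proof
      assume ?L
      then obtain s where s: "?s \<le> s" "s \<le> ?t" "\<bar>Y n x s - Y n x ?s\<bar> \<ge> 2 * e" by blast
      have "Y n x s - Y n x ?s = (\<Sum>i\<in>{?k ?s..<?k s}. X (z i) x) / Q"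
        using Y_diff[OF st(1) s(1)] by (simp add: Q_def time_block_def)
      also have "(\<Sum>i\<in>{?k ?s..<?k s}. X (z i) x) = path_sum (take (?k s - ?k ?s) zs) (\<lambda>l. X l x)"
        using path[of x "?k s - ?k ?s"] kk[OF s(1)] kk[OF s(2)] by (simp add: min_def)
      finally have "\<bar>path_sum (take (?k s - ?k ?s) zs) (\<lambda>l. X l x)\<bar> / Q \<ge> 2 * e" using s(3) Q by simp
      then show ?R using Q by (auto simp: le_divide_eq)
    next
      assume ?R
      then obtain r where r: "\<bar>path_sum (take r zs) (\<lambda>l. X l x)\<bar> \<ge> 2 * e * Q" by blast
      define q where "q = min (?k ?s + r) (?k ?t)"
      \<comment> \<open>Rounding down may place q / n to the left of the block; the left end of the
        block then has the floor q as well.\<close>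
      define u where "u = max ?s (real q / n)"
      have n0: "real n > 0" using n by simp
      have q: "?k ?s \<le> q" "q \<le> ?k ?t" using kk[OF st(2)] by (auto simp: q_def)
      have "real q \<le> real n * ?t"
      proof -
        have "real (?k ?t) \<le> real n * ?t" using st by (intro of_nat_floor) auto
        then show ?thesis using q(2) by linarith
      qed
      then have "real q / n \<le> ?t" using n0 by (simp add: divide_le_eq mult.commute)
      then have u: "?s \<le> u" "u \<le> ?t" using st by (auto simp: u_def)
      have "?k u = q"
      proof (cases "?s \<le> real q / n")
        case True
        then have "real n * u = real q" using n0 by (simp add: u_def)
        then show ?thesis by simp
      next
        case False
        then have "real q < real n * ?s" using n0 by (simp add: not_le divide_less_eq mult.commute)
        then have "q \<le> ?k ?s" by (simp add: le_nat_floor)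
        then show ?thesis using q(1) False by (simp add: u_def)
      qed
      then have "Y n x u - Y n x ?s = path_sum (take r zs) (\<lambda>l. X l x) / Q"
        using Y_diff[OF st(1) u(1), of n x] by (simp add: path q_def Q_def time_block_def)
      then have "\<bar>Y n x u - Y n x ?s\<bar> \<ge> 2 * e"
        using r Q by (simp add: le_divide_eq)
      then show ?L using u by blast
    qed
  qed
  have [measurable]: "(\<lambda>x. path_sum (take r zs) (\<lambda>l. X l x)) \<in> borel_measurable M" for r
    unfolding path by measurable
  show "?E \<in> events" unfolding Eeq by measurable
  have "prob ?E \<le> 4 * prob {x \<in> space M. \<bar>path_sum zs (\<lambda>l. X l x)\<bar> \<ge> 2 * e * Q - sqrt 2 * s}"
    unfolding Eeq
  proof (rule newman_wright_inequality)
    show "indep_vars (\<lambda>_. borel) X (set zs)" by (rule indep_vars_subset[OF indep]) auto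
    show "expectation (\<lambda>x. (path_sum zs (\<lambda>l. X l x))\<^sup>2) \<le> s\<^sup>2"
      unfolding full second_moment_path[OF finB] s(2) ..
    have "0 < e * Q" using e Q by simp
    then show "sqrt 2 * s < 2 * e * Q" using s2 by simp
  qed (use s L2 mean in auto)
  also have "\<dots> \<le> 4 * prob {x \<in> space M. min 1 (((Y n x ?t - Y n x ?s) / e) ^ 4) \<ge> 1}"
  proof (intro mult_left_mono finite_measure_mono)
    show "{x \<in> space M. \<bar>path_sum zs (\<lambda>l. X l x)\<bar> \<ge> 2 * e * Q - sqrt 2 * s}
        \<subseteq> {x \<in> space M. min 1 (((Y n x ?t - Y n x ?s) / e) ^ 4) \<ge> 1}"
    proof safe
      fix x assume "\<bar>path_sum zs (\<lambda>l. X l x)\<bar> \<ge> 2 * e * Q - sqrt 2 * s"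
      then have "e * Q \<le> \<bar>path_sum zs (\<lambda>l. X l x)\<bar>" using s2 by linarith
      then have "1 \<le> \<bar>(Y n x ?t - Y n x ?s) / e\<bar>"
        unfolding Yd abs_divide using e Q by (simp add: le_divide_eq) (metis mult.commute)
      then have "1 \<le> \<bar>(Y n x ?t - Y n x ?s) / e\<bar> ^ 4" by (rule one_le_power)
      also have "\<bar>(Y n x ?t - Y n x ?s) / e\<bar> ^ 4 = ((Y n x ?t - Y n x ?s) / e) ^ 4"
        by (rule power_even_abs) simp
      finally show "1 \<le> min 1 (((Y n x ?t - Y n x ?s) / e) ^ 4)" by simp
    qed
  qed auto
  also have "\<dots> \<le> 4 * expectation (\<lambda>x. min 1 (((Y n x ?t - Y n x ?s) / e) ^ 4))"
  proof (rule mult_left_mono)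
    have int: "integrable M (\<lambda>x. min 1 (((Y n x ?t - Y n x ?s) / e) ^ 4))"
    proof (rule integrable_bounded[where B=1])
      fix x
      have "0 \<le> ((Y n x ?t - Y n x ?s) / e) ^ 4" by (rule zero_le_even_power) simp
      then show "\<bar>min 1 (((Y n x ?t - Y n x ?s) / e) ^ 4)\<bar> \<le> 1" by (simp only: abs_of_nonneg min.cobounded1 min.bounded_iff zero_le_one simp_thms)
    qed simp
    show "prob {x \<in> space M. min 1 (((Y n x ?t - Y n x ?s) / e) ^ 4) \<ge> 1}
        \<le> expectation (\<lambda>x. min 1 (((Y n x ?t - Y n x ?s) / e) ^ 4))"
      using integral_Markov_inequality_measure[OF int, where A="space M" and c=1] by simp
  qed simp
  finally show "prob ?E \<le> 4 * expectation (\<lambda>x. min 1 (((Y n x ?t - Y n x ?s) / e) ^ 4))" .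
qed

text \<open>In the limit each of the m blocks contributes at most 4 * 3 C^2 / (m^2 e^4), with 4 from
  Newman-Wright and 3 from the Gaussian fourth moment; the sum is O(1/m). The condition relating m
  and e makes the variance of a block, eventually below 2 C / m, small enough for the maximal
  inequality. The 6 e are three legs of size 2 e.\<close>

lemma tightness_bound:
  fixes m :: nat and e \<delta> \<epsilon> :: real
  assumes e: "e > 0" and m: "m > 0" "4 * C / m \<le> e\<^sup>2" and \<delta>: "0 < \<delta>" "\<delta> \<le> 1 / m" and eps: "6 * e < \<epsilon>"
  shows "limsup (\<lambda>n. emeasure M {x \<in> space M. (SUP p \<in> {(t, t'). t \<in> {0..1} \<and> t' \<in> {0..1} \<and> \<bar>t' - t\<bar> \<le> \<delta>}.
                ereal \<bar>Y n x (snd p) - Y n x (fst p)\<bar>) \<ge> ereal \<epsilon>}) \<le> ennreal (12 * C\<^sup>2 / (e ^ 4 * m))"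
    (is "limsup (\<lambda>n. emeasure M (?A n)) \<le> _")
proof -
  let ?B = "\<lambda>n b. time_block n (real b / m) (real (Suc b) / m)"
  let ?G = "\<lambda>n b. expectation (\<lambda>x. min 1 (((Y n x (real (Suc b) / m) - Y n x (real b / m)) / e) ^ 4))"
  let ?ts = "\<lambda>b j. if j = 0 then real b / real m else real (Suc b) / real m"
  let ?E = "\<lambda>n b. {x \<in> space M. \<exists>s. real b / m \<le> s \<and> s \<le> real (Suc b) / m \<and> \<bar>Y n x s - Y n x (real b / m)\<bar> \<ge> 2 * e}"
  define L where "L b = (\<integral>y. min 1 (((y 1 - y 0) / e) ^ 4) \<partial>wiener_fdd (sqrt C) (?ts b) 2)" for b
  have st: "0 \<le> real b / m" "real b / m \<le> real (Suc b) / m" "real (Suc b) / m \<le> 1" "real (Suc b) / m - real b / m = 1 / m"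
    if "b < m" for b
  proof -
    show "0 \<le> real b / m" "real b / m \<le> real (Suc b) / m" by (auto simp: divide_right_mono)
    show "real (Suc b) / m - real b / m = 1 / m" by (simp add: add_divide_distrib)
    have "real (Suc b) \<le> real m" using that by simp
    then show "real (Suc b) / m \<le> 1" using m by (simp add: divide_le_eq)
  qed
  have lim: "(\<lambda>n. ?G n b) \<longlonglongrightarrow> L b" if b: "b < m" for b
  proof -
    have w: "weak_conv_top (\<lambda>n. proc_fdd M (Y n) (?ts b) 2) (wiener_fdd (sqrt C) (?ts b) 2)"
      by (rule fdd_convergence) (use st[OF b] in \<open>auto simp del: of_nat_Suc\<close>)
    let ?g = "\<lambda>y :: nat \<Rightarrow> real. min 1 (((y 1 - y 0) / e) ^ 4)"
    have g: "continuous_on UNIV ?g"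
      using e by (intro continuous_intros continuous_on_product_coordinates) auto
    moreover have "bounded (range ?g)"
      by (rule boundedI[where B=1]) auto
    ultimately have "(\<lambda>n. \<integral>y. ?g y \<partial>proc_fdd M (Y n) (?ts b) 2) \<longlonglongrightarrow> L b"
      using w unfolding weak_conv_top_def L_def by blast
    moreover have "(\<integral>y. ?g y \<partial>proc_fdd M (Y n) (?ts b) 2) = ?G n b" for n
      unfolding proc_fdd_def by (subst integral_distr[OF proc_meas borel_measurable_continuous_onI[OF g]]) simp
    ultimately show ?thesis by simp
  qed
  have Lb: "L b \<le> 3 * C\<^sup>2 * (1 / m)\<^sup>2 / e ^ 4" if "b < m" for b
  proof -
    have "sqrt C ^ 4 = (sqrt C ^ 2) ^ 2" by (simp flip: power_mult)
    then have "sqrt C ^ 4 = C\<^sup>2" using C_pos by simp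
    then show ?thesis
      using wiener_fdd_increment_fourth_moment[of e "?ts b" "sqrt C"] st[OF that] e
      unfolding L_def by (simp del: of_nat_Suc)
  qed
  have Vlim: "(\<lambda>n. intersections z (?B n b) (?B n b) / nlogn n) \<longlonglongrightarrow> C / m" if "b < m" for b
    using self_intersections[OF st(1,2,3)[OF that]] st(4)[OF that] by simp
  have ev: "eventually (\<lambda>n. \<forall>b\<in>{..<m}. 0 < intersections z (?B n b) (?B n b) / nlogn n
      \<and> intersections z (?B n b) (?B n b) / nlogn n < 2 * C / m) sequentially"
  proof (rule eventually_ball_finite, simp, rule ballI, rule eventually_conj)
    fix b assume "b \<in> {..<m}"
    then have b: "b < m" by simp
    show "eventually (\<lambda>n. 0 < intersections z (?B n b) (?B n b) / nlogn n) sequentially"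
      by (rule order_tendstoD(1)[OF Vlim[OF b]]) (use C_pos m in auto)
    show "eventually (\<lambda>n. intersections z (?B n b) (?B n b) / nlogn n < 2 * C / m) sequentially"
      by (rule order_tendstoD(2)[OF Vlim[OF b]]) (use C_pos m in \<open>auto intro!: divide_strict_right_mono\<close>)
  qed
  have bound: "eventually (\<lambda>n. emeasure M (?A n) \<le> ennreal (\<Sum>b<m. 4 * ?G n b)) sequentially"
    using ev eventually_ge_at_top[of 2]
  proof eventually_elim
    case (elim n)
    have Q: "0 < nlogn n" by (rule nlogn_pos[OF elim(2)])
    have blk: "prob (?E n b) \<le> 4 * ?G n b" "?E n b \<in> events" if b: "b < m" for b
    proof -
      have V: "0 < intersections z (?B n b) (?B n b)" "intersections z (?B n b) (?B n b) < 2 * C / m * nlogn n"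
        using elim(1)[rule_format, of b] b Q by (auto simp: zero_less_divide_iff divide_less_eq)
      have "2 * intersections z (?B n b) (?B n b) \<le> 4 * C / m * nlogn n" using V by simp
      also have "\<dots> \<le> e\<^sup>2 * nlogn n" using m Q by (intro mult_right_mono) auto
      finally have "sqrt (2 * intersections z (?B n b) (?B n b)) \<le> sqrt (e\<^sup>2 * nlogn n)" by simp
      also have "\<dots> = e * sqrt (nlogn n)" using e by (simp add: real_sqrt_mult)
      finally show "prob (?E n b) \<le> 4 * ?G n b" "?E n b \<in> events"
        using block_maximal_inequality[OF m(1) e elim(2), of b] V(1) by auto
    qed
    have "?A n \<subseteq> (\<Union>b<m. ?E n b)"
    proof
      fix x assume x: "x \<in> ?A n"
      have "ereal (6 * e) < ereal \<epsilon>" using eps by simp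
      also have "ereal \<epsilon> \<le> (SUP p \<in> {(t, t'). t \<in> {0..1} \<and> t' \<in> {0..1} \<and> \<bar>t' - t\<bar> \<le> \<delta>}.
                ereal \<bar>Y n x (snd p) - Y n x (fst p)\<bar>)"
        using x by simp
      finally obtain t t' where t: "t \<in> {0..1}" "t' \<in> {0..1}" "\<bar>t' - t\<bar> \<le> \<delta>" "6 * e < \<bar>Y n x t' - Y n x t\<bar>"
        unfolding less_SUP_iff by auto
      define p q where p_def: "p = min t t'" and q_def: "q = max t t'"
      have pq: "0 \<le> p" "p \<le> q" "q \<le> 1" "q - p \<le> 1 / m" "3 * (2 * e) \<le> \<bar>Y n x q - Y n x p\<bar>"
        using t \<delta> by (auto simp: p_def q_def min_def max_def abs_minus_commute)
      from block_cover[where y="Y n x", OF m(1) pq] x show "x \<in> (\<Union>b<m. ?E n b)" by auto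
    qed
    then have "emeasure M (?A n) \<le> emeasure M (\<Union>b<m. ?E n b)"
      using blk(2) by (intro emeasure_mono) auto
    also have "\<dots> = ennreal (prob (\<Union>b<m. ?E n b))" by (rule emeasure_eq_measure)
    also have "prob (\<Union>b<m. ?E n b) \<le> (\<Sum>b<m. prob (?E n b))"
      by (rule finite_measure_subadditive_finite) (use blk in auto)
    also have "\<dots> \<le> (\<Sum>b<m. 4 * ?G n b)" by (rule sum_mono) (use blk in auto)
    finally show ?case by (simp add: ennreal_leI)
  qed
  have "(\<lambda>n. \<Sum>b<m. 4 * ?G n b) \<longlonglongrightarrow> (\<Sum>b<m. 4 * L b)"
    by (intro tendsto_sum tendsto_mult tendsto_const lim) auto
  then have "(\<lambda>n. ennreal (\<Sum>b<m. 4 * ?G n b)) \<longlonglongrightarrow> ennreal (\<Sum>b<m. 4 * L b)"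
    by (rule tendsto_ennrealI)
  then have 1: "limsup (\<lambda>n. ennreal (\<Sum>b<m. 4 * ?G n b)) = ennreal (\<Sum>b<m. 4 * L b)"
    by (intro lim_imp_Limsup) auto
  have "(\<Sum>b<m. 4 * L b) \<le> (\<Sum>b<m. 4 * (3 * C\<^sup>2 * (1 / m)\<^sup>2 / e ^ 4))"
    by (intro sum_mono mult_left_mono Lb) auto
  also have "\<dots> = 12 * C\<^sup>2 / (e ^ 4 * m)"
    using m e by (simp add: field_simps power2_eq_square)
  finally have 2: "ennreal (\<Sum>b<m. 4 * L b) \<le> ennreal (12 * C\<^sup>2 / (e ^ 4 * m))" by (rule ennreal_leI)
  show ?thesis
    by (rule order_trans[OF Limsup_mono[OF bound]]) (simp only: 1 2)
qed

theorem functional_clt: "satisfies_FCLT M Y (sqrt C)"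
  unfolding satisfies_FCLT_def
proof (intro conjI allI impI)
  fix k and ts :: "nat \<Rightarrow> real"
  assume "(\<forall>j<k. 0 \<le> ts j \<and> ts j \<le> 1) \<and> (\<forall>i j. i \<le> j \<and> j < k \<longrightarrow> ts i \<le> ts j)"
  then show "weak_conv_top (\<lambda>n. proc_fdd M (Y n) ts k) (wiener_fdd (sqrt C) ts k)"
    by (intro fdd_convergence) auto
next
  fix \<epsilon> :: real assume "\<epsilon> > 0"
  \<comment> \<open>Any divisor above 6 gives the strict inequality that
    \<open>tightness_bound\<close> requires.\<close>
  define e where "e = \<epsilon> / 7"
  have e: "e > 0" "6 * e < \<epsilon>" using \<open>\<epsilon> > 0\<close> by (auto simp: e_def)
  let ?h = "\<lambda>\<delta>. limsup (\<lambda>n. emeasure M {x \<in> space M. (SUP p \<in> {(t, t'). t \<in> {0..1} \<and> t' \<in> {0..1} \<and> \<bar>t' - t\<bar> \<le> \<delta>}.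
                ereal \<bar>Y n x (snd p) - Y n x (fst p)\<bar>) \<ge> ereal \<epsilon>})"
  show "(?h \<longlongrightarrow> 0) (at_right 0)"
  proof (rule order_tendstoI)
    fix a :: ennreal assume "0 < a"
    have "(\<lambda>m. ennreal (12 * C\<^sup>2 / e ^ 4 / real (Suc m))) \<longlonglongrightarrow> ennreal 0"
      by (rule tendsto_ennrealI, rule LIMSEQ_Suc, rule lim_const_over_n)
    then have ev1: "eventually (\<lambda>m. ennreal (12 * C\<^sup>2 / e ^ 4 / real (Suc m)) < a) sequentially"
      using \<open>0 < a\<close> by (intro order_tendstoD) auto
    have "(\<lambda>m. 4 * C / real (Suc m)) \<longlonglongrightarrow> 0"
      by (rule LIMSEQ_Suc, rule lim_const_over_n)
    then have ev2: "eventually (\<lambda>m. 4 * C / real (Suc m) < e\<^sup>2) sequentially"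
      by (rule order_tendstoD) (use e in auto)
    from eventually_happens'[OF sequentially_bot eventually_conj[OF ev1 ev2]]
    obtain m where m: "ennreal (12 * C\<^sup>2 / e ^ 4 / real (Suc m)) < a" "4 * C / real (Suc m) < e\<^sup>2" by blast
    have "?h \<delta> < a" if "0 < \<delta>" "\<delta> < 1 / real (Suc m)" for \<delta>
    proof -
      have "?h \<delta> \<le> ennreal (12 * C\<^sup>2 / (e ^ 4 * real (Suc m)))"
        by (rule tightness_bound[OF e(1) zero_less_Suc less_imp_le[OF m(2)] that(1) less_imp_le[OF that(2)] e(2)])
      also have "\<dots> < a" using m(1) by (simp only: divide_divide_eq_left)
      finally show ?thesis .
    qed
    moreover have "0 < 1 / real (Suc m)" by simp
    ultimately show "eventually (\<lambda>\<delta>. ?h \<delta> < a) (at_right 0)"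
      unfolding eventually_at_right_field by (meson zero_less_one)
  qed simp
qed

end

section \<open>Variance of the number of self-intersections\<close>

text \<open>A pair is determined up to order by its larger element and its gap, so every
  \<open>f p a\<close> is met at most twice. The companion below sorts by the smaller element
  instead.\<close>

lemma sum_max_absdiff_le:
  fixes f :: "nat \<Rightarrow> nat \<Rightarrow> real"
  assumes I: "I = {s..<s+m}" "m \<le> N" and f: "\<And>p a. 0 \<le> f p a"
  shows "(\<Sum>i\<in>I. \<Sum>i'\<in>I. f (max i i') (max i i' - min i i')) \<le> 2 * (\<Sum>p\<in>I. \<Sum>a<N. f p a)"
proof -
  have half: "(\<Sum>i'\<in>{i'\<in>I. i' \<le> i}. f i (i - i')) \<le> (\<Sum>a<N. f i a)" if "i \<in> I" for i
  proof -
    have "(\<Sum>i'\<in>{i'\<in>I. i' \<le> i}. f i (i - i')) = (\<Sum>a\<in>(\<lambda>i'. i - i') ` {i'\<in>I. i' \<le> i}. f i a)"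
      by (subst sum.reindex) (auto simp: inj_on_def)
    also have "\<dots> \<le> (\<Sum>a<N. f i a)"
      by (rule sum_mono2) (use I f that in auto)
    finally show ?thesis .
  qed
  have fI: "finite I" using I by simp
  have "(\<Sum>i\<in>I. \<Sum>i'\<in>I. f (max i i') (max i i' - min i i'))
     \<le> (\<Sum>i\<in>I. \<Sum>i'\<in>I. (if i' \<le> i then f i (i - i') else 0) + (if i \<le> i' then f i' (i' - i) else 0))"
    by (intro sum_mono) (use f in \<open>auto simp: max_def min_def\<close>)
  also have "\<dots> = (\<Sum>i\<in>I. \<Sum>i'\<in>I. (if i' \<le> i then f i (i - i') else 0)) + (\<Sum>i'\<in>I. \<Sum>i\<in>I. (if i \<le> i' then f i' (i' - i) else 0))"
    unfolding sum.distrib by (subst (4) sum.swap) simp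
  also have "\<dots> = 2 * (\<Sum>i\<in>I. \<Sum>i'\<in>{i'\<in>I. i' \<le> i}. f i (i - i'))"
    using fI by (simp add: sum.inter_filter)
  also have "\<dots> \<le> 2 * (\<Sum>p\<in>I. \<Sum>a<N. f p a)"
    by (intro mult_left_mono sum_mono half) auto
  finally show ?thesis .
qed

lemma sum_min_absdiff_le:
  fixes f :: "nat \<Rightarrow> nat \<Rightarrow> real"
  assumes I: "I = {s..<s+m}" "m \<le> N" and f: "\<And>p a. 0 \<le> f p a"
  shows "(\<Sum>i\<in>I. \<Sum>i'\<in>I. f (min i i') (max i i' - min i i')) \<le> 2 * (\<Sum>p\<in>I. \<Sum>a<N. f p a)"
proof -
  have half: "(\<Sum>i'\<in>{i'\<in>I. i \<le> i'}. f i (i' - i)) \<le> (\<Sum>a<N. f i a)" if "i \<in> I" for i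
  proof -
    have "(\<Sum>i'\<in>{i'\<in>I. i \<le> i'}. f i (i' - i)) = (\<Sum>a\<in>(\<lambda>i'. i' - i) ` {i'\<in>I. i \<le> i'}. f i a)"
      by (subst sum.reindex) (auto simp: inj_on_def)
    also have "\<dots> \<le> (\<Sum>a<N. f i a)"
      by (rule sum_mono2) (use I f that in auto)
    finally show ?thesis .
  qed
  have fI: "finite I" using I by simp
  have "(\<Sum>i\<in>I. \<Sum>i'\<in>I. f (min i i') (max i i' - min i i'))
     \<le> (\<Sum>i\<in>I. \<Sum>i'\<in>I. (if i \<le> i' then f i (i' - i) else 0) + (if i' \<le> i then f i' (i - i') else 0))"
    by (intro sum_mono) (use f in \<open>auto simp: max_def min_def\<close>)
  also have "\<dots> = (\<Sum>i\<in>I. \<Sum>i'\<in>I. (if i \<le> i' then f i (i' - i) else 0)) + (\<Sum>i'\<in>I. \<Sum>i\<in>I. (if i' \<le> i then f i' (i - i') else 0))"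
    unfolding sum.distrib by (subst (4) sum.swap) simp
  also have "\<dots> = 2 * (\<Sum>i\<in>I. \<Sum>i'\<in>{i'\<in>I. i \<le> i'}. f i (i' - i))"
    using fI by (simp add: sum.inter_filter)
  also have "\<dots> \<le> 2 * (\<Sum>p\<in>I. \<Sum>a<N. f p a)"
    by (intro mult_left_mono sum_mono half) auto
  finally show ?thesis .
qed

text \<open>The shell max i j = N has 2 N + 1 pairs of weight 1 / (N + 1) each and so contributes
  less than 2.\<close>

lemma sum_inverse_max_le: "(\<Sum>i<N. \<Sum>j<N. 1 / (real (max i j) + 1)) \<le> 2 * real N"
proof (induction N)
  case (Suc N)
  let ?f = "\<lambda>i j :: nat. 1 / (real (max i j) + 1)"
  have "(\<Sum>i<Suc N. \<Sum>j<Suc N. ?f i j) = (\<Sum>i<N. \<Sum>j<N. ?f i j) + (\<Sum>i<N. ?f i N) + (\<Sum>j<N. ?f N j) + ?f N N"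
    by (simp only: sum.lessThan_Suc sum.distrib add.assoc)
  also have "(\<Sum>i<N. ?f i N) = real N / (real N + 1)" by (simp add: max_def)
  also have "(\<Sum>j<N. ?f N j) = real N / (real N + 1)" by (simp add: max_def)
  also have "(\<Sum>i<N. \<Sum>j<N. ?f i j) + real N / (real N + 1) + real N / (real N + 1) + ?f N N
      = (\<Sum>i<N. \<Sum>j<N. ?f i j) + (2 * real N + 1) / (real N + 1)"
    by (simp add: add_divide_distrib)
  also have "\<dots> \<le> 2 * real N + 2"
    by (intro add_mono Suc.IH) (simp add: divide_le_eq)
  finally show ?case by simp
qed simp

text \<open>With i and j measured from the common boundary of the two adjacent blocks, the gap is i
  + j + 1, which is at least max i j.\<close>

lemma sum_inverse_gap_le:
  assumes "m \<le> N" "m' \<le> N"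
  shows "(\<Sum>p\<in>{s..<s+m}. \<Sum>q\<in>{s+m..<s+m+m'}. 1 / (real (q - p) + 1)) \<le> 2 * real N"
proof -
  have "(\<Sum>p\<in>{s..<s+m}. \<Sum>q\<in>{s+m..<s+m+m'}. 1 / (real (q - p) + 1))
      = (\<Sum>i<m. \<Sum>j<m'. 1 / (real (i + j + 1) + 1))"
  proof (rule sum.reindex_bij_witness[where i="\<lambda>i. s + m - 1 - i" and j="\<lambda>p. s + m - 1 - p"])
    fix p assume p: "p \<in> {s..<s+m}"
    show "(\<Sum>j<m'. 1 / (real ((s + m - 1 - p) + j + 1) + 1)) = (\<Sum>q\<in>{s+m..<s+m+m'}. 1 / (real (q - p) + 1))"
      by (rule sum.reindex_bij_witness[where i="\<lambda>q. q - (s + m)" and j="\<lambda>j. s + m + j"])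
         (use p in \<open>auto intro!: arg_cong[where f="\<lambda>n. 1 / (real n + 1)"]\<close>)
  qed auto
  also have "\<dots> \<le> (\<Sum>i<m. \<Sum>j<m'. 1 / (real (max i j) + 1))"
    by (intro sum_mono divide_left_mono) auto
  also have "\<dots> \<le> (\<Sum>i<N. \<Sum>j<m'. 1 / (real (max i j) + 1))"
    by (rule sum_mono2) (use assms in \<open>auto intro!: sum_nonneg\<close>)
  also have "\<dots> \<le> (\<Sum>i<N. \<Sum>j<N. 1 / (real (max i j) + 1))"
    by (intro sum_mono sum_mono2) (use assms in auto)
  also have "\<dots> \<le> 2 * real N" by (rule sum_inverse_max_le)
  finally show ?thesis .
qed

section \<open>Walks with independent steps in a countable group\<close>

locale countable_walk = prob_space P for P :: "'w measure" +
  fixes \<zeta> :: "nat \<Rightarrow> 'w \<Rightarrow> 'g::{ab_group_add, countable}"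
  assumes indep: "indep_vars (\<lambda>_. count_space UNIV) \<zeta> UNIV"
begin

definition inc :: "nat \<Rightarrow> nat \<Rightarrow> 'w \<Rightarrow> 'g" where
  "inc a b \<omega> = (\<Sum>m\<in>{a..<b}. \<zeta> m \<omega>)"

definition Z :: "'w \<Rightarrow> nat \<Rightarrow> 'g" where "Z \<omega> i = (\<Sum>m<i. \<zeta> m \<omega>)"

text \<open>Dependence on the steps in \<open>A\<close> alone, stated pointwise. As the group is
  countable, the product space of finitely many steps is discrete: every such function is
  measurable, and functions of disjoint finite sets of steps are independent.\<close>

definition determined :: "nat set \<Rightarrow> ('w \<Rightarrow> 'c) \<Rightarrow> bool" where
  "determined A f \<longleftrightarrow> (\<exists>F. \<forall>\<omega>. f \<omega> = F (\<lambda>m\<in>A. \<zeta> m \<omega>))"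

lemma determinedI: "(\<And>\<omega>. f \<omega> = F (\<lambda>m\<in>A. \<zeta> m \<omega>)) \<Longrightarrow> determined A f"
  by (auto simp: determined_def)

lemma determined_const[simp]: "determined A (\<lambda>_. c)"
  by (rule determinedI[where F="\<lambda>_. c"]) simp

lemma determined_mono:
  assumes "determined A f" "A \<subseteq> B" shows "determined B f"
proof -
  obtain F where F: "\<And>\<omega>. f \<omega> = F (\<lambda>m\<in>A. \<zeta> m \<omega>)" using assms by (auto simp: determined_def)
  have "restrict (\<lambda>m\<in>B. \<zeta> m \<omega>) A = (\<lambda>m\<in>A. \<zeta> m \<omega>)" for \<omega> using assms(2) by (auto simp: fun_eq_iff)
  then show ?thesis by (intro determinedI[where F="\<lambda>x. F (restrict x A)"]) (simp add: F)
qed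

lemma determined_comp:
  assumes "determined A f" shows "determined A (\<lambda>\<omega>. h (f \<omega>))"
proof -
  obtain F where "\<And>\<omega>. f \<omega> = F (\<lambda>m\<in>A. \<zeta> m \<omega>)" using assms by (auto simp: determined_def)
  then show ?thesis by (intro determinedI[where F="\<lambda>x. h (F x)"]) simp
qed

lemma determined_comp2:
  assumes "determined A f" "determined A g" shows "determined A (\<lambda>\<omega>. h (f \<omega>) (g \<omega>))"
proof -
  obtain F G where "\<And>\<omega>. f \<omega> = F (\<lambda>m\<in>A. \<zeta> m \<omega>)" "\<And>\<omega>. g \<omega> = G (\<lambda>m\<in>A. \<zeta> m \<omega>)"
    using assms unfolding determined_def by metis
  then show ?thesis by (intro determinedI[where F="\<lambda>x. h (F x) (G x)"]) simp
qed

lemma determined_inc: "{a..<b} \<subseteq> A \<Longrightarrow> determined A (inc a b)"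
  by (rule determinedI[where F="\<lambda>x. \<Sum>m\<in>{a..<b}. x m"]) (auto simp: inc_def intro!: sum.cong)

lemma product_count_space:
  assumes "finite A"
  shows "PiM A (\<lambda>_. count_space UNIV) = (count_space (PiE A (\<lambda>_. UNIV)) :: (nat \<Rightarrow> 'g) measure)"
  by (rule count_space_PiM_finite) (use assms in auto)

lemma determined_measurable:
  assumes "finite A" "determined A f" shows "f \<in> measurable P (count_space UNIV)"
proof -
  obtain F where F: "f = (\<lambda>\<omega>. F (\<lambda>m\<in>A. \<zeta> m \<omega>))" using assms(2) unfolding determined_def fun_eq_iff by metis
  have "(\<lambda>\<omega>. \<lambda>m\<in>A. \<zeta> m \<omega>) \<in> measurable P (PiM A (\<lambda>_. count_space UNIV))"
    by (rule measurable_restrict) (use indep in \<open>auto simp: indep_vars_def\<close>)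
  moreover have "F \<in> measurable (PiM A (\<lambda>_. count_space UNIV)) (count_space UNIV)"
    unfolding product_count_space[OF assms(1)] by simp
  ultimately show ?thesis unfolding F by (rule measurable_compose)
qed

lemma determined_borel_measurable:
  fixes f :: "'w \<Rightarrow> 'c::topological_space"
  assumes "finite A" "determined A f" shows "f \<in> borel_measurable P"
  by (rule measurable_compose[OF determined_measurable[OF assms], where g="\<lambda>x. x", simplified]) simp

lemma determined_indep_var:
  assumes "finite A" "finite B" "A \<inter> B = {}" "determined A f" "determined B g"
  shows "indep_var (count_space UNIV) f (count_space UNIV) g"
proof -
  obtain F where F: "f = F \<circ> (\<lambda>\<omega>. \<lambda>m\<in>A. \<zeta> m \<omega>)"
    using assms(4) unfolding determined_def fun_eq_iff by (metis comp_apply)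
  obtain G where G: "g = G \<circ> (\<lambda>\<omega>. \<lambda>m\<in>B. \<zeta> m \<omega>)"
    using assms(5) unfolding determined_def fun_eq_iff by (metis comp_apply)
  show ?thesis unfolding F G
    by (rule indep_var_compose[OF indep_var_restrict[OF indep assms(3)]])
       (auto simp: product_count_space assms)
qed

lemma determined_prob_conj:
  assumes "finite A" "finite B" "A \<inter> B = {}" "determined A G" "determined B H"
  shows "prob {\<omega>\<in>space P. G \<omega> \<and> H \<omega>} = prob {\<omega>\<in>space P. G \<omega>} * prob {\<omega>\<in>space P. H \<omega>}"
proof -
  have "prob ((\<lambda>x. (G x, H x)) -` ({True} \<times> {True}) \<inter> space P) = prob (G -` {True} \<inter> space P) * prob (H -` {True} \<inter> space P)"
    by (rule indep_varD[OF determined_indep_var[OF assms]]) auto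
  moreover have "(\<lambda>x. (G x, H x)) -` ({True} \<times> {True}) \<inter> space P = {\<omega>\<in>space P. G \<omega> \<and> H \<omega>}" by auto
  moreover have "G -` {True} \<inter> space P = {\<omega>\<in>space P. G \<omega>}" "H -` {True} \<inter> space P = {\<omega>\<in>space P. H \<omega>}" by auto
  ultimately show ?thesis by simp
qed

lemma determined_expectation_mult:
  fixes f g :: "'w \<Rightarrow> real"
  assumes "finite A" "finite B" "A \<inter> B = {}" "determined A f" "determined B g"
    and "integrable P f" "integrable P g"
  shows "expectation (\<lambda>\<omega>. f \<omega> * g \<omega>) = expectation f * expectation g"
proof -
  have "indep_var borel (id \<circ> f) borel (id \<circ> g)"
    by (rule indep_var_compose[OF determined_indep_var[OF assms(1-5)]]) auto
  then show ?thesis using indep_var_lebesgue_integral[OF _ assms(6,7)] by simp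
qed

text \<open>Conditioning on the steps in \<open>A\<close>: \<open>w\<close> is independent of them
  and has to hit the value that they prescribe. The event is split over the countably many values of
  \<psi>.\<close>

lemma prob_eq_function_le:
  fixes w :: "'w \<Rightarrow> 'g"
  assumes AB: "finite A" "finite B" "A \<inter> B = {}"
    and G: "determined A G" and \<psi>: "determined A \<psi>" and w: "determined B w"
    and \<kappa>: "\<And>y. prob {\<omega>\<in>space P. w \<omega> = y} \<le> \<kappa>"
  shows "prob {\<omega>\<in>space P. G \<omega> \<and> w \<omega> = \<psi> \<omega>} \<le> \<kappa> * prob {\<omega>\<in>space P. G \<omega>}"
proof -
  have \<kappa>0: "0 \<le> \<kappa>" using \<kappa>[of undefined] measure_nonneg order_trans by blast
  have ev: "{\<omega>\<in>space P. Q \<omega>} \<in> events" if "determined (A \<union> B) Q" for Q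
    using measurable_sets[OF determined_measurable[OF _ that], of "{True}"] AB
    by (auto simp: vimage_def Int_def conj_commute)
  have dGy: "determined A (\<lambda>\<omega>. G \<omega> \<and> \<psi> \<omega> = y)" for y
    by (rule determined_comp2[OF G \<psi>])
  have dwy: "determined B (\<lambda>\<omega>. w \<omega> = y)" for y
    by (rule determined_comp[OF w])
  have e1: "{\<omega>\<in>space P. (G \<omega> \<and> \<psi> \<omega> = y) \<and> w \<omega> = y} \<in> events" for y
    by (rule ev) (intro determined_comp2[OF determined_mono[OF dGy] determined_mono[OF dwy]], auto)
  have e2: "{\<omega>\<in>space P. G \<omega> \<and> \<psi> \<omega> = y} \<in> events" for y
    by (rule ev) (rule determined_mono[OF dGy], auto)
  have "emeasure P {\<omega>\<in>space P. G \<omega> \<and> w \<omega> = \<psi> \<omega>} = emeasure P (\<Union>y. {\<omega>\<in>space P. (G \<omega> \<and> \<psi> \<omega> = y) \<and> w \<omega> = y})"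
    by (rule arg_cong[where f="emeasure P"]) auto
  also have "\<dots> = (\<integral>\<^sup>+y. emeasure P {\<omega>\<in>space P. (G \<omega> \<and> \<psi> \<omega> = y) \<and> w \<omega> = y} \<partial>count_space UNIV)"
    by (rule emeasure_UN_countable) (use e1 in \<open>auto simp: disjoint_family_on_def\<close>)
  also have "\<dots> \<le> (\<integral>\<^sup>+y. ennreal \<kappa> * emeasure P {\<omega>\<in>space P. G \<omega> \<and> \<psi> \<omega> = y} \<partial>count_space UNIV)"
  proof (rule nn_integral_mono)
    fix y
    have "prob {\<omega>\<in>space P. (G \<omega> \<and> \<psi> \<omega> = y) \<and> w \<omega> = y} \<le> \<kappa> * prob {\<omega>\<in>space P. G \<omega> \<and> \<psi> \<omega> = y}"
      unfolding determined_prob_conj[OF AB dGy dwy] by (subst mult.commute) (intro mult_right_mono \<kappa>, simp)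
    then show "emeasure P {\<omega>\<in>space P. (G \<omega> \<and> \<psi> \<omega> = y) \<and> w \<omega> = y} \<le> ennreal \<kappa> * emeasure P {\<omega>\<in>space P. G \<omega> \<and> \<psi> \<omega> = y}"
      unfolding emeasure_eq_measure ennreal_mult[OF \<kappa>0 measure_nonneg, symmetric] by (rule ennreal_leI)
  qed
  also have "\<dots> = ennreal \<kappa> * emeasure P (\<Union>y. {\<omega>\<in>space P. G \<omega> \<and> \<psi> \<omega> = y})"
    by (subst emeasure_UN_countable) (use e2 in \<open>auto simp: disjoint_family_on_def nn_integral_cmult\<close>)
  also have "(\<Union>y. {\<omega>\<in>space P. G \<omega> \<and> \<psi> \<omega> = y}) = {\<omega>\<in>space P. G \<omega>}" by auto
  finally have "ennreal (prob {\<omega>\<in>space P. G \<omega> \<and> w \<omega> = \<psi> \<omega>}) \<le> ennreal (\<kappa> * prob {\<omega>\<in>space P. G \<omega>})"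
    unfolding emeasure_eq_measure ennreal_mult[OF \<kappa>0 measure_nonneg] .
  then show ?thesis by (subst (asm) ennreal_le_iff) (use \<kappa>0 in auto)
qed

lemma Z_eq_iff:
  assumes "a \<le> i" "a \<le> j" shows "Z \<omega> i = Z \<omega> j \<longleftrightarrow> inc a i \<omega> = inc a j \<omega>"
proof -
  have *: "Z \<omega> i = Z \<omega> a + inc a i \<omega>" if "a \<le> i" for i
    unfolding Z_def inc_def lessThan_atLeast0 using that by (simp add: sum.atLeastLessThan_concat)
  show ?thesis unfolding *[OF assms(1)] *[OF assms(2)] by simp
qed

text \<open>Whether two later positions coincide depends only on the steps after time
  \<open>a\<close>. Hence the self-intersections of disjoint time blocks are independent.\<close>

lemma determined_intersections:
  assumes "A \<subseteq> {a..<b}" "B \<subseteq> {a..<b}"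
  shows "determined {a..<b} (\<lambda>\<omega>. intersections (Z \<omega>) A B)"
proof (rule determinedI[where F="\<lambda>x. intersections (\<lambda>i. \<Sum>m\<in>{a..<i}. x m) A B"])
  fix \<omega>
  have inc: "(\<Sum>m\<in>{a..<i}. (\<lambda>m\<in>{a..<b}. \<zeta> m \<omega>) m) = inc a i \<omega>" if "i < b" for i
    unfolding inc_def using that by (intro sum.cong) auto
  show "intersections (Z \<omega>) A B = intersections (\<lambda>i. \<Sum>m\<in>{a..<i}. (\<lambda>m\<in>{a..<b}. \<zeta> m \<omega>) m) A B"
    unfolding intersections_def
  proof (intro sum.cong refl)
    fix i j assume "i \<in> A" "j \<in> B"
    then have "a \<le> i" "i < b" "a \<le> j" "j < b" using assms by auto
    then show "of_bool (Z \<omega> i = Z \<omega> j) = of_bool ((\<Sum>m\<in>{a..<i}. (\<lambda>m\<in>{a..<b}. \<zeta> m \<omega>) m) = (\<Sum>m\<in>{a..<j}. (\<lambda>m\<in>{a..<b}. \<zeta> m \<omega>) m))"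
      by (simp only: inc Z_eq_iff)
  qed
qed

lemma intersections_le: "finite A \<Longrightarrow> finite B \<Longrightarrow> intersections z A B \<le> real (card A) * real (card B)"
proof -
  assume "finite A" "finite B"
  have "intersections z A B \<le> (\<Sum>i\<in>A. \<Sum>j\<in>B. 1)"
    unfolding intersections_def by (intro sum_mono) auto
  then show ?thesis by simp
qed

lemma intersections_measurable[measurable]:
  "finite A \<Longrightarrow> finite B \<Longrightarrow> (\<lambda>\<omega>. intersections (Z \<omega>) A B) \<in> borel_measurable P"
proof -
  assume AB: "finite A" "finite B"
  then obtain b where "A \<subseteq> {0..<b}" "B \<subseteq> {0..<b}"
    using finite_nat_bounded[of "A \<union> B"] by (auto simp: lessThan_atLeast0)
  then show ?thesis by (intro determined_borel_measurable[OF _ determined_intersections]) auto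
qed

lemma intersections_bounded_integrable:
  assumes "finite A" "finite B"
  shows "integrable P (\<lambda>\<omega>. intersections (Z \<omega>) A B)" "integrable P (\<lambda>\<omega>. (intersections (Z \<omega>) A B)\<^sup>2)"
proof -
  have b: "\<bar>intersections (Z \<omega>) A B\<bar> \<le> real (card A) * real (card B)" for \<omega>
    using intersections_le[OF assms] intersections_nonneg[of "Z \<omega>" A B] by simp
  show "integrable P (\<lambda>\<omega>. intersections (Z \<omega>) A B)"
    by (rule integrable_bounded[OF intersections_measurable[OF assms] b])
  have "\<bar>(intersections (Z \<omega>) A B)\<^sup>2\<bar> \<le> (real (card A) * real (card B))\<^sup>2" for \<omega>
    using power_mono[OF b, of \<omega> 2] by simp
  then show "integrable P (\<lambda>\<omega>. (intersections (Z \<omega>) A B)\<^sup>2)"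
    by (rule integrable_bounded[OF borel_measurable_power[OF intersections_measurable[OF assms]]])
qed

end

locale decaying_walk = countable_walk P \<zeta> for P :: "'w measure" and \<zeta> :: "nat \<Rightarrow> 'w \<Rightarrow> 'g::{ab_group_add, countable}" +
  fixes K :: real
  assumes local_bound: "\<And>a k y. prob {\<omega>\<in>space P. inc a (a + k) \<omega> = y} \<le> K / (real k + 1)"
begin

lemma K_nonneg: "0 \<le> K"
  using order_trans[OF measure_nonneg local_bound[of 0 0 undefined]] by simp

lemma local_bound': "a \<le> b \<Longrightarrow> prob {\<omega>\<in>space P. inc a b \<omega> = y} \<le> K / (real (b - a) + 1)"
  using local_bound[of a "b - a" y] by simp

lemma event_determined: "finite A \<Longrightarrow> determined A Q \<Longrightarrow> {\<omega>\<in>space P. Q \<omega>} \<in> events"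
  using measurable_sets[OF determined_measurable, of A Q "{True}"]
  by (auto simp: vimage_def Int_def conj_commute)

text \<open>The middle increment and the longer of the two outer increments are prescribed by the rest.\<close>
lemma prob_double_intersection_sorted:
  assumes t: "p \<le> q" "q \<le> r" "r \<le> s"
    and ij: "(i = p \<and> i' = q) \<or> (i = q \<and> i' = p)" "(j = r \<and> j' = s) \<or> (j = s \<and> j' = r)"
  shows "prob {\<omega>\<in>space P. Z \<omega> i = Z \<omega> j \<and> Z \<omega> i' = Z \<omega> j'}
     \<le> K\<^sup>2 / ((real (r - q) + 1) * (real (max (q - p) (s - r)) + 1))"
proof -
  let ?u = "inc p q" and ?v = "inc q r" and ?w = "inc r s"
  let ?E = "{\<omega>\<in>space P. Z \<omega> i = Z \<omega> j \<and> Z \<omega> i' = Z \<omega> j'}"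
  let ?A = "{p..<q}" and ?B = "{q..<r}" and ?C = "{r..<s}"
  let ?M = "\<lambda>n. K / (real n + 1)"
  have M0: "0 \<le> ?M n" for n using K_nonneg by simp
  have Zq: "Z \<omega> q = Z \<omega> p + ?u \<omega>" and Zr: "Z \<omega> r = Z \<omega> p + ?u \<omega> + ?v \<omega>"
    and Zs: "Z \<omega> s = Z \<omega> p + ?u \<omega> + ?v \<omega> + ?w \<omega>" for \<omega>
  proof -
    have *: "Z \<omega> b = Z \<omega> a + inc a b \<omega>" if "a \<le> b" for a b
      unfolding Z_def inc_def lessThan_atLeast0 using that by (simp add: sum.atLeastLessThan_concat)
    show "Z \<omega> q = Z \<omega> p + ?u \<omega>" using *[OF t(1)] .
    then show "Z \<omega> r = Z \<omega> p + ?u \<omega> + ?v \<omega>" using *[OF t(2)] by simp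
    then show "Z \<omega> s = Z \<omega> p + ?u \<omega> + ?v \<omega> + ?w \<omega>" using *[OF t(3)] by simp
  qed
  \<comment> \<open>The event is to be solved in two ways: for the middle and last increments given
    the first, and for the middle and first given the last. Each yields the bound with one of the
    outer gaps.\<close>
  have dim: "prob ?E \<le> ?M (r - q) * ?M (q - p) \<and> prob ?E \<le> ?M (r - q) * ?M (s - r)"
    if E: "?E = {\<omega>\<in>space P. ?v \<omega> = \<phi> (?u \<omega>) \<and> ?w \<omega> = \<psi> (?u \<omega>)}"
      "?E = {\<omega>\<in>space P. ?v \<omega> = \<phi>' (?w \<omega>) \<and> ?u \<omega> = \<psi>' (?w \<omega>)}" for \<phi> \<psi> \<phi>' \<psi>'
  proof
    have one: "prob {\<omega>\<in>space P. True} = 1" by (simp add: prob_space)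
    have v1: "prob {\<omega>\<in>space P. ?v \<omega> = \<phi> (?u \<omega>)} \<le> ?M (r - q)"
      using prob_eq_function_le[of ?A ?B "\<lambda>_. True" "\<lambda>\<omega>. \<phi> (?u \<omega>)" ?v "?M (r - q)"]
      by (auto intro: determined_comp determined_inc local_bound' t simp: one[simplified] simp del: of_nat_diff)
    have v2: "prob {\<omega>\<in>space P. ?v \<omega> = \<phi>' (?w \<omega>)} \<le> ?M (r - q)"
      using prob_eq_function_le[of ?C ?B "\<lambda>_. True" "\<lambda>\<omega>. \<phi>' (?w \<omega>)" ?v "?M (r - q)"]
      by (auto intro: determined_comp determined_inc local_bound' t simp: one[simplified] simp del: of_nat_diff)
    have "prob {\<omega>\<in>space P. ?v \<omega> = \<phi>' (?w \<omega>) \<and> ?u \<omega> = \<psi>' (?w \<omega>)} \<le> ?M (q - p) * prob {\<omega>\<in>space P. ?v \<omega> = \<phi>' (?w \<omega>)}"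
    proof (rule prob_eq_function_le[of "{q..<s}" ?A])
      show "determined {q..<s} (\<lambda>\<omega>. ?v \<omega> = \<phi>' (?w \<omega>))"
        by (rule determined_comp2[where h="\<lambda>a b. a = \<phi>' b"]) (use t in \<open>auto intro!: determined_inc\<close>)
      show "determined {q..<s} (\<lambda>\<omega>. \<psi>' (?w \<omega>))"
        by (rule determined_comp, rule determined_inc) (use t in auto)
    qed (use t in \<open>auto intro: determined_inc local_bound' simp del: of_nat_diff\<close>)
    also have "\<dots> \<le> ?M (q - p) * ?M (r - q)" by (intro mult_left_mono v2 M0)
    finally show "prob ?E \<le> ?M (r - q) * ?M (q - p)" unfolding E(2) mult.commute[of "?M (r - q)"] .
    have "prob {\<omega>\<in>space P. ?v \<omega> = \<phi> (?u \<omega>) \<and> ?w \<omega> = \<psi> (?u \<omega>)} \<le> ?M (s - r) * prob {\<omega>\<in>space P. ?v \<omega> = \<phi> (?u \<omega>)}"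
    proof (rule prob_eq_function_le[of "{p..<r}" ?C])
      show "determined {p..<r} (\<lambda>\<omega>. ?v \<omega> = \<phi> (?u \<omega>))"
        by (rule determined_comp2[where h="\<lambda>a b. a = \<phi> b"]) (use t in \<open>auto intro!: determined_inc\<close>)
      show "determined {p..<r} (\<lambda>\<omega>. \<psi> (?u \<omega>))"
        by (rule determined_comp, rule determined_inc) (use t in auto)
    qed (use t in \<open>auto intro: determined_inc local_bound' simp del: of_nat_diff\<close>)
    also have "\<dots> \<le> ?M (s - r) * ?M (r - q)" by (intro mult_left_mono v1 M0)
    finally show "prob ?E \<le> ?M (r - q) * ?M (s - r)" unfolding E(1) mult.commute[of "?M (r - q)"] .
  qed
  have grp: "a = a + u + v \<longleftrightarrow> v = - u" "a + u = a + u + v + w \<longleftrightarrow> w = - v"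
      "a + u = a + u + v \<longleftrightarrow> v = 0" "a = a + u + v + w \<longleftrightarrow> u + v + w = 0" for a u v w :: 'g
    by (simp_all add: add.assoc add_eq_0_iff)
  have "prob ?E \<le> ?M (r - q) * ?M (q - p) \<and> prob ?E \<le> ?M (r - q) * ?M (s - r)"
  \<comment> \<open>Either the coinciding times interlace, p with r and q with s, or they are
    nested, q with r between p and s.\<close>
  proof (cases "i = p \<and> i' = q \<and> j = r \<and> j' = s \<or> i = q \<and> i' = p \<and> j = s \<and> j' = r")
    case True
    then have "(Z \<omega> i = Z \<omega> j \<and> Z \<omega> i' = Z \<omega> j') \<longleftrightarrow> Z \<omega> p = Z \<omega> r \<and> Z \<omega> q = Z \<omega> s" for \<omega> by auto
    also have "(Z \<omega> p = Z \<omega> r \<and> Z \<omega> q = Z \<omega> s) \<longleftrightarrow> (?v \<omega> = - ?u \<omega> \<and> ?w \<omega> = ?u \<omega>)" for \<omega>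
      unfolding Zq Zr Zs grp by auto
    finally have *: "(Z \<omega> i = Z \<omega> j \<and> Z \<omega> i' = Z \<omega> j') \<longleftrightarrow> (?v \<omega> = - ?u \<omega> \<and> ?w \<omega> = ?u \<omega>)" for \<omega> .
    show ?thesis
      by (rule dim[of "\<lambda>u. - u" "\<lambda>u. u" "\<lambda>w. - w" "\<lambda>w. w"]) (auto simp: *)
  next
    case False
    then have "(Z \<omega> i = Z \<omega> j \<and> Z \<omega> i' = Z \<omega> j') \<longleftrightarrow> Z \<omega> q = Z \<omega> r \<and> Z \<omega> p = Z \<omega> s" for \<omega>
      using ij by auto
    also have "(Z \<omega> q = Z \<omega> r \<and> Z \<omega> p = Z \<omega> s) \<longleftrightarrow> (?v \<omega> = 0 \<and> ?w \<omega> = - ?u \<omega>)" for \<omega>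
      unfolding Zq Zr Zs grp by (auto simp: add_eq_0_iff)
    finally have *: "(Z \<omega> i = Z \<omega> j \<and> Z \<omega> i' = Z \<omega> j') \<longleftrightarrow> (?v \<omega> = 0 \<and> ?w \<omega> = - ?u \<omega>)" for \<omega> .
    show ?thesis
      by (rule dim[of "\<lambda>u. 0" "\<lambda>u. - u" "\<lambda>w. 0" "\<lambda>w. - w"]) (auto simp: *)
  qed
  then have "prob ?E \<le> ?M (r - q) * ?M (max (q - p) (s - r))" by (auto simp: max_def)
  also have "\<dots> = K\<^sup>2 / ((real (r - q) + 1) * (real (max (q - p) (s - r)) + 1))"
    by (simp add: power2_eq_square)
  finally show ?thesis .
qed

text \<open>Sorting the two times on either side by inner time and gap makes the bound for a double
  intersection factorise: the inverse distances of the inner times sum to at most 2 N, and so do the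
  inverses of the larger outer gap. With one fixed outer gap in place of the larger one, a logarithm
  would appear.\<close>

lemma cross_second_moment:
  assumes N: "m \<le> N" "m' \<le> N"
  shows "expectation (\<lambda>\<omega>. (intersections (Z \<omega>) {a..<a+m} {a+m..<a+m+m'})\<^sup>2) \<le> 16 * K\<^sup>2 * (real N)\<^sup>2"
proof -
  let ?I = "{a..<a+m}" and ?J = "{a+m..<a+m+m'}"
  let ?e = "\<lambda>i j i' j' \<omega>. of_bool (Z \<omega> i = Z \<omega> j \<and> Z \<omega> i' = Z \<omega> j') :: real"
  have sq: "(intersections (Z \<omega>) ?I ?J)\<^sup>2 = (\<Sum>i\<in>?I. \<Sum>i'\<in>?I. \<Sum>j\<in>?J. \<Sum>j'\<in>?J. ?e i j i' j' \<omega>)" for \<omega>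
  proof -
    have "(intersections (Z \<omega>) ?I ?J)\<^sup>2
        = (\<Sum>i\<in>?I. \<Sum>i'\<in>?I. (\<Sum>j\<in>?J. of_bool (Z \<omega> i = Z \<omega> j)) * (\<Sum>j'\<in>?J. of_bool (Z \<omega> i' = Z \<omega> j')))"
      unfolding intersections_def power2_eq_square by (rule sum_product)
    also have "\<dots> = (\<Sum>i\<in>?I. \<Sum>i'\<in>?I. \<Sum>j\<in>?J. \<Sum>j'\<in>?J. ?e i j i' j' \<omega>)"
      unfolding sum_product of_bool_conj ..
    finally show ?thesis .
  qed
  have ev: "{\<omega>\<in>space P. Z \<omega> i = Z \<omega> j \<and> Z \<omega> i' = Z \<omega> j'} \<in> events" for i j i' j'
  proof (rule event_determined)
    show "determined {0..<i + j + i' + j'} (\<lambda>\<omega>. Z \<omega> i = Z \<omega> j \<and> Z \<omega> i' = Z \<omega> j')"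
      unfolding Z_eq_iff[OF le0 le0]
      by (intro determined_comp2[where h="(\<and>)"] determined_comp2[where h="(=)"] determined_inc) auto
  qed simp
  have ei: "expectation (?e i j i' j') = prob {\<omega>\<in>space P. Z \<omega> i = Z \<omega> j \<and> Z \<omega> i' = Z \<omega> j'}" "integrable P (?e i j i' j')" for i j i' j'
  proof -
    have *: "integrable P (indicator {\<omega>\<in>space P. Z \<omega> i = Z \<omega> j \<and> Z \<omega> i' = Z \<omega> j'} :: _ \<Rightarrow> real)"
      "expectation (indicator {\<omega>\<in>space P. Z \<omega> i = Z \<omega> j \<and> Z \<omega> i' = Z \<omega> j'}) = prob {\<omega>\<in>space P. Z \<omega> i = Z \<omega> j \<and> Z \<omega> i' = Z \<omega> j'}"
      using ev[of i j i' j'] by (auto intro!: integrable_real_indicator simp: less_top[symmetric])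
    have c: "?e i j i' j' \<omega> = indicator {\<omega>\<in>space P. Z \<omega> i = Z \<omega> j \<and> Z \<omega> i' = Z \<omega> j'} \<omega>" if "\<omega> \<in> space P" for \<omega>
      using that by (auto simp: indicator_def)
    show "expectation (?e i j i' j') = prob {\<omega>\<in>space P. Z \<omega> i = Z \<omega> j \<and> Z \<omega> i' = Z \<omega> j'}"
      unfolding *(2)[symmetric] by (rule Bochner_Integration.integral_cong[OF refl c])
    show "integrable P (?e i j i' j')"
      using *(1) by (subst Bochner_Integration.integrable_cong[OF refl c])
  qed
  let ?b = "\<lambda>i i' j j'. K\<^sup>2 / ((real (min j j' - max i i') + 1) * (real (max (max i i' - min i i') (max j j' - min j j')) + 1))"
  have "expectation (\<lambda>\<omega>. (intersections (Z \<omega>) ?I ?J)\<^sup>2)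
      = (\<Sum>i\<in>?I. \<Sum>i'\<in>?I. \<Sum>j\<in>?J. \<Sum>j'\<in>?J. prob {\<omega>\<in>space P. Z \<omega> i = Z \<omega> j \<and> Z \<omega> i' = Z \<omega> j'})"
    unfolding sq ei(1)[symmetric]
    by (simp only: Bochner_Integration.integral_sum Bochner_Integration.integrable_sum ei(2))
  also have "\<dots> \<le> (\<Sum>i\<in>?I. \<Sum>i'\<in>?I. \<Sum>j\<in>?J. \<Sum>j'\<in>?J. ?b i i' j j')"
  proof (intro sum_mono)
    fix i i' j j' assume "i \<in> ?I" "i' \<in> ?I" "j \<in> ?J" "j' \<in> ?J"
    then show "prob {\<omega>\<in>space P. Z \<omega> i = Z \<omega> j \<and> Z \<omega> i' = Z \<omega> j'} \<le> ?b i i' j j'"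
      by (intro prob_double_intersection_sorted) (auto simp: min_def max_def)
  qed
  also have "\<dots> \<le> (\<Sum>i\<in>?I. \<Sum>i'\<in>?I. 2 * (\<Sum>q\<in>?J. \<Sum>c<N. K\<^sup>2 / ((real (q - max i i') + 1) * (real (max (max i i' - min i i') c) + 1))))"
    by (intro sum_mono sum_min_absdiff_le[where s="a+m" and m=m' and f="\<lambda>q c. K\<^sup>2 / ((real (q - max i i') + 1) * (real (max (max i i' - min i i') c) + 1))" for i i'])
       (use N in auto)
  also have "\<dots> \<le> 2 * (\<Sum>p\<in>?I. \<Sum>d<N. 2 * (\<Sum>q\<in>?J. \<Sum>c<N. K\<^sup>2 / ((real (q - p) + 1) * (real (max d c) + 1))))"
    by (rule sum_max_absdiff_le[where s=a and m=m and f="\<lambda>p d. 2 * (\<Sum>q\<in>?J. \<Sum>c<N. K\<^sup>2 / ((real (q - p) + 1) * (real (max d c) + 1)))"])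
       (use N in \<open>auto intro!: sum_nonneg\<close>)
  also have "\<dots> = 4 * K\<^sup>2 * ((\<Sum>p\<in>?I. \<Sum>q\<in>?J. 1 / (real (q - p) + 1)) * (\<Sum>d<N. \<Sum>c<N. 1 / (real (max d c) + 1)))"
  proof -
    have "(\<Sum>p\<in>?I. \<Sum>q\<in>?J. 1 / (real (q - p) + 1)) * (\<Sum>d<N. \<Sum>c<N. 1 / (real (max d c) + 1))
        = (\<Sum>p\<in>?I. \<Sum>d<N. \<Sum>q\<in>?J. \<Sum>c<N. 1 / ((real (q - p) + 1) * (real (max d c) + 1)))"
      unfolding sum_product by simp
    then show ?thesis by (simp add: sum_distrib_left mult_ac)
  qed
  also have "\<dots> \<le> 4 * K\<^sup>2 * ((2 * real N) * (2 * real N))"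
    by (intro mult_left_mono mult_mono sum_inverse_gap_le sum_inverse_max_le N sum_nonneg) auto
  also have "\<dots> = 16 * K\<^sup>2 * (real N)\<^sup>2" by (simp add: power2_eq_square)
  finally show ?thesis .
qed

text \<open>Halving the time interval, the two halves are independent; only their mutual intersections
  contribute beyond the sum of the variances, and these are of order n in mean square.\<close>
lemma variance_self_intersections:
  "variance (\<lambda>\<omega>. intersections (Z \<omega>) {a..<a+n} {a..<a+n}) \<le> 1152 * K\<^sup>2 * (real n)\<^sup>2"
proof (induction n arbitrary: a rule: less_induct)
  case (less n)
  let ?V = "\<lambda>A \<omega>. intersections (Z \<omega>) A A"
  consider "n = 0" | "n = 1" | "n \<ge> 2" by linarith
  then show ?case
  proof cases
    case 1
    then show ?thesis by (simp add: intersections_def)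
  next
    case 2
    then show ?thesis by (simp add: intersections_def prob_space K_nonneg)
  next
    case 3
    define m m' where m_def: "m = n div 2" and m'_def: "m' = n - n div 2"
    have m: "m < n" "m' < n" "n = m + m'" using 3 by (auto simp: m_def m'_def)
    let ?A = "{a..<a+m}" and ?B = "{a+m..<a+m+m'}"
    have AB: "{a..<a+n} = ?A \<union> ?B" "?A \<inter> ?B = {}" using m(3) by auto
    define V where "V = ?V ?A"
    define W where "W = ?V ?B"
    define R where "R \<omega> = intersections (Z \<omega>) ?A ?B" for \<omega>
    have tot: "?V {a..<a+n} \<omega> = V \<omega> + W \<omega> + 2 * R \<omega>" for \<omega>
      unfolding AB(1) V_def W_def R_def using AB(2)
      by (simp add: intersections_Un_left intersections_Un_right intersections_sym[of "Z \<omega>" ?B ?A])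
    have int[simp]: "integrable P V" "integrable P W" "integrable P R"
      "integrable P (\<lambda>\<omega>. (V \<omega>)\<^sup>2)" "integrable P (\<lambda>\<omega>. (W \<omega>)\<^sup>2)" "integrable P (\<lambda>\<omega>. (R \<omega>)\<^sup>2)"
      unfolding V_def W_def R_def by (auto intro: intersections_bounded_integrable)
    have [measurable]: "V \<in> borel_measurable P" "W \<in> borel_measurable P" "R \<in> borel_measurable P"
      using int(1-3)[THEN borel_measurable_integrable] by auto
    define v w r where vwr: "v = expectation V" "w = expectation W" "r = expectation R"
    have mean: "expectation (\<lambda>\<omega>. V \<omega> + W \<omega> + 2 * R \<omega>) = v + w + 2 * r" by (simp add: vwr)
    have sqint: "integrable P (\<lambda>\<omega>. (f \<omega> - c)\<^sup>2)" if "integrable P f" "integrable P (\<lambda>\<omega>. (f \<omega>)\<^sup>2)" for f :: "'w \<Rightarrow> real" and c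
      using that by (simp add: power2_diff)
    have VW: "expectation (\<lambda>\<omega>. (V \<omega> - v) * (W \<omega> - w)) = 0"
    proof -
      have "expectation (\<lambda>\<omega>. (V \<omega> - v) * (W \<omega> - w)) = expectation (\<lambda>\<omega>. V \<omega> - v) * expectation (\<lambda>\<omega>. W \<omega> - w)"
      proof (rule determined_expectation_mult[of ?A ?B])
        show "determined ?A (\<lambda>\<omega>. V \<omega> - v)" unfolding V_def
          by (rule determined_comp[OF determined_intersections]) auto
        show "determined ?B (\<lambda>\<omega>. W \<omega> - w)" unfolding W_def
          by (rule determined_comp[OF determined_intersections]) auto
      qed auto
      then show ?thesis by (simp add: vwr prob_space)
    qed
    have VWi: "integrable P (\<lambda>\<omega>. (V \<omega> - v) * (W \<omega> - w))"
      by (rule integrable_mult_of_squares) (auto intro!: sqint)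
    \<comment> \<open>The difference of the two sides is (x + y - 4 z)^2 / 2. The weight 3/2 is
      affordable because halving reduces the sum of squares to at most 5/9 of n^2, and 3/2 * 5/9 <
      1; the constant of the lemma solves 3/2 * 5/9 * 1152 + 12 * 16 = 1152.\<close>
    have pw: "(x + y + 2 * z)\<^sup>2 \<le> 3/2 * (x\<^sup>2 + y\<^sup>2 + 2 * (x * y)) + 12 * z\<^sup>2" for x y z :: real
      using zero_le_power2[of "(x + y) - 4 * z"] by (simp add: power2_eq_square algebra_simps)
    have "variance (?V {a..<a+n}) = expectation (\<lambda>\<omega>. ((V \<omega> - v) + (W \<omega> - w) + 2 * (R \<omega> - r))\<^sup>2)"
      unfolding tot mean by (rule Bochner_Integration.integral_cong) (auto simp: algebra_simps)
    also have "\<dots> \<le> expectation (\<lambda>\<omega>. 3/2 * ((V \<omega> - v)\<^sup>2 + (W \<omega> - w)\<^sup>2 + 2 * ((V \<omega> - v) * (W \<omega> - w))) + 12 * (R \<omega> - r)\<^sup>2)"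
    proof (rule integral_mono)
      have "integrable P (\<lambda>\<omega>. (?V {a..<a+n} \<omega> - (v + w + 2 * r))\<^sup>2)"
        by (rule sqint) (auto intro: intersections_bounded_integrable)
      then show "integrable P (\<lambda>\<omega>. ((V \<omega> - v) + (W \<omega> - w) + 2 * (R \<omega> - r))\<^sup>2)"
        unfolding tot by (simp add: algebra_simps)
      show "integrable P (\<lambda>\<omega>. 3/2 * ((V \<omega> - v)\<^sup>2 + (W \<omega> - w)\<^sup>2 + 2 * ((V \<omega> - v) * (W \<omega> - w))) + 12 * (R \<omega> - r)\<^sup>2)"
        by (intro Bochner_Integration.integrable_add integrable_mult_right sqint VWi int)
    qed (rule pw)
    also have "\<dots> = 3/2 * (variance V + variance W) + 12 * variance R"
      unfolding vwr[symmetric] using VW VWi by (simp add: sqint)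
    also have "variance R \<le> expectation (\<lambda>\<omega>. (R \<omega>)\<^sup>2)"
      by (simp add: variance_eq)
    also have "expectation (\<lambda>\<omega>. (R \<omega>)\<^sup>2) \<le> 16 * K\<^sup>2 * (real n)\<^sup>2"
      unfolding R_def by (rule cross_second_moment) (use m in auto)
    also have "variance V \<le> 1152 * K\<^sup>2 * (real m)\<^sup>2"
      unfolding V_def by (rule less.IH) (use m in auto)
    also have "variance W \<le> 1152 * K\<^sup>2 * (real m')\<^sup>2"
      unfolding W_def by (rule less.IH) (use m in auto)
    finally have "variance (?V {a..<a+n}) \<le> 3/2 * (1152 * K\<^sup>2 * (real m)\<^sup>2 + 1152 * K\<^sup>2 * (real m')\<^sup>2) + 12 * (16 * K\<^sup>2 * (real n)\<^sup>2)"
      by simp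
    also have "\<dots> = K\<^sup>2 * (1728 * ((real m)\<^sup>2 + (real m')\<^sup>2) + 192 * (real n)\<^sup>2)"
      by (simp add: algebra_simps)
    also have "\<dots> \<le> K\<^sup>2 * (1152 * (real n)\<^sup>2)"
    proof (rule mult_left_mono)
      have "m' = m \<or> m' = m + 1" "m \<ge> 1" using 3 by (auto simp: m_def m'_def)
      moreover obtain k where "m = Suc k" using \<open>m \<ge> 1\<close> by (cases m) auto
      \<comment> \<open>The worst case is n = 3, split into 1 and 2.\<close>
      ultimately have "9 * (m\<^sup>2 + m'\<^sup>2) \<le> 5 * n\<^sup>2"
        unfolding m(3) by (auto simp: power2_eq_square algebra_simps)
      then have "9 * ((real m)\<^sup>2 + (real m')\<^sup>2) \<le> 5 * (real n)\<^sup>2"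
        by (metis (mono_tags) of_nat_add of_nat_le_iff of_nat_mult of_nat_numeral of_nat_power)
      then show "1728 * ((real m)\<^sup>2 + (real m')\<^sup>2) + 192 * (real n)\<^sup>2 \<le> 1152 * (real n)\<^sup>2" by simp
    qed simp
    finally show ?thesis by (simp add: mult_ac)
  qed
qed

end

section \<open>Tauberian lemmas\<close>

lemma stolz_cesaro:
  fixes a B :: "nat \<Rightarrow> real"
  assumes incr: "eventually (\<lambda>n. B n < B (Suc n)) sequentially" and Binf: "filterlim B at_top sequentially"
    and lim: "(\<lambda>n. (a (Suc n) - a n) / (B (Suc n) - B n)) \<longlonglongrightarrow> c"
  shows "(\<lambda>n. a n / B n) \<longlonglongrightarrow> c"
proof (rule tendstoI)
  fix e :: real assume e: "e > 0"
  define d where "d n = a n - c * B n" for n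
  have "eventually (\<lambda>n. dist ((a (Suc n) - a n) / (B (Suc n) - B n)) c < e / 2) sequentially"
    by (rule tendstoD[OF lim]) (use e in simp)
  with incr have "eventually (\<lambda>n. B n < B (Suc n) \<and> \<bar>d (Suc n) - d n\<bar> \<le> e / 2 * (B (Suc n) - B n)) sequentially"
  proof eventually_elim
    case (elim n)
    have p: "0 < B (Suc n) - B n" using elim by simp
    have "d (Suc n) - d n = ((a (Suc n) - a n) / (B (Suc n) - B n) - c) * (B (Suc n) - B n)"
      using p by (simp add: d_def field_simps)
    then have "\<bar>d (Suc n) - d n\<bar> = \<bar>(a (Suc n) - a n) / (B (Suc n) - B n) - c\<bar> * (B (Suc n) - B n)"
      using p by (simp add: abs_mult)
    also have "\<dots> \<le> e / 2 * (B (Suc n) - B n)"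
      using elim p by (intro mult_right_mono) (auto simp: dist_real_def)
    finally show ?case using elim by simp
  qed
  then obtain n0 where n0: "\<And>n. n \<ge> n0 \<Longrightarrow> B n < B (Suc n)" "\<And>n. n \<ge> n0 \<Longrightarrow> \<bar>d (Suc n) - d n\<bar> \<le> e / 2 * (B (Suc n) - B n)"
    by (auto simp: eventually_sequentially)
  have bound: "\<bar>d n - d n0\<bar> \<le> e / 2 * (B n - B n0)" if "n \<ge> n0" for n
    using that
  proof (induction n rule: dec_induct)
    case (step n)
    have "\<bar>d (Suc n) - d n0\<bar> \<le> \<bar>d (Suc n) - d n\<bar> + \<bar>d n - d n0\<bar>" by linarith
    also have "\<dots> \<le> e / 2 * (B (Suc n) - B n) + e / 2 * (B n - B n0)"
      using step n0(2) by (intro add_mono) auto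
    finally show ?case unfolding right_diff_distrib by linarith
  qed simp
  \<comment> \<open>Once \<open>B n\<close> is at least this, the error inherited from
    \<open>n0\<close> is below e / 2 * B n.\<close>
  define L where "L = (\<bar>d n0\<bar> + e / 2 * \<bar>B n0\<bar>) * 2 / e + 1"
  have "eventually (\<lambda>n. B n \<ge> L) sequentially" using Binf by (simp add: filterlim_at_top)
  with eventually_ge_at_top[of n0] show "eventually (\<lambda>n. dist (a n / B n) c < e) sequentially"
  proof eventually_elim
    case (elim n)
    have L0: "L > 0" using e by (simp add: L_def add_nonneg_pos)
    then have Bp: "B n > 0" using elim by simp
    have "\<bar>d n\<bar> \<le> \<bar>d n0\<bar> + e / 2 * (B n - B n0)" using bound[OF elim(1)] by linarith
    also have "\<dots> \<le> \<bar>d n0\<bar> + e / 2 * \<bar>B n0\<bar> + e / 2 * B n"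
      using e mult_left_mono[of "- B n0" "\<bar>B n0\<bar>" "e / 2"] by (simp add: right_diff_distrib)
    also have "\<bar>d n0\<bar> + e / 2 * \<bar>B n0\<bar> < e / 2 * L" using e by (simp add: L_def field_simps)
    also have "e / 2 * L \<le> e / 2 * B n" using elim e by (intro mult_left_mono) auto
    finally have "\<bar>d n\<bar> < e * B n" by simp
    moreover have "a n / B n - c = d n / B n" using Bp by (simp add: d_def field_simps)
    ultimately show ?case using Bp by (simp add: dist_real_def abs_divide divide_less_eq)
  qed
qed

lemma sum_asymp_ln:
  fixes Q :: "nat \<Rightarrow> real"
  assumes "(\<lambda>k. real k * Q k) \<longlonglongrightarrow> c"
  shows "(\<lambda>n. (\<Sum>k<n. Q k) / ln (real n)) \<longlonglongrightarrow> c"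
proof (rule stolz_cesaro)
  show "eventually (\<lambda>n. ln (real n) < ln (real (Suc n))) sequentially" by real_asymp
  show "filterlim (\<lambda>n. ln (real n)) at_top sequentially" by real_asymp
  have "(\<lambda>n. 1 / (real n * (ln (real (Suc n)) - ln (real n)))) \<longlonglongrightarrow> 1" by real_asymp
  from tendsto_mult[OF assms this]
  have "(\<lambda>n. real n * Q n * (1 / (real n * (ln (real (Suc n)) - ln (real n))))) \<longlonglongrightarrow> c" by simp
  then show "(\<lambda>n. ((\<Sum>k<Suc n. Q k) - (\<Sum>k<n. Q k)) / (ln (real (Suc n)) - ln (real n))) \<longlonglongrightarrow> c"
    by (rule Lim_transform_eventually)
       (use eventually_gt_at_top[of 0] in eventually_elim, simp)
qed

lemma sum_asymp_nlogn:
  fixes G :: "nat \<Rightarrow> real"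
  assumes "(\<lambda>n. G n / ln (real n)) \<longlonglongrightarrow> c"
  shows "(\<lambda>n. (\<Sum>i<n. G (Suc i)) / nlogn n) \<longlonglongrightarrow> c"
  unfolding nlogn_def
proof (rule stolz_cesaro)
  show "eventually (\<lambda>n. real n * ln (real n) < real (Suc n) * ln (real (Suc n))) sequentially" by real_asymp
  show "filterlim (\<lambda>n. real n * ln (real n)) at_top sequentially" by real_asymp
  have "(\<lambda>n. ln (real (Suc n)) / (real (Suc n) * ln (real (Suc n)) - real n * ln (real n))) \<longlonglongrightarrow> 1" by real_asymp
  from tendsto_mult[OF LIMSEQ_Suc[OF assms] this]
  have "(\<lambda>n. G (Suc n) / ln (real (Suc n)) * (ln (real (Suc n)) / (real (Suc n) * ln (real (Suc n)) - real n * ln (real n)))) \<longlonglongrightarrow> c" by simp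
  then show "(\<lambda>n. ((\<Sum>i<Suc n. G (Suc i)) - (\<Sum>i<n. G (Suc i))) / (real (Suc n) * ln (real (Suc n)) - real n * ln (real n))) \<longlonglongrightarrow> c"
    by (rule Lim_transform_eventually)
       (use eventually_gt_at_top[of 0] in eventually_elim, simp)
qed

text \<open>An elementary Tauberian argument, with the Abel means taken at r = 1 - 1/n.\<close>
lemma partial_sums_bounded_of_abel_bounded:
  fixes a :: "nat \<Rightarrow> real"
  assumes a: "\<And>k. \<bar>a k\<bar> \<le> K / (real k + 1)"
    and abel: "\<And>r. 0 \<le> r \<Longrightarrow> r < 1 \<Longrightarrow> \<bar>\<Sum>k. r ^ k * a k\<bar> \<le> K'"
  shows "\<bar>\<Sum>k<n. a k\<bar> \<le> K' + 2 * K"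
proof (cases "n = 0")
  case True
  have "0 \<le> K'" using abel[of 0] by linarith
  moreover have "0 \<le> K" using a[of 0] by simp
  ultimately show ?thesis using True by simp
next
  case False
  have K0: "0 \<le> K" using a[of 0] by simp
  define r where "r = 1 - 1 / real n"
  have r: "0 \<le> r" "r < 1" "1 - r = 1 / n" using False by (auto simp: r_def field_simps)
  have aK: "\<bar>a k\<bar> \<le> K" for k
    using a[of k] divide_left_mono[of 1 "real k + 1" K] K0 by simp
  have sm: "summable (\<lambda>k. r ^ k * a k)"
  proof (rule summable_comparison_test')
    show "summable (\<lambda>k. K * r ^ k)" using r by (intro summable_mult summable_geometric) auto
    show "norm (r ^ k * a k) \<le> K * r ^ k" for k
      using mult_right_mono[OF aK[of k], of "r ^ k"] r by (simp add: abs_mult mult.commute)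
  qed
  have split: "(\<Sum>k. r ^ k * a k) = (\<Sum>k. r ^ (k + n) * a (k + n)) + (\<Sum>k<n. r ^ k * a k)"
    by (rule suminf_split_initial_segment[OF sm])
  \<comment> \<open>Beyond n the coefficients are at most K / n, and the geometric weights sum to 1
    / (1 - r) = n.\<close>
  have tail: "\<bar>\<Sum>k. r ^ (k + n) * a (k + n)\<bar> \<le> K"
  proof -
    have b: "norm (r ^ (k + n) * a (k + n)) \<le> K / n * r ^ k" for k
    proof -
      have "\<bar>a (k + n)\<bar> \<le> K / n"
        using a[of "k + n"] divide_left_mono[of "real n" "real (k + n) + 1" K] K0 False by simp
      moreover have "r ^ (k + n) \<le> r ^ k" using r by (simp add: power_add mult_left_le power_le_one)
      ultimately have "\<bar>a (k + n)\<bar> * r ^ (k + n) \<le> K / n * r ^ k" using r K0 by (intro mult_mono) auto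
      then show ?thesis using r by (simp add: abs_mult mult.commute)
    qed
    have g: "summable (\<lambda>k. K / n * r ^ k)" using r by (intro summable_mult summable_geometric) auto
    have "\<bar>\<Sum>k. r ^ (k + n) * a (k + n)\<bar> \<le> (\<Sum>k. K / n * r ^ k)"
      using norm_suminf_le[OF b g] by simp
    also have "\<dots> = K / n * (1 / (1 - r))" using r by (subst suminf_mult) (auto simp: suminf_geometric intro!: summable_geometric)
    also have "\<dots> = K" using r(3) False by simp
    finally show ?thesis .
  qed
  \<comment> \<open>Bernoulli's inequality bounds 1 - r^k by k / n, and the decay of
    \<open>a k\<close> turns this into K / n for each of n terms.\<close>
  have head: "\<bar>(\<Sum>k<n. a k) - (\<Sum>k<n. r ^ k * a k)\<bar> \<le> K"
  proof -
    have "\<bar>(\<Sum>k<n. a k) - (\<Sum>k<n. r ^ k * a k)\<bar> = \<bar>\<Sum>k<n. (1 - r ^ k) * a k\<bar>"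
      by (simp add: sum_subtractf left_diff_distrib)
    also have "\<dots> \<le> (\<Sum>k<n. (1 - r ^ k) * \<bar>a k\<bar>)"
      by (rule order_trans[OF sum_abs]) (use r in \<open>auto intro!: sum_mono simp: abs_mult power_le_one\<close>)
    also have "\<dots> \<le> (\<Sum>k<n. K / n)"
    proof (rule sum_mono)
      fix k
      have "1 - r ^ k \<le> real k / n"
        using Bernoulli_inequality[of "- 1 / real n" k] False by (simp add: r_def)
      then have "(1 - r ^ k) * \<bar>a k\<bar> \<le> real k / n * (K / (real k + 1))"
        using a[of k] r by (intro mult_mono) auto
      also have "\<dots> = K / n * (real k / (real k + 1))" by simp
      also have "\<dots> \<le> K / n * 1" using K0 by (intro mult_left_mono) (auto simp: divide_le_eq)
      finally show "(1 - r ^ k) * \<bar>a k\<bar> \<le> K / n" by simp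
    qed
    also have "\<dots> = K" using False by simp
    finally show ?thesis .
  qed
  show ?thesis using abel[OF r(1,2)] tail head unfolding split by linarith
qed

section \<open>Strong law for the self-intersections\<close>

text \<open>ln m / ln N = 1 + ln (m / N) / ln N, and m / N has a positive limit: the logarithm does
  not see constant factors.\<close>

lemma nlogn_ratio:
  fixes m N :: "nat \<Rightarrow> nat"
  assumes N: "filterlim N at_top sequentially" and m: "(\<lambda>k. real (m k) / real (N k)) \<longlonglongrightarrow> \<tau>" and \<tau>: "\<tau> > 0"
  shows "(\<lambda>k. nlogn (m k) / nlogn (N k)) \<longlonglongrightarrow> \<tau>" "filterlim m at_top sequentially"
proof -
  have Nr: "filterlim (\<lambda>k. real (N k)) at_top sequentially"
    by (rule filterlim_compose[OF filterlim_real_sequentially N])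
  have A: "filterlim (\<lambda>k. real (m k) / real (N k) * real (N k)) at_top sequentially"
    by (rule filterlim_tendsto_pos_mult_at_top[OF m \<tau> Nr])
  have evN: "eventually (\<lambda>k. N k \<ge> 2) sequentially" using N by (simp add: filterlim_at_top)
  have B: "eventually (\<lambda>k. real (m k) / real (N k) * real (N k) = real (m k)) sequentially"
    using evN by eventually_elim simp
  have mr: "filterlim (\<lambda>k. real (m k)) at_top sequentially"
    using A unfolding filterlim_cong[OF refl refl B] .
  then show mt: "filterlim m at_top sequentially"
    by (simp add: filterlim_at_top) (metis (mono_tags, lifting) eventually_mono of_nat_le_iff)
  have evm: "eventually (\<lambda>k. m k \<ge> 2) sequentially" using mt by (simp add: filterlim_at_top)
  have lnN: "filterlim (\<lambda>k. ln (real (N k))) at_top sequentially"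
    by (rule filterlim_compose[OF ln_at_top Nr])
  have "(\<lambda>k. ln (real (m k) / real (N k)) / ln (real (N k))) \<longlonglongrightarrow> 0"
    by (rule real_tendsto_divide_at_top[OF tendsto_ln[OF m] lnN]) (use \<tau> in simp)
  then have "(\<lambda>k. real (m k) / real (N k) * (ln (real (m k) / real (N k)) / ln (real (N k)) + 1)) \<longlonglongrightarrow> \<tau> * (0 + 1)"
    by (intro tendsto_intros m)
  then have "(\<lambda>k. real (m k) / real (N k) * (ln (real (m k) / real (N k)) / ln (real (N k)) + 1)) \<longlonglongrightarrow> \<tau>" by simp
  then show "(\<lambda>k. nlogn (m k) / nlogn (N k)) \<longlonglongrightarrow> \<tau>"
  proof (rule Lim_transform_eventually)
    show "eventually (\<lambda>k. real (m k) / real (N k) * (ln (real (m k) / real (N k)) / ln (real (N k)) + 1) = nlogn (m k) / nlogn (N k)) sequentially"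
      using evN evm
    proof eventually_elim
      case (elim k)
      then have "ln (real (N k)) > 0" by simp
      then show ?case using elim by (simp add: nlogn_def ln_div field_simps)
    qed
  qed
qed

section \<open>Geometric subsequences\<close>

definition geo :: "real \<Rightarrow> nat \<Rightarrow> nat" where "geo \<theta> k = nat \<lceil>\<theta> ^ k\<rceil>"

lemma geo_bounds: "\<theta> > 1 \<Longrightarrow> \<theta> ^ k \<le> real (geo \<theta> k)" "\<theta> > 1 \<Longrightarrow> real (geo \<theta> k) \<le> \<theta> ^ k + 1"
proof -
  assume "\<theta> > 1"
  then have "\<theta> ^ k > 0" by simp
  then show "\<theta> ^ k \<le> real (geo \<theta> k)" "real (geo \<theta> k) \<le> \<theta> ^ k + 1" unfolding geo_def by linarith+
qed

lemma geo_at_top: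
  assumes "\<theta> > 1" shows "filterlim (geo \<theta>) at_top sequentially"
proof -
  have "filterlim (\<lambda>k. \<theta> ^ k) at_top sequentially" using assms by real_asymp
  then have "filterlim (\<lambda>k. real (geo \<theta> k)) at_top sequentially"
    by (rule filterlim_at_top_mono) (use geo_bounds assms in auto)
  then show ?thesis
    by (simp add: filterlim_at_top) (metis (mono_tags, lifting) eventually_mono of_nat_le_iff)
qed

lemma geo_ratio:
  assumes "\<theta> > 1" shows "(\<lambda>k. real (geo \<theta> (Suc k)) / real (geo \<theta> k)) \<longlonglongrightarrow> \<theta>"
proof (rule tendsto_sandwich)
  have i: "(\<lambda>k. (1 / \<theta>) ^ k) \<longlonglongrightarrow> 0" by (rule LIMSEQ_realpow_zero) (use assms in auto)
  have "(\<lambda>k. \<theta> / (1 + (1 / \<theta>) ^ k)) \<longlonglongrightarrow> \<theta> / (1 + 0)" by (intro tendsto_intros i) auto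
  moreover have "\<theta> ^ Suc k / (\<theta> ^ k + 1) = \<theta> / (1 + (1 / \<theta>) ^ k)" for k
    using assms by (simp add: power_divide field_simps)
  ultimately show "(\<lambda>k. \<theta> ^ Suc k / (\<theta> ^ k + 1)) \<longlonglongrightarrow> \<theta>" by simp
  have "(\<lambda>k. \<theta> + (1 / \<theta>) ^ k) \<longlonglongrightarrow> \<theta> + 0" by (intro tendsto_intros i)
  moreover have "(\<theta> ^ Suc k + 1) / \<theta> ^ k = \<theta> + (1 / \<theta>) ^ k" for k
    using assms by (simp add: power_divide field_simps)
  ultimately show "(\<lambda>k. (\<theta> ^ Suc k + 1) / \<theta> ^ k) \<longlonglongrightarrow> \<theta>" by simp
  show "eventually (\<lambda>k. \<theta> ^ Suc k / (\<theta> ^ k + 1) \<le> real (geo \<theta> (Suc k)) / real (geo \<theta> k)) sequentially"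
  proof (intro always_eventually allI frac_le)
    fix k show "0 < real (geo \<theta> k)" using geo_bounds(1)[OF assms, of k] assms by (smt (verit) zero_less_power)
  qed (use geo_bounds(1)[OF assms, of "Suc k" for k] geo_bounds(2)[OF assms] assms in auto)
  show "eventually (\<lambda>k. real (geo \<theta> (Suc k)) / real (geo \<theta> k) \<le> (\<theta> ^ Suc k + 1) / \<theta> ^ k) sequentially"
    by (intro always_eventually allI frac_le)
       (use geo_bounds(2)[OF assms, of "Suc k" for k] geo_bounds(1)[OF assms] assms in auto)
qed

text \<open>The strong law uses no lattice structure: a uniform bound, return probabilities that do
  not depend on the starting time, and the growth of their sums. The \<open>p k\<close> themselves
  may oscillate, as they do for a walk with a period.\<close>

locale log_walk = decaying_walk P \<zeta> K for P :: "'w measure" and \<zeta> :: "nat \<Rightarrow> 'w \<Rightarrow> 'g::{ab_group_add, countable}" and K :: real +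
  fixes p :: "nat \<Rightarrow> real" and c\<^sub>0 :: real
  assumes return_prob: "\<And>a k. prob {\<omega>\<in>space P. inc a (a + k) \<omega> = 0} = p k"
    and green: "(\<lambda>n. (\<Sum>k<n. p k) / ln (real n)) \<longlonglongrightarrow> c\<^sub>0"
    and c0_pos: "c\<^sub>0 > 0"
begin

text \<open>The expected self-intersections of a block of length n: a pair of times with gap k
  contributes \<open>p k\<close>, doubled for the two orders; the diagonal, doubled with the rest,
  is taken off once for each time.\<close>

definition v :: "nat \<Rightarrow> real" where "v n = 2 * (\<Sum>i<n. \<Sum>k<Suc i. p k) - real n"

lemma expectation_self_intersections:
  "expectation (\<lambda>\<omega>. intersections (Z \<omega>) {a..<a+n} {a..<a+n}) = v n"
proof (induction n)
  case 0
  then show ?case by (simp add: intersections_def v_def)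
next
  case (Suc n)
  let ?A = "{a..<a+n}"
  have eq: "intersections (Z \<omega>) {a..<a+Suc n} {a..<a+Suc n}
     = intersections (Z \<omega>) ?A ?A + 2 * intersections (Z \<omega>) ?A {a+n} + 1" for \<omega>
  proof -
    have U: "{a..<a+Suc n} = ?A \<union> {a+n}" "finite ?A" "finite {a+n}" "?A \<inter> {a+n} = {}" by auto
    have one: "intersections (Z \<omega>) {a+n} {a+n} = 1" by (simp add: intersections_def)
    show ?thesis
      unfolding U(1) intersections_Un_left[OF U(2-4)] intersections_Un_right[OF U(2-4)] one
        intersections_sym[of "Z \<omega>" "{a+n}" ?A] by simp
  qed
  have one: "expectation (\<lambda>\<omega>. of_bool (Z \<omega> i = Z \<omega> (a+n))) = p (a + n - i)"
    "integrable P (\<lambda>\<omega>. of_bool (Z \<omega> i = Z \<omega> (a+n)) :: real)" if "i \<in> ?A" for i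
  proof -
    let ?S = "{\<omega>\<in>space P. inc i (a+n) \<omega> = 0}"
    have z: "inc i i \<omega> = 0" for \<omega> by (simp add: inc_def)
    have "i \<le> a + n" using that by auto
    then have iff: "Z \<omega> i = Z \<omega> (a+n) \<longleftrightarrow> inc i (a+n) \<omega> = 0" for \<omega>
      using trans[OF Z_eq_iff[OF order_refl, of i "a+n" \<omega>, unfolded z] eq_commute] by blast
    have S: "?S \<in> events" by (rule event_determined[of "{i..<a+n}"], simp, rule determined_comp[where h="\<lambda>g. g = 0"], rule determined_inc, simp)
    have cong: "of_bool (Z \<omega> i = Z \<omega> (a+n)) = (indicator ?S \<omega> :: real)" if "\<omega> \<in> space P" for \<omega>
      using that by (simp add: iff indicator_def)
    have "expectation (\<lambda>\<omega>. of_bool (Z \<omega> i = Z \<omega> (a+n)) :: real) = expectation (\<lambda>\<omega>. indicator ?S \<omega>)"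
      by (rule Bochner_Integration.integral_cong[OF refl cong])
    also have "\<dots> = prob ?S" using S by simp
    also have "\<dots> = p (a + n - i)" using return_prob[of i "a + n - i"] that by simp
    finally show "expectation (\<lambda>\<omega>. of_bool (Z \<omega> i = Z \<omega> (a+n))) = p (a + n - i)" .
    show "integrable P (\<lambda>\<omega>. of_bool (Z \<omega> i = Z \<omega> (a+n)) :: real)"
      by (subst Bochner_Integration.integrable_cong[OF refl cong])
         (use S in \<open>auto intro!: integrable_real_indicator simp: less_top[symmetric]\<close>)
  qed
  have "expectation (\<lambda>\<omega>. intersections (Z \<omega>) ?A {a+n}) = (\<Sum>i\<in>?A. p (a + n - i))"
  proof -
    have sg: "(\<Sum>j\<in>{b}. f j) = f b" for f :: "nat \<Rightarrow> real" and b by simp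
    show ?thesis
      unfolding intersections_def sg
      by (subst Bochner_Integration.integral_sum, erule one(2), rule sum.cong[OF refl], erule one(1))
  qed
  also have "\<dots> = (\<Sum>k\<in>{1..<Suc n}. p k)"
    by (rule sum.reindex_bij_witness[where i="\<lambda>k. a + n - k" and j="\<lambda>i. a + n - i"]) auto
  also have "\<dots> = (\<Sum>k<Suc n. p k) - p 0"
  proof -
    have "sum p {0..<Suc n} = p 0 + sum p {Suc 0..<Suc n}" by (rule sum.atLeast_Suc_lessThan) simp
    then show ?thesis by (simp only: lessThan_atLeast0 One_nat_def add_diff_cancel_left')
  qed
  also have "p 0 = 1" using return_prob[of 0 0] by (simp add: inc_def prob_space)
  finally have "expectation (\<lambda>\<omega>. intersections (Z \<omega>) ?A {a+n}) = (\<Sum>k<Suc n. p k) - 1" .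
  moreover have "expectation (\<lambda>\<omega>. intersections (Z \<omega>) {a..<a+Suc n} {a..<a+Suc n})
      = expectation (\<lambda>\<omega>. intersections (Z \<omega>) ?A ?A) + 2 * expectation (\<lambda>\<omega>. intersections (Z \<omega>) ?A {a+n}) + 1"
    unfolding eq by (simp add: intersections_bounded_integrable prob_space)
  ultimately show ?case using Suc by (simp add: v_def)
qed

lemma v_asymp: "(\<lambda>n. v n / nlogn n) \<longlonglongrightarrow> 2 * c\<^sub>0"
proof -
  have "(\<lambda>n. (\<Sum>i<n. \<Sum>k<Suc i. p k) / nlogn n) \<longlonglongrightarrow> c\<^sub>0"
    by (rule sum_asymp_nlogn[OF green])
  moreover have "(\<lambda>n. real n / nlogn n) \<longlonglongrightarrow> 0" unfolding nlogn_def by real_asymp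
  ultimately have "(\<lambda>n. 2 * ((\<Sum>i<n. \<Sum>k<Suc i. p k) / nlogn n) - real n / nlogn n) \<longlonglongrightarrow> 2 * c\<^sub>0 - 0"
    by (intro tendsto_intros)
  then show ?thesis by (simp add: v_def diff_divide_distrib)
qed

abbreviation VV :: "'w \<Rightarrow> nat \<Rightarrow> real \<Rightarrow> real \<Rightarrow> real" where
  "VV \<omega> n s t \<equiv> intersections (Z \<omega>) (time_block n s t) (time_block n s t)"

lemma time_block_card:
  assumes "s \<le> t"
  obtains a where "time_block n s t = {a..<a + (nat \<lfloor>real n * t\<rfloor> - nat \<lfloor>real n * s\<rfloor>)}"
proof -
  have "nat \<lfloor>real n * s\<rfloor> \<le> nat \<lfloor>real n * t\<rfloor>" using assms by (intro nat_mono floor_mono mult_left_mono) auto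
  then show ?thesis by (intro that[of "nat \<lfloor>real n * s\<rfloor>"]) (simp add: time_block_def)
qed

text \<open>The variance lacks the logarithm of the mean, so Chebyshev gives a probability of order
  1 / (log N)^2, that is 1 / k^2 for N near \<theta>^k, and Borel-Cantelli applies. The time
  \<open>t\<close> may exceed 1, because the interpolation takes endpoints slightly to the right of
  the given ones.\<close>

lemma AE_geo_convergence:
  assumes st: "0 \<le> s" "s < t" and \<theta>: "\<theta> > 1"
  shows "AE \<omega> in P. (\<lambda>k. VV \<omega> (geo \<theta> k) s t / nlogn (geo \<theta> k)) \<longlonglongrightarrow> 2 * c\<^sub>0 * (t - s)"
proof -
  let ?N = "geo \<theta>"
  define m where "m k = nat \<lfloor>real (?N k) * t\<rfloor> - nat \<lfloor>real (?N k) * s\<rfloor>" for k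
  have Nr: "filterlim (\<lambda>k. real (?N k)) at_top sequentially"
    by (rule filterlim_compose[OF filterlim_real_sequentially geo_at_top[OF \<theta>]])
  have N1: "real (?N k) \<ge> 1" for k
    using geo_bounds(1)[OF \<theta>, of k] one_le_power[of \<theta> k] \<theta> by linarith
  have mm: "real (?N k) * (t - s) - 1 \<le> real (m k)" "real (m k) \<le> real (?N k) * (t - s) + 1" for k
  proof -
    have "0 \<le> real (?N k) * s" "real (?N k) * s \<le> real (?N k) * t"
      using st by (auto intro!: mult_left_mono)
    then have "real (m k) = of_int \<lfloor>real (?N k) * t\<rfloor> - of_int \<lfloor>real (?N k) * s\<rfloor>"
      unfolding m_def by (subst of_nat_diff) (auto intro!: nat_mono floor_mono)
    then show "real (?N k) * (t - s) - 1 \<le> real (m k)" "real (m k) \<le> real (?N k) * (t - s) + 1"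
      unfolding right_diff_distrib by linarith+
  qed
  have mlim: "(\<lambda>k. real (m k) / real (?N k)) \<longlonglongrightarrow> t - s"
  proof (rule tendsto_sandwich)
    have i: "(\<lambda>k. 1 / real (?N k)) \<longlonglongrightarrow> 0" by (rule tendsto_divide_0[OF tendsto_const filterlim_at_top_imp_at_infinity[OF Nr]])
    show "(\<lambda>k. (t - s) - 1 / real (?N k)) \<longlonglongrightarrow> t - s" using tendsto_diff[OF tendsto_const i, of "t - s"] by simp
    show "(\<lambda>k. (t - s) + 1 / real (?N k)) \<longlonglongrightarrow> t - s" using tendsto_add[OF tendsto_const i, of "t - s"] by simp
    have N0: "0 < real (?N k)" for k using N1[of k] by linarith
    show "eventually (\<lambda>k. (t - s) - 1 / real (?N k) \<le> real (m k) / real (?N k)) sequentially"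
    proof (intro always_eventually allI)
      fix k show "(t - s) - 1 / real (?N k) \<le> real (m k) / real (?N k)"
        using divide_right_mono[OF mm(1)[of k], of "real (?N k)"] N0[of k] by (simp add: diff_divide_distrib)
    qed
    show "eventually (\<lambda>k. real (m k) / real (?N k) \<le> (t - s) + 1 / real (?N k)) sequentially"
    proof (intro always_eventually allI)
      fix k show "real (m k) / real (?N k) \<le> (t - s) + 1 / real (?N k)"
        using divide_right_mono[OF mm(2)[of k], of "real (?N k)"] N0[of k] by (simp add: add_divide_distrib)
    qed
  qed
  note rat = nlogn_ratio[OF geo_at_top[OF \<theta>] mlim]
  have blk: "\<exists>a. time_block (?N k) s t = {a..<a + m k}" for k
    using time_block_card[of s t "?N k"] st unfolding m_def by (metis less_imp_le)
  have mean: "expectation (\<lambda>\<omega>. VV \<omega> (?N k) s t) = v (m k)" for k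
    using blk[of k] expectation_self_intersections by metis
  have var: "variance (\<lambda>\<omega>. VV \<omega> (?N k) s t) \<le> 1152 * K\<^sup>2 * (real (m k))\<^sup>2" for k
    using blk[of k] variance_self_intersections by metis
  have meanlim: "(\<lambda>k. v (m k) / nlogn (?N k)) \<longlonglongrightarrow> 2 * c\<^sub>0 * (t - s)"
  proof -
    have 1: "(\<lambda>k. v (m k) / nlogn (m k)) \<longlonglongrightarrow> 2 * c\<^sub>0"
      using filterlim_compose[OF v_asymp rat(2)] st by simp
    have "(\<lambda>k. v (m k) / nlogn (m k) * (nlogn (m k) / nlogn (?N k))) \<longlonglongrightarrow> 2 * c\<^sub>0 * (t - s)"
      by (rule tendsto_mult[OF 1 rat(1)]) (use st in auto)
    then show ?thesis
    proof (rule Lim_transform_eventually)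
      have "filterlim m at_top sequentially" using rat(2) st by simp
      then have "eventually (\<lambda>k. m k \<ge> 2) sequentially" by (simp add: filterlim_at_top)
      then show "eventually (\<lambda>k. v (m k) / nlogn (m k) * (nlogn (m k) / nlogn (?N k)) = v (m k) / nlogn (?N k)) sequentially"
      proof eventually_elim
        case (elim k)
        then have "nlogn (m k) \<noteq> 0" using nlogn_pos[of "m k"] by simp
        then show ?case by simp
      qed
    qed
  qed
  define D where "D k \<omega> = (VV \<omega> (?N k) s t - v (m k)) / nlogn (?N k)" for k \<omega>
  have Dm[measurable]: "D k \<in> borel_measurable P" for k
    unfolding D_def by measurable
  have "AE \<omega> in P. (\<lambda>k. D k \<omega>) \<longlonglongrightarrow> 0"
  proof -
    have key: "AE \<omega> in P. eventually (\<lambda>k. \<bar>D k \<omega>\<bar> < e) sequentially" if e: "e > 0" for e :: real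
    proof -
      define c where "c = 1152 * K\<^sup>2 * (t - s + 1)\<^sup>2 / (e\<^sup>2 * (ln \<theta>)\<^sup>2)"
      have bound: "prob {\<omega>\<in>space P. e \<le> \<bar>D k \<omega>\<bar>} \<le> c / (real k)\<^sup>2" if k: "k \<ge> 1" for k
      proof -
        have lnN: "real k * ln \<theta> \<le> ln (real (?N k))"
        proof -
          have "ln (\<theta> ^ k) \<le> ln (real (?N k))" using geo_bounds(1)[OF \<theta>, of k] \<theta> N1[of k]
            by (subst ln_le_cancel_iff) (auto simp: less_le_trans[OF zero_less_one])
          then show ?thesis using \<theta> by (simp add: ln_realpow)
        qed
        have lk: "0 < real k * ln \<theta>" using k \<theta> by simp
        then have Q: "nlogn (?N k) > 0" "real (?N k) * (real k * ln \<theta>) \<le> nlogn (?N k)"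
          unfolding nlogn_def using lnN N1[of k] by (auto intro!: mult_pos_pos mult_left_mono less_le_trans[OF lk lnN] less_le_trans[OF zero_less_one N1])
        have "prob {\<omega>\<in>space P. e \<le> \<bar>D k \<omega>\<bar>} = prob {\<omega>\<in>space P. \<bar>VV \<omega> (?N k) s t - v (m k)\<bar> \<ge> e * nlogn (?N k)}"
          using Q(1) by (simp add: D_def abs_divide le_divide_eq)
        also have "\<dots> \<le> variance (\<lambda>\<omega>. VV \<omega> (?N k) s t) / (e * nlogn (?N k))\<^sup>2"
          unfolding mean[symmetric] using e Q(1) by (intro Chebyshev_inequality intersections_bounded_integrable) auto
        also have "\<dots> \<le> 1152 * K\<^sup>2 * (real (m k))\<^sup>2 / (e * nlogn (?N k))\<^sup>2"
          by (intro divide_right_mono var) auto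
        also have "\<dots> \<le> 1152 * K\<^sup>2 * (real (?N k) * (t - s + 1))\<^sup>2 / (e * (real (?N k) * (real k * ln \<theta>)))\<^sup>2"
        proof (intro frac_le mult_left_mono power_mono)
          show "real (m k) \<le> real (?N k) * (t - s + 1)" using mm(2)[of k] N1[of k] by (simp add: algebra_simps)
          have "0 < real (?N k)" using N1[of k] by linarith
          then show "0 < (e * (real (?N k) * (real k * ln \<theta>)))\<^sup>2" using e k \<theta> by (intro zero_less_power mult_pos_pos) auto
          show "0 \<le> e * (real (?N k) * (real k * ln \<theta>))" using e lk by simp
        qed (use e Q in auto)
        also have "\<dots> = c / (real k)\<^sup>2"
        proof -
          have alg: "A * (x * w)\<^sup>2 / (e * (x * (y * l)))\<^sup>2 = A * w\<^sup>2 / (e\<^sup>2 * l\<^sup>2) / y\<^sup>2" if "x \<noteq> 0" for A x w y l :: real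
            using that by (simp add: power_mult_distrib mult_ac)
          show ?thesis unfolding c_def by (rule alg) (use N1[of k] in auto)
        qed
        finally show ?thesis .
      qed
      have "summable (\<lambda>k. prob {\<omega>\<in>space P. e \<le> \<bar>D k \<omega>\<bar>})"
      proof (rule summable_comparison_test'[of "\<lambda>k. c * (1 / (real k)\<^sup>2)" 1])
        show "summable (\<lambda>k. c * (1 / (real k)\<^sup>2))"
          using inverse_power_summable[of 2] by (intro summable_mult) (simp add: inverse_eq_divide)
      qed (use bound in simp)
      then have "AE \<omega> in P. eventually (\<lambda>k. \<omega> \<in> space P - {\<omega>\<in>space P. e \<le> \<bar>D k \<omega>\<bar>}) sequentially"
        by (intro borel_cantelli_AE1) (auto simp: less_top[symmetric])
      then show ?thesis
        by (rule AE_mp) (auto intro!: AE_I2 elim!: eventually_mono)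
    qed
    have "AE \<omega> in P. \<forall>r::nat. eventually (\<lambda>k. \<bar>D k \<omega>\<bar> < 1 / real (Suc r)) sequentially"
      unfolding AE_all_countable by (intro allI key) simp
    then show ?thesis
    proof eventually_elim
      case (elim \<omega>)
      show ?case
      proof (rule tendstoI)
        fix e :: real assume "e > 0"
        then obtain r where "1 / real (Suc r) < e" by (metis inverse_eq_divide reals_Archimedean)
        with elim[rule_format, of r] show "eventually (\<lambda>k. dist (D k \<omega>) 0 < e) sequentially"
          by (auto elim!: eventually_mono)
      qed
    qed
  qed
  then show ?thesis
  proof eventually_elim
    case (elim \<omega>)
    from tendsto_add[OF elim meanlim] show ?case
      by (simp add: D_def diff_divide_distrib)
  qed
qed

end

lemma intersections_mono: "A \<subseteq> B \<Longrightarrow> finite B \<Longrightarrow> intersections z A A \<le> intersections z B B"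
  unfolding intersections_def
  by (intro order_trans[OF sum_mono[OF sum_mono2] sum_mono2] sum_nonneg) (auto intro: finite_subset)

lemma nlogn_mono: "1 \<le> m \<Longrightarrow> m \<le> n \<Longrightarrow> nlogn m \<le> nlogn n"
  unfolding nlogn_def by (intro mult_mono) auto

lemma time_block_mono:
  assumes "real N * s' \<le> real n * s" "real n * t \<le> real N * t'"
  shows "time_block n s t \<subseteq> time_block N s' t'"
proof -
  have "nat \<lfloor>real N * s'\<rfloor> \<le> nat \<lfloor>real n * s\<rfloor>" "nat \<lfloor>real n * t\<rfloor> \<le> nat \<lfloor>real N * t'\<rfloor>"
    using assms by (auto intro!: nat_mono floor_mono)
  then show ?thesis by (auto simp: time_block_def)
qed

lemma geo_bracket:
  assumes "\<theta> > 1"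
  obtains \<kappa> :: "nat \<Rightarrow> nat" where "filterlim \<kappa> at_top sequentially"
    "\<And>n. n \<ge> 1 \<Longrightarrow> geo \<theta> (\<kappa> n) \<le> n" "\<And>n. n < geo \<theta> (Suc (\<kappa> n))"
proof
  let ?\<kappa> = "\<lambda>n. LEAST k. n < geo \<theta> (Suc k)"
  have ex: "\<exists>k. n < geo \<theta> (Suc k)" for n
  proof -
    have "eventually (\<lambda>k. Suc n \<le> geo \<theta> k) sequentially" using geo_at_top[OF assms] by (simp add: filterlim_at_top)
    then obtain k0 where "\<And>k. k \<ge> k0 \<Longrightarrow> Suc n \<le> geo \<theta> k" by (auto simp: eventually_sequentially)
    from this[of "Suc k0"] show ?thesis by (auto intro!: exI[of _ k0])
  qed
  show 1: "n < geo \<theta> (Suc (?\<kappa> n))" for n by (rule LeastI_ex[OF ex])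
  show "geo \<theta> (?\<kappa> n) \<le> n" if "n \<ge> 1" for n
  proof (cases "?\<kappa> n")
    case 0
    then show ?thesis using that by (simp add: geo_def)
  next
    case (Suc j)
    then have "j < ?\<kappa> n" by simp
    from not_less_Least[OF this] Suc show ?thesis by simp
  qed
  show "filterlim ?\<kappa> at_top sequentially"
    unfolding filterlim_at_top
  proof
    fix J
    have "eventually (\<lambda>n. \<forall>k\<in>{..<J}. geo \<theta> (Suc k) \<le> n) sequentially"
      by (rule eventually_ball_finite) (auto intro: eventually_ge_at_top)
    then show "eventually (\<lambda>n. J \<le> ?\<kappa> n) sequentially"
    proof eventually_elim
      case (elim n)
      show ?case
      proof (rule ccontr)
        assume "\<not> J \<le> ?\<kappa> n"
        then have "geo \<theta> (Suc (?\<kappa> n)) \<le> n" using elim by simp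
        then show False using 1[of n] by simp
      qed
    qed
  qed
qed

text \<open>Take k with N_k <= n < N_(k+1) along the geometric times. As n / N_k is at most about
  \<theta>, the block of [s, t] at n lies between the blocks at N_k of a slightly smaller and a
  slightly larger rational interval, and self-intersections are monotone in the block. Rational
  endpoints and the ratios 1 + 1 / (r + 1) keep the limits that must hold together countable in
  number.\<close>

lemma self_intersections_interpolate:
  fixes z :: "nat \<Rightarrow> 'l" and C :: real
  defines "VV \<equiv> \<lambda>n s t. intersections z (time_block n s t) (time_block n s t)"
  assumes C: "C > 0"
    and geo: "\<And>s t r. s \<in> \<rat> \<Longrightarrow> t \<in> \<rat> \<Longrightarrow> 0 \<le> s \<Longrightarrow> s < t \<Longrightarrow>
      (\<lambda>k. VV (geo (1 + 1 / real (Suc r)) k) s t / nlogn (geo (1 + 1 / real (Suc r)) k)) \<longlonglongrightarrow> C * (t - s)"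
    and st: "0 \<le> s" "s \<le> t"
  shows "(\<lambda>n. VV n s t / nlogn n) \<longlonglongrightarrow> C * (t - s)"
proof (cases "s = t")
  case True
  then show ?thesis by (simp add: VV_def time_block_def intersections_def)
next
  case False
  then have lt: "s < t" using st by simp
  show ?thesis
  proof (rule tendstoI)
    fix e0 :: real assume "e0 > 0"
    \<comment> \<open>The cap by C (t - s) keeps the lower target \<open>a\<close> nonnegative and
      the inner interval nonempty.\<close>
    define \<epsilon> where "\<epsilon> = min e0 (C * (t - s))"
    have \<epsilon>: "\<epsilon> > 0" "\<epsilon> \<le> e0" "\<epsilon> \<le> C * (t - s)" using \<open>e0 > 0\<close> C lt by (auto simp: \<epsilon>_def)
    define \<eta> where "\<eta> = \<epsilon> / (3 * C)"
    have \<eta>: "\<eta> > 0" "C * \<eta> = \<epsilon> / 3" using \<epsilon> C by (auto simp: \<eta>_def)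
    have "C * (3 * \<eta>) \<le> C * (t - s)" using \<eta>(2) \<epsilon>(3) by (simp add: algebra_simps)
    then have \<eta>3: "3 * \<eta> \<le> t - s" using C by simp
    define a where "a = C * (t - s) - \<epsilon>"
    have \<theta>lim: "(\<lambda>r. (1 + 1 / real (Suc r)) * x) \<longlonglongrightarrow> x" for x :: real
    proof -
      have "(\<lambda>r. 1 / real (Suc r)) \<longlonglongrightarrow> 0" by (rule LIMSEQ_Suc, rule lim_const_over_n)
      then have "(\<lambda>r. (1 + 1 / real (Suc r)) * x) \<longlonglongrightarrow> (1 + 0) * x" by (intro tendsto_intros)
      then show ?thesis by simp
    qed
    have "eventually (\<lambda>r. (1 + 1 / real (Suc r)) * t < t + \<eta> / 2 \<and> (1 + 1 / real (Suc r)) * s < s + \<eta> / 2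
        \<and> (1 + 1 / real (Suc r)) * a < a + \<epsilon> / 3) sequentially"
      by (intro eventually_conj order_tendstoD(2)[OF \<theta>lim]) (use \<eta> \<epsilon> in auto)
    then obtain r where r: "(1 + 1 / real (Suc r)) * t < t + \<eta> / 2" "(1 + 1 / real (Suc r)) * s < s + \<eta> / 2"
        "(1 + 1 / real (Suc r)) * a < a + \<epsilon> / 3"
      using eventually_happens'[OF sequentially_bot] by blast
    define \<theta> where "\<theta> = 1 + 1 / real (Suc r)"
    have \<theta>: "\<theta> > 1" by (simp add: \<theta>_def)
    obtain sm where sm: "sm \<in> \<rat>" "0 \<le> sm" "sm \<le> s" "s - \<eta> < sm"
    proof (cases "s = 0")
      case True then show ?thesis using that[of 0] \<eta> by simp
    next
      case False
      then have "max 0 (s - \<eta>) < s" using st \<eta> by simp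
      from Rats_dense_in_real[OF this] show ?thesis using that by force
    qed
    obtain tp where tp: "tp \<in> \<rat>" "t + \<eta> / 2 < tp" "tp < t + \<eta>"
      using Rats_dense_in_real[of "t + \<eta> / 2" "t + \<eta>"] \<eta> by auto
    obtain sp where sp: "sp \<in> \<rat>" "s + \<eta> / 2 < sp" "sp < s + \<eta>"
      using Rats_dense_in_real[of "s + \<eta> / 2" "s + \<eta>"] \<eta> by auto
    obtain tm where tm: "tm \<in> \<rat>" "t - \<eta> < tm" "tm < t"
      using Rats_dense_in_real[of "t - \<eta>" t] \<eta> by auto
    have order: "0 \<le> sm" "sm < tp" "0 \<le> sp" "sp < tm" "0 \<le> tm"
      using sm tp sp tm \<eta>3 \<eta>(1) st lt by linarith+
    let ?N = "geo \<theta>"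
    obtain \<kappa> where \<kappa>: "filterlim \<kappa> at_top sequentially"
      "\<And>n. n \<ge> 1 \<Longrightarrow> ?N (\<kappa> n) \<le> n" "\<And>n. n < ?N (Suc (\<kappa> n))" using geo_bracket[OF \<theta>] by blast
    have up: "(\<lambda>k. VV (?N k) sm tp / nlogn (?N k)) \<longlonglongrightarrow> C * (tp - sm)"
      unfolding \<theta>_def by (rule geo) (use sm tp order in auto)
    have lo: "(\<lambda>k. VV (?N k) sp tm / nlogn (?N k)) \<longlonglongrightarrow> C * (tm - sp)"
      unfolding \<theta>_def by (rule geo) (use sp tm order in auto)
    have rl: "(\<lambda>k. nlogn (?N (Suc k)) / nlogn (?N k)) \<longlonglongrightarrow> \<theta>"
      by (rule nlogn_ratio(1)[OF geo_at_top[OF \<theta>] geo_ratio[OF \<theta>]]) (use \<theta> in simp)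
    have up': "C * (tp - sm) < C * (t - s) + \<epsilon>"
    proof -
      have "C * (tp - sm) < C * (t - s + 2 * \<eta>)" using tp sm C by (intro mult_strict_left_mono) auto
      also have "\<dots> = C * (t - s) + 2 * (\<epsilon> / 3)" unfolding \<eta>(2)[symmetric] by (simp add: algebra_simps)
      also have "\<dots> < C * (t - s) + \<epsilon>" using \<epsilon> by simp
      finally show ?thesis .
    qed
    have lo': "\<theta> * a < C * (tm - sp)"
    proof -
      have "\<theta> * a < a + \<epsilon> / 3" using r(3) by (simp add: \<theta>_def)
      also have "a + \<epsilon> / 3 = C * (t - s) - 2 * (C * \<eta>)" unfolding \<eta>(2) by (simp add: a_def)
      also have "\<dots> = C * (t - s - 2 * \<eta>)" by (simp add: algebra_simps)
      also have "\<dots> < C * (tm - sp)" using tm sp C by (intro mult_strict_left_mono) auto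
      finally show ?thesis .
    qed
    have rt: "(\<lambda>k. real (?N (Suc k)) / real (?N k) * x) \<longlonglongrightarrow> \<theta> * x" for x
      by (intro tendsto_mult geo_ratio[OF \<theta>] tendsto_const)
    have e1: "eventually (\<lambda>k. VV (?N k) sm tp / nlogn (?N k) < C * (t - s) + \<epsilon>) sequentially"
      by (rule order_tendstoD(2)[OF up up'])
    \<comment> \<open>The lower bound is compared with \<open>nlogn\<close> at the next geometric
      time, which dominates \<open>nlogn n\<close>; the ratio of the two is close to \<theta>, and
      the choice of \<theta> left room for it.\<close>
    have "(\<lambda>k. VV (?N k) sp tm / nlogn (?N k) - a * (nlogn (?N (Suc k)) / nlogn (?N k))) \<longlonglongrightarrow> C * (tm - sp) - a * \<theta>"
      by (intro tendsto_intros lo rl)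
    then have e2: "eventually (\<lambda>k. 0 < VV (?N k) sp tm / nlogn (?N k) - a * (nlogn (?N (Suc k)) / nlogn (?N k))) sequentially"
      by (rule order_tendstoD(1)) (use lo' in \<open>simp add: mult.commute\<close>)
    have e3: "eventually (\<lambda>k. real (?N (Suc k)) / real (?N k) * t < t + \<eta> / 2) sequentially"
      by (rule order_tendstoD(2)[OF rt]) (use r in \<open>simp add: \<theta>_def\<close>)
    have e4: "eventually (\<lambda>k. real (?N (Suc k)) / real (?N k) * s < s + \<eta> / 2) sequentially"
      by (rule order_tendstoD(2)[OF rt]) (use r in \<open>simp add: \<theta>_def\<close>)
    have e5: "eventually (\<lambda>k. ?N k \<ge> 2) sequentially" using geo_at_top[OF \<theta>] by (simp add: filterlim_at_top)
    from e1 e2 e3 e4 e5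
    have "eventually (\<lambda>k. VV (?N k) sm tp / nlogn (?N k) < C * (t - s) + \<epsilon> \<and>
        0 < VV (?N k) sp tm / nlogn (?N k) - a * (nlogn (?N (Suc k)) / nlogn (?N k)) \<and>
        real (?N (Suc k)) / real (?N k) * t < t + \<eta> / 2 \<and> real (?N (Suc k)) / real (?N k) * s < s + \<eta> / 2 \<and> ?N k \<ge> 2) sequentially"
      by eventually_elim simp
    then have "eventually (\<lambda>n. VV (?N (\<kappa> n)) sm tp / nlogn (?N (\<kappa> n)) < C * (t - s) + \<epsilon> \<and>
        0 < VV (?N (\<kappa> n)) sp tm / nlogn (?N (\<kappa> n)) - a * (nlogn (?N (Suc (\<kappa> n))) / nlogn (?N (\<kappa> n))) \<and>
        real (?N (Suc (\<kappa> n))) / real (?N (\<kappa> n)) * t < t + \<eta> / 2 \<and> real (?N (Suc (\<kappa> n))) / real (?N (\<kappa> n)) * s < s + \<eta> / 2 \<and> ?N (\<kappa> n) \<ge> 2) sequentially"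
      using \<kappa>(1) by (rule eventually_compose_filterlim)
    then show "eventually (\<lambda>n. dist (VV n s t / nlogn n) (C * (t - s)) < e0) sequentially"
      using eventually_ge_at_top[of 2]
    proof eventually_elim
      case (elim n)
      define k where "k = \<kappa> n"
      have k: "VV (?N k) sm tp / nlogn (?N k) < C * (t - s) + \<epsilon>"
        "0 < VV (?N k) sp tm / nlogn (?N k) - a * (nlogn (?N (Suc k)) / nlogn (?N k))"
        "real (?N (Suc k)) / real (?N k) * t < t + \<eta> / 2" "real (?N (Suc k)) / real (?N k) * s < s + \<eta> / 2" "?N k \<ge> 2"
        using elim by (auto simp: k_def)
      have br: "?N k \<le> n" "n \<le> ?N (Suc k)" using \<kappa>(2)[of n] \<kappa>(3)[of n] elim by (auto simp: k_def)
      have Np: "real (?N k) > 0" using k(5) by simp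
      have pos: "0 < nlogn (?N k)" "0 < nlogn n" "0 < nlogn (?N (Suc k))"
        using k(5) br by (auto intro!: nlogn_pos)
      have stretch: "real n * x \<le> real (?N k) * y" if "0 \<le> x" "real (?N (Suc k)) / real (?N k) * x < x + \<eta> / 2" "x + \<eta> / 2 < y" for x y
      proof -
        have "real n * x \<le> real (?N (Suc k)) * x" using br that by (intro mult_right_mono) auto
        also have "\<dots> = real (?N k) * (real (?N (Suc k)) / real (?N k) * x)" using Np by simp
        also have "\<dots> \<le> real (?N k) * y" using that Np by (intro mult_left_mono) auto
        finally show ?thesis .
      qed
      have "VV n s t \<le> VV (?N k) sm tp" unfolding VV_def
        by (intro intersections_mono time_block_mono stretch mult_mono) (use br sm st tp k in auto)
      then have "VV n s t / nlogn n \<le> VV (?N k) sm tp / nlogn (?N k)"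
        using pos br k(5) by (intro frac_le nlogn_mono) (auto simp: VV_def intersections_nonneg)
      then have u: "VV n s t / nlogn n < C * (t - s) + \<epsilon>" using k(1) by linarith
      have low: "VV (?N k) sp tm \<le> VV n s t" unfolding VV_def
        by (intro intersections_mono time_block_mono stretch mult_mono) (use br sp st tm k order in auto)
      have a0: "0 \<le> a" using \<epsilon>(3) by (simp add: a_def)
      have "a * nlogn n \<le> a * nlogn (?N (Suc k))" using br elim a0 by (intro mult_left_mono nlogn_mono) auto
      also have "\<dots> < VV (?N k) sp tm"
      proof -
        have "a * nlogn (?N (Suc k)) / nlogn (?N k) < VV (?N k) sp tm / nlogn (?N k)" using k(2) by simp
        then show ?thesis using pos(1) by (simp add: divide_less_cancel)
      qed
      finally have "a * nlogn n < VV n s t" using low by linarith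
      then have "a < VV n s t / nlogn n" using pos(2) by (simp add: less_divide_eq)
      then show ?case using u \<epsilon>(2) unfolding dist_real_def a_def by linarith
    qed
  qed
qed

context log_walk begin

theorem AE_normalised_self_intersections:
  "AE \<omega> in P. normalised_self_intersections (Z \<omega>) (2 * c\<^sub>0)"
proof -
  have "AE \<omega> in P. \<forall>q q' :: rat. \<forall>r :: nat. 0 \<le> q \<and> q < q' \<longrightarrow>
      (\<lambda>k. VV \<omega> (geo (1 + 1 / real (Suc r)) k) (of_rat q) (of_rat q') / nlogn (geo (1 + 1 / real (Suc r)) k))
        \<longlonglongrightarrow> 2 * c\<^sub>0 * (of_rat q' - of_rat q)"
    unfolding AE_all_countable
  proof (intro allI)
    fix q q' :: rat and r :: nat
    show "AE \<omega> in P. 0 \<le> q \<and> q < q' \<longrightarrow>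
      (\<lambda>k. VV \<omega> (geo (1 + 1 / real (Suc r)) k) (of_rat q) (of_rat q') / nlogn (geo (1 + 1 / real (Suc r)) k))
        \<longlonglongrightarrow> 2 * c\<^sub>0 * (of_rat q' - of_rat q)"
    proof (cases "0 \<le> q \<and> q < q'")
      case True
      have "AE \<omega> in P. (\<lambda>k. VV \<omega> (geo (1 + 1 / real (Suc r)) k) (of_rat q) (of_rat q') / nlogn (geo (1 + 1 / real (Suc r)) k))
        \<longlonglongrightarrow> 2 * c\<^sub>0 * (of_rat q' - of_rat q)"
        by (rule AE_geo_convergence) (use True in \<open>auto simp: of_rat_less\<close>)
      then show ?thesis by eventually_elim simp
    next
      case False
      then show ?thesis by (intro AE_I2) blast
    qed
  qed
  then show ?thesis
  proof eventually_elim
    case (elim \<omega>)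
    show ?case
    proof
      show "0 < 2 * c\<^sub>0" using c0_pos by simp
      fix s t :: real assume st: "0 \<le> s" "s \<le> t" "t \<le> 1"
      show "(\<lambda>n. VV \<omega> n s t / nlogn n) \<longlonglongrightarrow> 2 * c\<^sub>0 * (t - s)"
      proof (rule self_intersections_interpolate[OF _ _ st(1,2)])
        fix q q' :: real and r :: nat assume "q \<in> \<rat>" "q' \<in> \<rat>" and q: "0 \<le> q" "q < q'"
        then obtain a b where ab: "q = of_rat a" "q' = of_rat b" by (auto elim!: Rats_cases)
        show "(\<lambda>k. VV \<omega> (geo (1 + 1 / real (Suc r)) k) q q' / nlogn (geo (1 + 1 / real (Suc r)) k)) \<longlonglongrightarrow> 2 * c\<^sub>0 * (q' - q)"
          unfolding ab using elim[rule_format, of a b r] q unfolding ab by (simp add: of_rat_less)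
      qed (use c0_pos in simp)
    qed
  qed
qed

end

section \<open>Fourier analysis on the lattice\<close>

lemma abs_sin_of_nat_mult_le: "\<bar>sin (real n * x)\<bar> \<le> real n * \<bar>sin x\<bar>"
proof (induction n)
  case (Suc n)
  have "\<bar>sin (real (Suc n) * x)\<bar> = \<bar>sin (real n * x) * cos x + cos (real n * x) * sin x\<bar>"
  proof -
    have e: "real (Suc n) * x = real n * x + x" by (simp add: algebra_simps)
    show ?thesis unfolding e sin_add ..
  qed
  also have "\<dots> \<le> \<bar>sin (real n * x)\<bar> * \<bar>cos x\<bar> + \<bar>cos (real n * x)\<bar> * \<bar>sin x\<bar>"
    by (rule order_trans[OF abs_triangle_ineq]) (simp add: abs_mult)
  also have "\<dots> \<le> \<bar>sin (real n * x)\<bar> * 1 + 1 * \<bar>sin x\<bar>"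
    by (intro add_mono mult_left_mono mult_right_mono) auto
  finally show ?case using Suc by (simp add: algebra_simps)
qed simp

lemma sin_square_of_int_mult_le:
  fixes x :: real
  shows "(sin (of_int n * x))\<^sup>2 \<le> (of_int n)\<^sup>2 * (sin x)\<^sup>2"
proof -
  have "\<bar>sin (of_int n * x)\<bar> = \<bar>sin (real (nat \<bar>n\<bar>) * x)\<bar>"
    by (cases "n \<ge> 0") auto
  also have "\<dots> \<le> real (nat \<bar>n\<bar>) * \<bar>sin x\<bar>" by (rule abs_sin_of_nat_mult_le)
  finally have "\<bar>sin (of_int n * x)\<bar> \<le> \<bar>of_int n * sin x\<bar>" by (simp add: abs_mult)
  then show ?thesis by (simp add: abs_le_square_iff power_mult_distrib)
qed

text \<open>This makes the set of lattice vectors whose sine is controlled closed under subtraction,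
  hence a subgroup.\<close>

lemma sin_square_diff_le: "(sin (x - y))\<^sup>2 \<le> 2 * (sin x)\<^sup>2 + 2 * (sin (y::real))\<^sup>2"
proof -
  have "\<bar>sin (x - y)\<bar> \<le> \<bar>sin x * cos y\<bar> + \<bar>cos x * sin y\<bar>"
    unfolding sin_diff by (rule abs_triangle_ineq4)
  also have "\<dots> \<le> \<bar>sin x\<bar> * 1 + 1 * \<bar>sin y\<bar>"
    unfolding abs_mult by (intro add_mono mult_left_mono mult_right_mono) auto
  finally have "\<bar>sin (x - y)\<bar> \<le> \<bar>sin x\<bar> + \<bar>sin y\<bar>" by simp
  then have "\<bar>sin (x - y)\<bar>\<^sup>2 \<le> (\<bar>sin x\<bar> + \<bar>sin y\<bar>)\<^sup>2" by (rule power_mono) simp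
  also have "\<dots> \<le> 2 * (sin x)\<^sup>2 + 2 * (sin y)\<^sup>2"
    using zero_le_power2[of "\<bar>sin x\<bar> - \<bar>sin y\<bar>"] by (simp add: power2_sum power2_diff)
  finally show ?thesis by simp
qed

lemma jordan_sin:
  assumes "\<bar>x\<bar> \<le> pi / 2" shows "(2 / pi * x)\<^sup>2 \<le> (sin x)\<^sup>2"
proof -
  have pos: "2 / pi * y \<le> sin y" if y: "0 \<le> y" "y \<le> pi / 2" for y
  proof -
    have "concave_on {0..pi/2} sin"
      by (rule f''_le0_imp_concave[where f'=cos and f''="\<lambda>x. - sin x"])
         (auto intro!: derivative_eq_intros sin_ge_zero)
    from concave_onD[OF this, of "2 / pi * y" 0 "pi / 2"] y show ?thesis
      by (simp add: divide_le_eq)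
  qed
  have "\<bar>2 / pi * x\<bar> \<le> \<bar>sin x\<bar>"
    using pos[of x] pos[of "- x"] assms by (cases "x \<ge> 0") (auto simp: abs_mult)
  then show ?thesis by (rule abs_le_square_iff[THEN iffD1])
qed

lemma gaussian_integral:
  assumes a: "a > 0"
  shows "integrable lborel (\<lambda>x::real. exp (- a * (x - c)\<^sup>2))" "(\<integral>x. exp (- a * (x - c)\<^sup>2) \<partial>lborel) = sqrt (pi / a)"
proof -
  define \<sigma> where "\<sigma> = 1 / sqrt (2 * a)"
  have \<sigma>: "\<sigma> > 0" "\<sigma>\<^sup>2 = 1 / (2 * a)" using a by (auto simp: \<sigma>_def power_divide)
  have eq: "exp (- a * (x - c)\<^sup>2) = sqrt (pi / a) * normal_density c \<sigma> x" for x
    using a by (simp add: normal_density_def \<sigma>(2) real_sqrt_divide)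
  show "integrable lborel (\<lambda>x::real. exp (- a * (x - c)\<^sup>2))" "(\<integral>x. exp (- a * (x - c)\<^sup>2) \<partial>lborel) = sqrt (pi / a)"
    unfolding eq using integrable_normal_density[OF \<sigma>(1), of c] integral_normal_density[OF \<sigma>(1), of c] by auto
qed

section \<open>Integration over the torus\<close>

abbreviation circle_measure :: "real measure" where
  "circle_measure \<equiv> restrict_space lborel {-pi..pi}"

lemma finite_measure_circle: "finite_measure circle_measure"
  by (rule finite_measureI) (simp add: emeasure_restrict_space space_restrict_space)

abbreviation torus_measure :: "(real \<times> real) measure" where
  "torus_measure \<equiv> circle_measure \<Otimes>\<^sub>M circle_measure"

lemma finite_measure_torus: "finite_measure torus_measure"
  by (intro finite_measure_pair_measure finite_measure_circle)

lemma borel_measurable_circle: "f \<in> borel_measurable borel \<Longrightarrow> f \<in> borel_measurable circle_measure"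
  by (simp add: measurable_restrict_space1)

lemma measurable_id_circle[measurable]: "(\<lambda>x. x) \<in> borel_measurable circle_measure"
  by (rule borel_measurable_circle) simp

lemma circle_integral_character:
  fixes m :: int
  shows "(\<integral>x. iexp (x * of_int m) \<partial>circle_measure) = (if m = 0 then 2 * pi else 0)"
proof (cases "m = 0")
  case True
  have "measure circle_measure (space circle_measure) = 2 * pi"
    by (simp add: measure_restrict_space space_restrict_space)
  then show ?thesis using True by (simp add: scaleR_conv_of_real)
next
  case False
  define F where "F x = (1 / (\<i> * of_int m)) * iexp (of_int m * x)" for x :: real
  have der: "(F has_vector_derivative iexp (x * of_int m)) (at x within {-pi..pi})" for x
  proof -
    have "((\<lambda>x. of_int m * x) has_vector_derivative of_int m) (at x within {-pi..pi})"
      by (auto intro!: derivative_eq_intros simp: has_real_derivative_iff_has_vector_derivative[symmetric])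
    from vector_diff_chain_within[OF this has_vector_derivative_iexp]
    have "((\<lambda>x. iexp (of_int m * x)) has_vector_derivative of_int m *\<^sub>R (\<i> * iexp (of_int m * x))) (at x within {-pi..pi})"
      by (simp add: o_def)
    then have "(F has_vector_derivative (1 / (\<i> * of_int m)) * (of_int m *\<^sub>R (\<i> * iexp (of_int m * x)))) (at x within {-pi..pi})"
      unfolding F_def by (rule has_vector_derivative_mult_right)
    then show ?thesis using False by (simp add: scaleR_conv_of_real mult.commute)
  qed
  have "(\<integral>x. iexp (x * of_int m) \<partial>circle_measure) = (\<integral>x. indicator {-pi..pi} x *\<^sub>R iexp (x * of_int m) \<partial>lborel)"
    by (subst integral_restrict_space) auto
  also have "\<dots> = F pi - F (- pi)"
    by (rule integral_FTC_Icc[OF _ der]) (auto intro!: continuous_intros)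
  also have "F pi = F (- pi)"
  proof -
    have "iexp (of_int m * pi) = iexp (of_int m * (- pi))"
      by (simp only: cis_conv_exp[symmetric] complex_eq_iff cis.simps) (simp add: sin_times_pi_eq_0)
    then show ?thesis by (simp add: F_def)
  qed
  finally show ?thesis using False by simp
qed

definition dotp :: "real \<times> real \<Rightarrow> int ^ 2 \<Rightarrow> real" where
  "dotp w l = fst w * of_int (l $ 1) + snd w * of_int (l $ 2)"

lemma dotp_add: "dotp w (l + l') = dotp w l + dotp w l'"
  by (simp add: dotp_def algebra_simps)

lemma dotp_diff: "dotp w (l - l') = dotp w l - dotp w l'"
  by (simp add: dotp_def algebra_simps)

lemma dotp_0: "dotp w 0 = 0" by (simp add: dotp_def)

lemma dotp_sum: "dotp w (\<Sum>i\<in>A. f i) = (\<Sum>i\<in>A. dotp w (f i))"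
  by (induction A rule: infinite_finite_induct) (auto simp: dotp_add dotp_0)

lemma torus_integral_product:
  fixes f g :: "real \<Rightarrow> 'a::{real_normed_field, banach, second_countable_topology}"
  assumes "f \<in> borel_measurable borel" "g \<in> borel_measurable borel" and b: "\<And>x. norm (f x) \<le> B" "\<And>x. norm (g x) \<le> B"
  shows "(\<integral>w. f (fst w) * g (snd w) \<partial>torus_measure) = (\<integral>x. f x \<partial>circle_measure) * (\<integral>y. g y \<partial>circle_measure)"
proof -
  interpret U: finite_measure circle_measure by (rule finite_measure_circle)
  interpret T: finite_measure torus_measure by (rule finite_measure_torus)
  interpret pair_sigma_finite circle_measure circle_measure ..
  have m[measurable]: "f \<in> borel_measurable circle_measure" "g \<in> borel_measurable circle_measure"
    using assms by (auto intro: borel_measurable_circle)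
  have "0 \<le> B" using b(1)[of undefined] norm_ge_zero order_trans by blast
  then have "integrable torus_measure (\<lambda>(x, y). f x * g y)"
    by (intro T.integrable_const_bound[where B="B * B"])
       (auto simp: norm_mult case_prod_beta' intro!: AE_I2 mult_mono b)
  from integral_fst[OF this] show ?thesis by (simp add: case_prod_beta')
qed

lemma torus_integral_character:
  "(\<integral>w. iexp (dotp w l) \<partial>torus_measure) = (if l = 0 then (2 * pi)\<^sup>2 else 0)"
proof -
  have "(\<integral>w. iexp (dotp w l) \<partial>torus_measure) = (\<integral>w. iexp (fst w * of_int (l $ 1)) * iexp (snd w * of_int (l $ 2)) \<partial>torus_measure)"
    by (simp add: dotp_def exp_add[symmetric] distrib_left)
  also have "\<dots> = (\<integral>x. iexp (x * of_int (l $ 1)) \<partial>circle_measure) * (\<integral>y. iexp (y * of_int (l $ 2)) \<partial>circle_measure)"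
    by (rule torus_integral_product[where f="\<lambda>x. iexp (x * of_int (l $ 1))" and g="\<lambda>y. iexp (y * of_int (l $ 2))" and B=1])
       (auto intro!: borel_measurable_continuous_onI continuous_intros)
  also have "\<dots> = (if l = 0 then (2 * pi)\<^sup>2 else 0)"
    unfolding circle_integral_character by (auto simp: vec_eq_iff forall_2 power2_eq_square)
  finally show ?thesis .
qed

text \<open>The exponent vanishes at the multiples of 2 pi / d. Near each of them Jordan's
  inequality replaces it by a parabola, so the integrand is below a sum of Gaussians centred at
  these points. Each integrates to order \<kappa>^(-1/2), and two such factors will give the decay 1
  / k.\<close>

lemma circle_integral_exp_sin_le:
  fixes d :: int
  assumes d: "d \<noteq> 0" and \<kappa>: "\<kappa> > 0"
  shows "(\<integral>x. exp (- \<kappa> * (sin (of_int d * x / 2))\<^sup>2) \<partial>circle_measure) \<le> (2 * \<bar>of_int d\<bar> + 1) * sqrt (pi / (\<kappa> * (of_int d / pi)\<^sup>2))"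
proof -
  let ?J = "{- \<bar>d\<bar>..\<bar>d\<bar>}"
  define a where "a = \<kappa> * (of_int d / pi)\<^sup>2"
  have a: "a > 0" using d \<kappa> by (simp add: a_def)
  let ?g = "\<lambda>j x. exp (- a * (x - 2 * pi * of_int j / of_int d)\<^sup>2)"
  have pt: "exp (- \<kappa> * (sin (of_int d * x / 2))\<^sup>2) \<le> (\<Sum>j\<in>?J. ?g j x)" if x: "x \<in> {-pi..pi}" for x :: real
  proof -
    \<comment> \<open>The index of the zero nearest to x.\<close>
    define j where "j = round (of_int d * x / (2 * pi))"
    have r: "\<bar>of_int j - of_int d * x / (2 * pi)\<bar> \<le> 1 / 2" unfolding j_def by (rule of_int_round_abs_le)
    have "\<bar>of_int d * x / (2 * pi)\<bar> = \<bar>of_int d\<bar> * (\<bar>x\<bar> / (2 * pi))" by (simp add: abs_mult)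
    also have "\<dots> \<le> \<bar>of_int d\<bar> * (1 / 2)" using x by (intro mult_left_mono) (auto simp: divide_le_eq)
    finally have "\<bar>of_int j\<bar> \<le> \<bar>real_of_int d\<bar> / 2 + 1 / 2" using r by linarith
    moreover have "1 \<le> \<bar>real_of_int d\<bar>" using d by linarith
    ultimately have "\<bar>real_of_int j\<bar> \<le> \<bar>real_of_int d\<bar>" by linarith
    then have "\<bar>j\<bar> \<le> \<bar>d\<bar>" by linarith
    then have jJ: "j \<in> ?J" by auto
    define u where "u = of_int d * x / 2 - of_int j * pi"
    have "u = - pi * (of_int j - of_int d * x / (2 * pi))" by (simp add: u_def field_simps)
    then have "\<bar>u\<bar> = pi * \<bar>of_int j - of_int d * x / (2 * pi)\<bar>" by (simp add: abs_mult)
    also have "\<dots> \<le> pi * (1 / 2)" by (intro mult_left_mono r) simp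
    finally have u: "\<bar>u\<bar> \<le> pi / 2" by simp
    have "sin u = sin (of_int d * x / 2) * cos (of_int j * pi)"
      by (simp add: u_def sin_diff sin_times_pi_eq_0)
    moreover have "(cos (of_int j * pi))\<^sup>2 = 1"
      by (simp add: cos_squared_eq sin_times_pi_eq_0)
    ultimately have "(sin u)\<^sup>2 = (sin (of_int d * x / 2))\<^sup>2" by (simp add: power_mult_distrib)
    then have "(2 / pi * u)\<^sup>2 \<le> (sin (of_int d * x / 2))\<^sup>2" using jordan_sin[OF u] by simp
    also have "2 / pi * u = of_int d / pi * (x - 2 * pi * of_int j / of_int d)"
      using d by (simp add: u_def field_simps)
    finally have le: "(of_int d / pi * (x - 2 * pi * of_int j / of_int d))\<^sup>2 \<le> (sin (of_int d * x / 2))\<^sup>2" .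
    have "a * (x - 2 * pi * of_int j / of_int d)\<^sup>2 = \<kappa> * (of_int d / pi * (x - 2 * pi * of_int j / of_int d))\<^sup>2"
      unfolding a_def power_mult_distrib mult.assoc ..
    also have "\<dots> \<le> \<kappa> * (sin (of_int d * x / 2))\<^sup>2" using \<kappa> le by (intro mult_left_mono) auto
    finally have "a * (x - 2 * pi * of_int j / of_int d)\<^sup>2 \<le> \<kappa> * (sin (of_int d * x / 2))\<^sup>2" .
    then have "exp (- \<kappa> * (sin (of_int d * x / 2))\<^sup>2) \<le> ?g j x" by simp
    also have "\<dots> \<le> (\<Sum>j\<in>?J. ?g j x)" using jJ by (intro member_le_sum) auto
    finally show ?thesis .
  qed
  have gi: "integrable lborel (\<lambda>x. \<Sum>j\<in>?J. ?g j x)" by (intro Bochner_Integration.integrable_sum gaussian_integral a)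
  have bi: "integrable lborel (\<lambda>x. indicator {-pi..pi} x *\<^sub>R exp (- \<kappa> * (sin (of_int d * x / 2))\<^sup>2))"
    by (rule borel_integrable_compact) (auto intro!: continuous_intros)
  have "(\<integral>x. exp (- \<kappa> * (sin (of_int d * x / 2))\<^sup>2) \<partial>circle_measure) = (\<integral>x. indicator {-pi..pi} x *\<^sub>R exp (- \<kappa> * (sin (of_int d * x / 2))\<^sup>2) \<partial>lborel)"
    by (subst integral_restrict_space) auto
  also have "\<dots> \<le> (\<integral>x. (\<Sum>j\<in>?J. ?g j x) \<partial>lborel)"
    by (rule integral_mono[OF bi gi]) (use pt in \<open>auto simp: indicator_def intro!: sum_nonneg\<close>)
  also have "\<dots> = (\<Sum>j\<in>?J. sqrt (pi / a))"
    by (subst Bochner_Integration.integral_sum, rule gaussian_integral(1)[OF a], simp only: gaussian_integral(2)[OF a])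
  also have "\<dots> = (2 * \<bar>of_int d\<bar> + 1) * sqrt (pi / a)" by simp
  finally show ?thesis unfolding a_def .
qed

section \<open>The characteristic function of the step\<close>

locale lattice_walk = countable_walk P \<zeta> for P :: "'w measure" and \<zeta> :: "nat \<Rightarrow> 'w \<Rightarrow> int ^ 2" +
  assumes ident: "\<And>i. distr P (count_space UNIV) (\<zeta> i) = distr P (count_space UNIV) (\<zeta> 0)"
    and L2: "\<And>j. integrable P (\<lambda>\<omega>. (to_real2 (\<zeta> 0 \<omega>) $ j)\<^sup>2)"
    and mean: "\<And>j. expectation (\<lambda>\<omega>. to_real2 (\<zeta> 0 \<omega>) $ j) = 0"
    and aperiodic: "gen_subgroup {l. prob {\<omega> \<in> space P. \<zeta> 0 \<omega> = l} > 0} = UNIV"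
begin

lemma zeta_meas: "\<zeta> i \<in> measurable P (count_space UNIV)"
  using indep by (auto simp: indep_vars_def)

lemma zeta_compose_meas[measurable]: "(\<lambda>\<omega>. h (\<zeta> i \<omega>)) \<in> measurable P (borel :: 'c::topological_space measure)"
  by (rule measurable_compose[OF zeta_meas]) simp

lemma zeta_determined: "determined {i} (\<lambda>\<omega>. h (\<zeta> i \<omega>))"
  by (rule determinedI[where F="\<lambda>x. h (x i)"]) simp

lemma expectation_ident:
  fixes h :: "int ^ 2 \<Rightarrow> 'c::{banach, second_countable_topology}"
  shows "expectation (\<lambda>\<omega>. h (\<zeta> i \<omega>)) = expectation (\<lambda>\<omega>. h (\<zeta> 0 \<omega>))"
proof -
  have *: "expectation (\<lambda>\<omega>. h (\<zeta> i \<omega>)) = (\<integral>l. h l \<partial>distr P (count_space UNIV) (\<zeta> i))" for i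
    by (subst integral_distr[OF zeta_meas]) auto
  show ?thesis unfolding *[of i] *[of 0] ident[of i] ..
qed

definition \<phi> :: "real \<times> real \<Rightarrow> complex" where
  "\<phi> w = expectation (\<lambda>\<omega>. iexp (dotp w (\<zeta> 0 \<omega>)))"

lemma integrable_iexp_dotp: "integrable P (\<lambda>\<omega>. iexp (dotp w (\<zeta> i \<omega>)))"
  by (rule integrable_const_bound[where B=1]) auto

lemma norm_phi_le: "norm (\<phi> w) \<le> 1"
proof -
  have "norm (\<phi> w) \<le> expectation (\<lambda>\<omega>. norm (iexp (dotp w (\<zeta> 0 \<omega>))))"
    unfolding \<phi>_def by (rule integral_norm_bound)
  then show ?thesis by (simp add: prob_space)
qed

lemma phi_power: "expectation (\<lambda>\<omega>. iexp (dotp w (inc a (a + k) \<omega>))) = \<phi> w ^ k"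
proof -
  have "expectation (\<lambda>\<omega>. iexp (dotp w (inc a (a + k) \<omega>))) = expectation (\<lambda>\<omega>. \<Prod>i\<in>{a..<a+k}. iexp (dotp w (\<zeta> i \<omega>)))"
    by (simp add: inc_def dotp_sum sum_distrib_left exp_sum)
  also have "\<dots> = (\<Prod>i\<in>{a..<a+k}. expectation (\<lambda>\<omega>. iexp (dotp w (\<zeta> i \<omega>))))"
  proof (rule indep_vars_lebesgue_integral)
    show "indep_vars (\<lambda>_. borel) (\<lambda>i \<omega>. iexp (dotp w (\<zeta> i \<omega>))) {a..<a+k}"
      by (rule indep_vars_compose2[OF indep_vars_subset[OF indep], where Y="\<lambda>i l. iexp (dotp w l)"]) auto
  qed (auto intro: integrable_iexp_dotp)
  also have "\<dots> = (\<Prod>i\<in>{a..<a+k}. \<phi> w)"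
    unfolding \<phi>_def by (intro prod.cong refl expectation_ident[where h="\<lambda>l. iexp (dotp w l)"])
  finally show ?thesis by simp
qed

lemma inc_component_meas: "(\<lambda>\<omega>. real_of_int (inc a b \<omega> $ j)) \<in> borel_measurable P"
  by (rule determined_borel_measurable[of "{a..<b}"], simp, rule determined_comp[where h="\<lambda>l. real_of_int (l $ j)"], rule determined_inc, simp)

lemma fst_torus_measurable: "fst \<in> borel_measurable torus_measure"
proof -
  have "fst \<in> measurable torus_measure circle_measure" by (rule measurable_fst)
  from measurable_compose[OF this measurable_id_circle] show ?thesis .
qed

lemma snd_torus_measurable: "snd \<in> borel_measurable torus_measure"
proof -
  have "snd \<in> measurable torus_measure circle_measure" by (rule measurable_snd)
  from measurable_compose[OF this measurable_id_circle] show ?thesis .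
qed

lemma fourier_measurable[measurable]:
  "(\<lambda>x. iexp (dotp (fst x) (inc a b (snd x) - l))) \<in> borel_measurable (torus_measure \<Otimes>\<^sub>M P)"
proof -
  have [measurable]: "(\<lambda>x. real_of_int (inc a b (snd x) $ j)) \<in> borel_measurable (torus_measure \<Otimes>\<^sub>M P)" for j
    by (rule measurable_compose[OF measurable_snd inc_component_meas])
  have [measurable]: "(\<lambda>x. fst (fst x)) \<in> borel_measurable (torus_measure \<Otimes>\<^sub>M P)" "(\<lambda>x. snd (fst x)) \<in> borel_measurable (torus_measure \<Otimes>\<^sub>M P)"
  proof -
    have 1: "fst \<in> measurable (torus_measure \<Otimes>\<^sub>M P) torus_measure" by (rule measurable_fst)
    have 2: "fst \<in> borel_measurable torus_measure" "snd \<in> borel_measurable torus_measure"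
      by (rule fst_torus_measurable snd_torus_measurable)+
    show "(\<lambda>x. fst (fst x)) \<in> borel_measurable (torus_measure \<Otimes>\<^sub>M P)" by (rule measurable_compose[OF 1 2(1)])
    show "(\<lambda>x. snd (fst x)) \<in> borel_measurable (torus_measure \<Otimes>\<^sub>M P)" by (rule measurable_compose[OF 1 2(2)])
  qed
  have eq: "dotp (fst x) (inc a b (snd x) - l) = fst (fst x) * (real_of_int (inc a b (snd x) $ 1) - real_of_int (l $ 1))
      + snd (fst x) * (real_of_int (inc a b (snd x) $ 2) - real_of_int (l $ 2))" for x :: "(real \<times> real) \<times> 'w"
    by (simp add: dotp_def)
  show ?thesis unfolding eq by measurable
qed

lemma dotp_measurable[measurable]: "(\<lambda>w. dotp w l) \<in> borel_measurable torus_measure"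
proof -
  note [measurable] = fst_torus_measurable snd_torus_measurable
  show ?thesis unfolding dotp_def by measurable
qed

lemma phi_power_measurable: "(\<lambda>w. \<phi> w ^ k) \<in> borel_measurable torus_measure"
proof -
  interpret T: finite_measure torus_measure by (rule finite_measure_torus)
  have "(\<lambda>(w, \<omega>). iexp (dotp w (inc 0 (0 + k) \<omega> - 0))) \<in> borel_measurable (torus_measure \<Otimes>\<^sub>M P)"
    using fourier_measurable[of 0 "0 + k" 0] unfolding case_prod_beta' .
  from borel_measurable_lebesgue_integral[OF this]
  have "(\<lambda>w. expectation (\<lambda>\<omega>. iexp (dotp w (inc 0 (0 + k) \<omega> - 0)))) \<in> borel_measurable torus_measure" .
  then show ?thesis unfolding diff_0_right phi_power .
qed

lemma phi_measurable[measurable]: "\<phi> \<in> borel_measurable torus_measure"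
  using phi_power_measurable[of 1] by simp

text \<open>Fubini, and the orthogonality of the characters on the torus.\<close>

lemma fourier_inversion:
  "complex_of_real (prob {\<omega>\<in>space P. inc a (a + k) \<omega> = l}) = (1 / (2 * pi)\<^sup>2) * (\<integral>w. \<phi> w ^ k * iexp (- dotp w l) \<partial>torus_measure)"
proof -
  interpret T: finite_measure torus_measure by (rule finite_measure_torus)
  interpret TP: pair_sigma_finite torus_measure P ..
  interpret TPf: finite_measure "torus_measure \<Otimes>\<^sub>M P" by (intro finite_measure_pair_measure finite_measure_torus finite_measure_axioms)
  let ?S = "inc a (a + k)"
  let ?E = "{\<omega>\<in>space P. ?S \<omega> = l}"
  have E: "?E \<in> events"
  proof -
    have "?S -` {l} \<inter> space P \<in> events"
      by (rule measurable_sets[OF determined_measurable[OF _ determined_inc[OF order_refl]]]) auto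
    then show ?thesis by (simp add: vimage_def Int_def conj_commute)
  qed
  have int: "integrable (torus_measure \<Otimes>\<^sub>M P) (\<lambda>(w, \<omega>). iexp (dotp w (?S \<omega> - l)))"
  proof (rule TPf.integrable_const_bound[where B=1])
    show "(\<lambda>(w, \<omega>). iexp (dotp w (?S \<omega> - l))) \<in> borel_measurable (torus_measure \<Otimes>\<^sub>M P)"
      using fourier_measurable[of a "a + k" l] unfolding case_prod_beta' .
  qed (simp add: case_prod_beta')
  have "(\<integral>w. \<phi> w ^ k * iexp (- dotp w l) \<partial>torus_measure)
      = (\<integral>w. expectation (\<lambda>\<omega>. iexp (dotp w (?S \<omega> - l))) \<partial>torus_measure)"
  proof (rule Bochner_Integration.integral_cong[OF refl])
    fix w
    have "expectation (\<lambda>\<omega>. iexp (dotp w (?S \<omega> - l))) = expectation (\<lambda>\<omega>. iexp (dotp w (?S \<omega>)) * iexp (- dotp w l))"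
      by (simp add: dotp_diff exp_add[symmetric] right_diff_distrib)
    then show "\<phi> w ^ k * iexp (- dotp w l) = expectation (\<lambda>\<omega>. iexp (dotp w (?S \<omega> - l)))"
      by (simp only: integral_mult_left_zero phi_power)
  qed
  also have "\<dots> = expectation (\<lambda>\<omega>. \<integral>w. iexp (dotp w (?S \<omega> - l)) \<partial>torus_measure)"
    by (rule TP.Fubini_integral[OF int, symmetric])
  also have "\<dots> = expectation (\<lambda>\<omega>. complex_of_real ((2 * pi)\<^sup>2 * indicator ?E \<omega>))"
    by (rule Bochner_Integration.integral_cong[OF refl]) (simp add: torus_integral_character indicator_def)
  also have "\<dots> = complex_of_real ((2 * pi)\<^sup>2 * prob ?E)"
    unfolding integral_complex_of_real integral_mult_right_zero using E by simp
  finally show ?thesis by simp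
qed

text \<open>The decay exponent of the continuous-time walk. Unlike 1 - |\<phi>|^2 it vanishes on the
  torus only at the origin, for periodic walks too; \<open>D_lower\<close> is the quantitative
  form.\<close>

definition D :: "real \<times> real \<Rightarrow> real" where "D w = 1 - Re (\<phi> w)"

lemma D_eq: "D w = 2 * expectation (\<lambda>\<omega>. (sin (dotp w (\<zeta> 0 \<omega>) / 2))\<^sup>2)"
proof -
  have "Re (\<phi> w) = expectation (\<lambda>\<omega>. cos (dotp w (\<zeta> 0 \<omega>)))"
    unfolding \<phi>_def by (subst integral_Re[OF integrable_iexp_dotp, symmetric]) (simp add: Re_exp)
  also have "\<dots> = expectation (\<lambda>\<omega>. 1 - 2 * (sin (dotp w (\<zeta> 0 \<omega>) / 2))\<^sup>2)"
    by (simp add: cos_double_sin[symmetric])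
  also have "\<dots> = 1 - 2 * expectation (\<lambda>\<omega>. (sin (dotp w (\<zeta> 0 \<omega>) / 2))\<^sup>2)"
    by (subst Bochner_Integration.integral_diff)
       (auto intro!: integrable_const_bound[where B=1] integrable_mult_right simp: prob_space abs_square_le_1 power_le_one)
  finally show ?thesis by (simp add: D_def)
qed

lemma D_nonneg: "0 \<le> D w"
  using complex_Re_le_cmod[of "\<phi> w"] norm_phi_le[of w] by (simp add: D_def)

lemma expectation_ge_atom:
  fixes h :: "'w \<Rightarrow> real"
  assumes "integrable P h" "\<And>\<omega>. 0 \<le> h \<omega>" "E \<in> events" "\<And>\<omega>. \<omega> \<in> E \<Longrightarrow> h \<omega> = c"
  shows "prob E * c \<le> expectation h"
proof -
  have "prob E * c = expectation (\<lambda>\<omega>. c * indicator E \<omega>)" using assms(3) by simp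
  also have "\<dots> \<le> expectation h"
  proof (rule integral_mono)
    show "integrable P (\<lambda>\<omega>. c * indicator E \<omega>)"
      using assms(3) by (intro integrable_mult_right integrable_real_indicator) (auto simp: less_top[symmetric])
    show "c * indicator E \<omega> \<le> h \<omega>" for \<omega>
      using assms(2)[of \<omega>] assms(4)[of \<omega>] by (cases "\<omega> \<in> E") auto
  qed (rule assms(1))
  finally show ?thesis .
qed

definition supp :: "(int ^ 2) set" where "supp = {l. prob {\<omega> \<in> space P. \<zeta> 0 \<omega> = l} > 0}"

lemma atom_event: "{\<omega> \<in> space P. \<zeta> i \<omega> = l} \<in> events"
  using measurable_sets[OF zeta_meas, of "{l}" i] by (simp add: vimage_def Int_def conj_commute)

lemma AE_supp: "AE \<omega> in P. \<zeta> 0 \<omega> \<in> supp"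
proof -
  have "AE \<omega> in P. \<forall>l. l \<notin> supp \<longrightarrow> \<zeta> 0 \<omega> \<noteq> l"
    unfolding AE_all_countable
  proof
    fix l
    show "AE \<omega> in P. l \<notin> supp \<longrightarrow> \<zeta> 0 \<omega> \<noteq> l"
    proof (cases "l \<in> supp")
      case False
      then have "prob {\<omega> \<in> space P. \<zeta> 0 \<omega> = l} = 0" by (simp add: supp_def zero_less_measure_iff)
      then show ?thesis using atom_event[of 0 l] by (subst (asm) prob_eq_0) auto
    qed simp
  qed
  then show ?thesis by eventually_elim blast
qed

text \<open>The vectors l for which the left hand side below is controlled by D form a subgroup.\<close>
lemma sin_dotp_le_D: "\<exists>K. \<forall>w. (sin (dotp w l / 2))\<^sup>2 \<le> K * D w"
proof -
  let ?H = "{l. \<exists>K. \<forall>w. (sin (dotp w l / 2))\<^sup>2 \<le> K * D w}"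
  have "gen_subgroup supp \<subseteq> ?H"
    unfolding gen_subgroup_def
  proof (rule Inter_lower, safe)
    fix l assume "l \<in> supp"
    then have p: "prob {\<omega> \<in> space P. \<zeta> 0 \<omega> = l} > 0" (is "?p > 0") by (simp add: supp_def)
    have "?p * (sin (dotp w l / 2))\<^sup>2 \<le> expectation (\<lambda>\<omega>. (sin (dotp w (\<zeta> 0 \<omega>) / 2))\<^sup>2)" for w
      by (rule expectation_ge_atom[OF _ _ atom_event])
         (auto intro!: integrable_const_bound[where B=1] simp: abs_square_le_1 power_le_one)
    then have "(sin (dotp w l / 2))\<^sup>2 \<le> (1 / (2 * ?p)) * D w" for w
      using p by (simp add: D_eq field_simps)
    then show "\<exists>K. \<forall>w. (sin (dotp w l / 2))\<^sup>2 \<le> K * D w" by blast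
  next
    show "\<exists>K. \<forall>w. (sin (dotp w 0 / 2))\<^sup>2 \<le> K * D w"
      by (intro exI[of _ 0]) (simp add: dotp_0)
  next
    fix l l' K K'
    assume K: "\<forall>w. (sin (dotp w l / 2))\<^sup>2 \<le> K * D w" "\<forall>w. (sin (dotp w l' / 2))\<^sup>2 \<le> K' * D w"
    have "(sin (dotp w (l - l') / 2))\<^sup>2 \<le> (2 * K + 2 * K') * D w" for w
      using sin_square_diff_le[of "dotp w l / 2" "dotp w l' / 2"] K[rule_format, of w]
      by (simp add: dotp_diff diff_divide_distrib distrib_right)
    then show "\<exists>K. \<forall>w. (sin (dotp w (l - l') / 2))\<^sup>2 \<le> K * D w" by blast
  qed
  then show ?thesis using aperiodic unfolding supp_def by auto
qed

text \<open>Both unit vectors have their sines controlled by D, and Jordan's inequality turns the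
  squared sines of the half angles into quadratic lower bounds on the whole square.\<close>

lemma D_lower: "\<exists>c>0. \<forall>w. \<bar>fst w\<bar> \<le> pi \<and> \<bar>snd w\<bar> \<le> pi \<longrightarrow> c * ((fst w)\<^sup>2 + (snd w)\<^sup>2) \<le> D w"
proof -
  have e: "dotp w (axis 1 1) = fst w" "dotp w (axis 2 1) = snd w" for w
    by (simp_all add: dotp_def axis_def)
  obtain K1 K2 where K: "\<And>w. (sin (fst w / 2))\<^sup>2 \<le> K1 * D w" "\<And>w. (sin (snd w / 2))\<^sup>2 \<le> K2 * D w"
    using sin_dotp_le_D[of "axis 1 1"] sin_dotp_le_D[of "axis 2 1"] unfolding e by blast
  define K where "K = \<bar>K1\<bar> + \<bar>K2\<bar> + 1"
  have jor: "(t / pi)\<^sup>2 \<le> (sin (t / 2))\<^sup>2" if "\<bar>t\<bar> \<le> pi" for t :: real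
    using jordan_sin[of "t / 2"] that by simp
  have main: "((fst w)\<^sup>2 + (snd w)\<^sup>2) / pi\<^sup>2 \<le> K * D w" if "\<bar>fst w\<bar> \<le> pi" "\<bar>snd w\<bar> \<le> pi" for w
  proof -
    have "((fst w)\<^sup>2 + (snd w)\<^sup>2) / pi\<^sup>2 \<le> K1 * D w + K2 * D w"
      using jor[OF that(1)] jor[OF that(2)] K[of w] by (simp add: power_divide add_divide_distrib)
    also have "\<dots> \<le> K * D w"
      unfolding distrib_right[symmetric] by (intro mult_right_mono D_nonneg) (simp add: K_def)
    finally show ?thesis .
  qed
  have K0: "K > 0" by (simp add: K_def add_nonneg_pos)
  show ?thesis
  proof (intro exI[of _ "1 / (K * pi\<^sup>2)"] conjI allI impI)
    show "0 < 1 / (K * pi\<^sup>2)" using K0 by simp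
    fix w assume w: "\<bar>fst w\<bar> \<le> pi \<and> \<bar>snd w\<bar> \<le> pi"
    have "1 / (K * pi\<^sup>2) * ((fst w)\<^sup>2 + (snd w)\<^sup>2) = ((fst w)\<^sup>2 + (snd w)\<^sup>2) / pi\<^sup>2 / K" by simp
    also have "\<dots> \<le> K * D w / K" using main[of w] w K0 by (intro divide_right_mono) auto
    finally show "1 / (K * pi\<^sup>2) * ((fst w)\<^sup>2 + (snd w)\<^sup>2) \<le> D w" using K0 by simp
  qed
qed

lemma int_component: "integrable P (\<lambda>\<omega>. (real_of_int (\<zeta> 0 \<omega> $ j))\<^sup>2)" "integrable P (\<lambda>\<omega>. real_of_int (\<zeta> 0 \<omega> $ j))"
    "expectation (\<lambda>\<omega>. real_of_int (\<zeta> 0 \<omega> $ j)) = 0"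
proof -
  show 1: "integrable P (\<lambda>\<omega>. (real_of_int (\<zeta> 0 \<omega> $ j))\<^sup>2)" using L2[of j] by (simp add: to_real2_def)
  show "integrable P (\<lambda>\<omega>. real_of_int (\<zeta> 0 \<omega> $ j))"
    by (rule square_integrable_imp_integrable[OF _ 1]) (rule zeta_compose_meas)
  show "expectation (\<lambda>\<omega>. real_of_int (\<zeta> 0 \<omega> $ j)) = 0" using mean[of j] by (simp add: to_real2_def)
qed

text \<open>Half the covariance form: the second-order term of 1 - \<phi> at the origin and the
  exponent of the limiting Gaussian.\<close>

definition q :: "real \<times> real \<Rightarrow> real" where
  "q w = expectation (\<lambda>\<omega>. (dotp w (\<zeta> 0 \<omega>))\<^sup>2) / 2"

lemma dotp_int: "integrable P (\<lambda>\<omega>. dotp w (\<zeta> 0 \<omega>))" "expectation (\<lambda>\<omega>. dotp w (\<zeta> 0 \<omega>)) = 0"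
  unfolding dotp_def by (simp_all add: int_component)

lemma cross_int: "integrable P (\<lambda>\<omega>. real_of_int (\<zeta> 0 \<omega> $ i) * real_of_int (\<zeta> 0 \<omega> $ j))"
  by (rule integrable_mult_of_squares[OF zeta_compose_meas zeta_compose_meas int_component(1) int_component(1)])

lemma dotp_square: "(dotp w l)\<^sup>2 = (fst w)\<^sup>2 * (of_int (l$1))\<^sup>2 + 2 * (fst w * snd w) * (of_int (l$1) * of_int (l$2)) + (snd w)\<^sup>2 * (of_int (l$2))\<^sup>2"
  by (simp add: dotp_def power2_sum power_mult_distrib)

lemma dotp_square_int: "integrable P (\<lambda>\<omega>. (dotp w (\<zeta> 0 \<omega>))\<^sup>2)"
  unfolding dotp_square by (intro Bochner_Integration.integrable_add integrable_mult_right int_component cross_int)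

lemma q_eq: "2 * q w = (fst w)\<^sup>2 * (cov_matrix P (\<zeta> 0) $ 1 $ 1) + 2 * (fst w * snd w) * (cov_matrix P (\<zeta> 0) $ 1 $ 2)
    + (snd w)\<^sup>2 * (cov_matrix P (\<zeta> 0) $ 2 $ 2)"
  unfolding q_def dotp_square
  by (simp add: Bochner_Integration.integral_add Bochner_Integration.integrable_add int_component cross_int cov_matrix_def to_real2_def power2_eq_square
      int_component(1)[unfolded power2_eq_square])

lemma D_le_q: "D w \<le> q w"
proof -
  have "D w \<le> 2 * expectation (\<lambda>\<omega>. (dotp w (\<zeta> 0 \<omega>))\<^sup>2 / 4)"
    unfolding D_eq
  proof (intro mult_left_mono integral_mono)
    show "(sin (dotp w (\<zeta> 0 \<omega>) / 2))\<^sup>2 \<le> (dotp w (\<zeta> 0 \<omega>))\<^sup>2 / 4" for \<omega>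
      using abs_le_square_iff[THEN iffD1, OF abs_sin_x_le_abs_x[of "dotp w (\<zeta> 0 \<omega>) / 2"]] by (simp add: power_divide)
    show "integrable P (\<lambda>\<omega>. (sin (dotp w (\<zeta> 0 \<omega>) / 2))\<^sup>2)"
      by (rule integrable_const_bound[where B=1]) (auto simp: abs_square_le_1)
    show "integrable P (\<lambda>\<omega>. (dotp w (\<zeta> 0 \<omega>))\<^sup>2 / 4)" by (intro integrable_divide dotp_square_int)
  qed simp
  then show ?thesis by (simp add: q_def)
qed

lemma q_scale: "q (c *\<^sub>R w) = c\<^sup>2 * q w"
proof -
  have "(dotp (c *\<^sub>R w) l)\<^sup>2 = c\<^sup>2 * (dotp w l)\<^sup>2" for l
    by (simp add: dotp_def power_mult_distrib[symmetric] algebra_simps)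
  then show ?thesis by (simp add: q_def)
qed

text \<open>Near the origin q dominates D, which is bounded below by a positive definite form;
  homogeneity of q carries positivity to the whole plane.\<close>

lemma q_pos: assumes "w \<noteq> 0" shows "q w > 0"
proof -
  obtain c where c: "c > 0" "\<And>w. \<bar>fst w\<bar> \<le> pi \<Longrightarrow> \<bar>snd w\<bar> \<le> pi \<Longrightarrow> c * ((fst w)\<^sup>2 + (snd w)\<^sup>2) \<le> D w"
    using D_lower by blast
  define t where "t = 1 / (\<bar>fst w\<bar> + \<bar>snd w\<bar> + 1)"
  have s: "\<bar>fst w\<bar> + \<bar>snd w\<bar> + 1 > 0" by linarith
  have t: "t > 0" using s by (simp add: t_def)
  have le: "\<bar>fst (t *\<^sub>R w)\<bar> \<le> 1" "\<bar>snd (t *\<^sub>R w)\<bar> \<le> 1"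
    using s by (auto simp: t_def abs_mult divide_le_eq)
  have "(1::real) \<le> pi" using pi_gt3 by linarith
  with le have b: "\<bar>fst (t *\<^sub>R w)\<bar> \<le> pi" "\<bar>snd (t *\<^sub>R w)\<bar> \<le> pi" by linarith+
  have "fst w \<noteq> 0 \<or> snd w \<noteq> 0" using assms by (auto simp: prod_eq_iff)
  then have "0 < (fst (t *\<^sub>R w))\<^sup>2 + (snd (t *\<^sub>R w))\<^sup>2"
    using t by (auto simp: sum_power2_gt_zero_iff)
  then have "0 < c * ((fst (t *\<^sub>R w))\<^sup>2 + (snd (t *\<^sub>R w))\<^sup>2)" using c by simp
  also have "\<dots> \<le> q (t *\<^sub>R w)" using c(2)[OF b] D_le_q[of "t *\<^sub>R w"] by linarith
  finally show ?thesis using t unfolding q_scale by (simp add: zero_less_mult_iff)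
qed

lemma zeta_diff_meas[measurable]:
  fixes h :: "int ^ 2 \<Rightarrow> 'c::topological_space"
  shows "(\<lambda>\<omega>. h (\<zeta> 0 \<omega> - \<zeta> 1 \<omega>)) \<in> borel_measurable P"
  by (rule determined_borel_measurable[of "{0,1}"], simp, rule determined_comp[where h=h],
      rule determinedI[where F="\<lambda>x. x 0 - x 1"], simp)

text \<open>Symmetrisation: |\<phi>|^2 is the characteristic function of the difference of two
  independent steps.\<close>

lemma phi_norm_square: "(norm (\<phi> w))\<^sup>2 = 1 - 2 * expectation (\<lambda>\<omega>. (sin (dotp w (\<zeta> 0 \<omega> - \<zeta> 1 \<omega>) / 2))\<^sup>2)"
proof -
  have ind: "indep_var borel (id \<circ> (\<lambda>\<omega>. iexp (dotp w (\<zeta> 0 \<omega>)))) borel (id \<circ> (\<lambda>\<omega>. iexp (- dotp w (\<zeta> 1 \<omega>))))"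
    by (rule indep_var_compose[OF determined_indep_var[of "{0}" "{1}"]])
       (auto intro: zeta_determined[where h="\<lambda>l. iexp (dotp w l)"] zeta_determined[where h="\<lambda>l. iexp (- dotp w l)"] simp del: of_real_minus)
  have i1: "integrable P (\<lambda>\<omega>. iexp (- dotp w (\<zeta> 1 \<omega>)))"
    by (rule integrable_const_bound[where B=1]) auto
  have cn: "iexp (- dotp w l) = cnj (iexp (dotp w l))" for l
    by (simp add: exp_cnj)
  have "expectation (\<lambda>\<omega>. iexp (- dotp w (\<zeta> 1 \<omega>))) = cnj (expectation (\<lambda>\<omega>. iexp (dotp w (\<zeta> 1 \<omega>))))"
    unfolding cn by (rule integral_bounded_linear[OF bounded_linear_cnj integrable_iexp_dotp])
  also have "expectation (\<lambda>\<omega>. iexp (dotp w (\<zeta> 1 \<omega>))) = \<phi> w"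
    unfolding \<phi>_def by (rule expectation_ident[where h="\<lambda>l. iexp (dotp w l)"])
  finally have e1: "expectation (\<lambda>\<omega>. iexp (- dotp w (\<zeta> 1 \<omega>))) = cnj (\<phi> w)" .
  have int: "integrable P (\<lambda>\<omega>. iexp (dotp w (\<zeta> 0 \<omega> - \<zeta> 1 \<omega>)))"
  proof (rule integrable_const_bound[where B=1])
    show "(\<lambda>\<omega>. iexp (dotp w (\<zeta> 0 \<omega> - \<zeta> 1 \<omega>))) \<in> borel_measurable P"
      by (rule zeta_diff_meas)
  qed auto
  have "\<phi> w * cnj (\<phi> w) = expectation (\<lambda>\<omega>. iexp (dotp w (\<zeta> 0 \<omega>)) * iexp (- dotp w (\<zeta> 1 \<omega>)))"
    unfolding e1[symmetric] using indep_var_lebesgue_integral[OF ind] integrable_iexp_dotp[of w 0] i1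
    by (simp add: \<phi>_def del: of_real_minus)
  also have "\<dots> = expectation (\<lambda>\<omega>. iexp (dotp w (\<zeta> 0 \<omega> - \<zeta> 1 \<omega>)))"
    by (simp add: dotp_diff exp_add[symmetric] right_diff_distrib)
  finally have "Re (\<phi> w * cnj (\<phi> w)) = expectation (\<lambda>\<omega>. Re (iexp (dotp w (\<zeta> 0 \<omega> - \<zeta> 1 \<omega>))))"
    by (simp only: integral_Re[OF int])
  also have "\<dots> = expectation (\<lambda>\<omega>. 1 - 2 * (sin (dotp w (\<zeta> 0 \<omega> - \<zeta> 1 \<omega>) / 2))\<^sup>2)"
    by (simp add: Re_exp cos_double_sin[symmetric])
  also have "\<dots> = 1 - 2 * expectation (\<lambda>\<omega>. (sin (dotp w (\<zeta> 0 \<omega> - \<zeta> 1 \<omega>) / 2))\<^sup>2)"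
  proof -
    have "integrable P (\<lambda>\<omega>. (sin (dotp w (\<zeta> 0 \<omega> - \<zeta> 1 \<omega>) / 2))\<^sup>2)"
      by (rule integrable_const_bound[where B=1, OF _ zeta_diff_meas]) (auto simp: abs_square_le_1)
    then show ?thesis by (simp add: prob_space)
  qed
  finally show ?thesis by (simp add: complex_mult_cnj cmod_power2)
qed

end

section \<open>The local bound for return probabilities\<close>

context lattice_walk begin

text \<open>On a support contained in a line, the inner product with a normal vector would be
  constant and equal to its mean 0, so that q would vanish at that vector.\<close>

lemma noncollinear_support:
  "\<exists>u\<in>supp. \<exists>v\<in>supp. \<exists>l\<in>supp. (u - l) $ 1 * (v - l) $ 2 - (u - l) $ 2 * (v - l) $ 1 \<noteq> 0"
proof (rule ccontr)
  assume "\<not> ?thesis"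
  then have col: "(u - l) $ 1 * (v - l) $ 2 = (u - l) $ 2 * (v - l) $ 1" if "u \<in> supp" "v \<in> supp" "l \<in> supp" for u v l
    using that by auto
  have "supp \<noteq> {}"
  proof
    assume "supp = {}"
    then have "AE \<omega> in P. False" using AE_supp by simp
    then show False by (simp add: AE_False)
  qed
  then obtain l where l: "l \<in> supp" by blast
  have "\<exists>w. w \<noteq> 0 \<and> (\<forall>v\<in>supp. dotp w v = dotp w l)"
  proof (cases "\<forall>u\<in>supp. u = l")
    case True
    then show ?thesis by (intro exI[of _ "(1, 0)"]) (auto simp: prod_eq_iff)
  next
    case False
    then obtain u where u: "u \<in> supp" "u \<noteq> l" by blast
    define p where "p = u - l"
    have p: "p \<noteq> 0" using u by (simp add: p_def)
    \<comment> \<open>Normal to p, hence to the difference of any support point and l.\<close>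
    define w where "w = (- real_of_int (p $ 2), real_of_int (p $ 1))"
    have "w \<noteq> 0" using p by (auto simp: w_def prod_eq_iff vec_eq_iff forall_2)
    moreover have "dotp w v = dotp w l" if "v \<in> supp" for v
    proof -
      have "real_of_int (p $ 1 * (v - l) $ 2) = real_of_int (p $ 2 * (v - l) $ 1)"
        using col[OF u(1) that l] unfolding p_def by simp
      then have "dotp w (v - l) = 0" by (simp add: dotp_def w_def)
      then show ?thesis by (simp add: dotp_diff)
    qed
    ultimately show ?thesis by blast
  qed
  then obtain w where w: "w \<noteq> 0" "\<And>v. v \<in> supp \<Longrightarrow> dotp w v = dotp w l" by blast
  have ae: "AE \<omega> in P. dotp w (\<zeta> 0 \<omega>) = dotp w l"
    using AE_supp by eventually_elim (rule w(2))
  have "expectation (\<lambda>\<omega>. dotp w (\<zeta> 0 \<omega>)) = expectation (\<lambda>\<omega>. dotp w l)"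
    by (rule integral_cong_AE) (use ae in auto)
  then have z: "dotp w l = 0" using dotp_int(2)[of w] by (simp add: prob_space)
  have "expectation (\<lambda>\<omega>. (dotp w (\<zeta> 0 \<omega>))\<^sup>2) = expectation (\<lambda>\<omega>. 0)"
    by (rule integral_cong_AE) (use ae z in auto)
  then have "q w = 0" by (simp add: q_def)
  then show False using q_pos[OF w(1)] by simp
qed

text \<open>A single atom of the pair of independent steps, weighted by its probability, bounds the
  expectation in \<open>phi_norm_square\<close> from below.\<close>

lemma sin_difference_le:
  assumes "u \<in> supp" "v \<in> supp"
  shows "\<exists>\<alpha>>0. \<forall>w. \<alpha> * (sin (dotp w (u - v) / 2))\<^sup>2 \<le> 1 - (norm (\<phi> w))\<^sup>2"
proof -
  let ?E = "{\<omega>\<in>space P. \<zeta> 0 \<omega> = u \<and> \<zeta> 1 \<omega> = v}"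
  have E: "?E \<in> events"
  proof -
    have "?E = {\<omega>\<in>space P. \<zeta> 0 \<omega> = u} \<inter> {\<omega>\<in>space P. \<zeta> 1 \<omega> = v}" by auto
    then show ?thesis using atom_event[of 0 u] atom_event[of 1 v] by simp
  qed
  have same: "prob {\<omega>\<in>space P. \<zeta> 1 \<omega> = v} = prob {\<omega>\<in>space P. \<zeta> 0 \<omega> = v}"
  proof -
    have *: "measure (distr P (count_space UNIV) (\<zeta> i)) {v} = prob {\<omega>\<in>space P. \<zeta> i \<omega> = v}" for i
      by (subst measure_distr[OF zeta_meas]) (auto simp: vimage_def Int_def conj_commute)
    show ?thesis unfolding *[symmetric] ident[of 1] ..
  qed
  have pE: "prob ?E > 0"
    using assms unfolding supp_def
    by (subst determined_prob_conj[of "{0}" "{1}"])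
       (auto intro: zeta_determined[where h="\<lambda>l. l = u"] zeta_determined[where h="\<lambda>l. l = v"] simp: same[unfolded One_nat_def])
  have "prob ?E * (sin (dotp w (u - v) / 2))\<^sup>2 \<le> expectation (\<lambda>\<omega>. (sin (dotp w (\<zeta> 0 \<omega> - \<zeta> 1 \<omega>) / 2))\<^sup>2)" for w
  proof (rule expectation_ge_atom[OF _ _ E])
    show "integrable P (\<lambda>\<omega>. (sin (dotp w (\<zeta> 0 \<omega> - \<zeta> 1 \<omega>) / 2))\<^sup>2)"
      by (rule integrable_const_bound[where B=1, OF _ zeta_diff_meas]) (auto simp: abs_square_le_1)
  qed auto
  then have "2 * prob ?E * (sin (dotp w (u - v) / 2))\<^sup>2 \<le> 1 - (norm (\<phi> w))\<^sup>2" for w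
    unfolding phi_norm_square using mult_left_mono[of _ _ 2] by (simp add: mult.assoc)
  then show ?thesis using pE by (intro exI[of _ "2 * prob ?E"]) auto
qed

text \<open>Two independent differences p, r of support points span a sublattice that contains d e1
  and d e2, with d their determinant, and the inequality for sines of differences carries the bound
  over to these vectors. For a periodic walk 1 - |\<phi>|^2 has zeros besides the origin, but only
  at common zeros of the two sines.\<close>

lemma phi_decay:
  "\<exists>\<beta>>0. \<exists>d::int. d \<noteq> 0 \<and> (\<forall>w. \<beta> * ((sin (of_int d * fst w / 2))\<^sup>2 + (sin (of_int d * snd w / 2))\<^sup>2) \<le> 1 - (norm (\<phi> w))\<^sup>2)"
proof -
  obtain u v l where uvl: "u \<in> supp" "v \<in> supp" "l \<in> supp"
    "(u - l) $ 1 * (v - l) $ 2 - (u - l) $ 2 * (v - l) $ 1 \<noteq> 0" using noncollinear_support by blast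
  define p r where p_def: "p = u - l" and r_def: "r = v - l"
  define d where "d = p $ 1 * r $ 2 - p $ 2 * r $ 1"
  obtain \<alpha> where \<alpha>: "\<alpha> > 0" "\<And>w. \<alpha> * (sin (dotp w p / 2))\<^sup>2 \<le> 1 - (norm (\<phi> w))\<^sup>2"
    using sin_difference_le[OF uvl(1,3)] unfolding p_def by blast
  obtain \<alpha>' where \<alpha>': "\<alpha>' > 0" "\<And>w. \<alpha>' * (sin (dotp w r / 2))\<^sup>2 \<le> 1 - (norm (\<phi> w))\<^sup>2"
    using sin_difference_le[OF uvl(2,3)] unfolding r_def by blast
  have comb: "(sin (of_int m * (dotp w p / 2) - of_int n * (dotp w r / 2)))\<^sup>2
      \<le> (2 * (of_int m)\<^sup>2 / \<alpha> + 2 * (of_int n)\<^sup>2 / \<alpha>') * (1 - (norm (\<phi> w))\<^sup>2)" for m n w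
  proof -
    let ?D = "1 - (norm (\<phi> w))\<^sup>2"
    have 1: "(sin (dotp w p / 2))\<^sup>2 \<le> ?D / \<alpha>" "(sin (dotp w r / 2))\<^sup>2 \<le> ?D / \<alpha>'"
      using \<alpha> \<alpha>' by (simp_all add: le_divide_eq mult.commute)
    have "(sin (of_int m * (dotp w p / 2) - of_int n * (dotp w r / 2)))\<^sup>2
        \<le> 2 * (sin (of_int m * (dotp w p / 2)))\<^sup>2 + 2 * (sin (of_int n * (dotp w r / 2)))\<^sup>2"
      by (rule sin_square_diff_le)
    also have "\<dots> \<le> 2 * ((of_int m)\<^sup>2 * (?D / \<alpha>)) + 2 * ((of_int n)\<^sup>2 * (?D / \<alpha>'))"
      by (intro add_mono mult_left_mono order_trans[OF sin_square_of_int_mult_le] 1) auto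
    finally show ?thesis by (simp add: algebra_simps add_divide_distrib diff_divide_distrib)
  qed
  \<comment> \<open>Cramer's rule: r_2 p - p_2 r = d e1.\<close>
  have i1: "of_int (r $ 2) * (dotp w p / 2) - of_int (p $ 2) * (dotp w r / 2) = of_int d * fst w / 2" for w
    by (simp add: dotp_def d_def field_simps)
  have i2: "of_int (p $ 1) * (dotp w r / 2) - of_int (r $ 1) * (dotp w p / 2) = of_int d * snd w / 2" for w
    by (simp add: dotp_def d_def field_simps)
  have i2': "(sin (of_int (r $ 1) * (dotp w p / 2) - of_int (p $ 1) * (dotp w r / 2)))\<^sup>2 = (sin (of_int d * snd w / 2))\<^sup>2" for w
  proof -
    have "of_int (r $ 1) * (dotp w p / 2) - of_int (p $ 1) * (dotp w r / 2) = - (of_int d * snd w / 2)"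
      using i2[of w] by linarith
    then show ?thesis by (simp only: sin_minus power2_minus)
  qed
  define B where "B = (2 * (of_int (r$2))\<^sup>2 / \<alpha> + 2 * (of_int (p$2))\<^sup>2 / \<alpha>') + (2 * (of_int (r$1))\<^sup>2 / \<alpha> + 2 * (of_int (p$1))\<^sup>2 / \<alpha>') + 1"
  have B: "B > 0" unfolding B_def using \<alpha>(1) \<alpha>'(1) by (intro add_nonneg_pos add_nonneg_nonneg) auto
  have D0: "0 \<le> 1 - (norm (\<phi> w))\<^sup>2" for w
    using norm_phi_le[of w] by (simp add: power_le_one)
  have "(sin (of_int d * fst w / 2))\<^sup>2 + (sin (of_int d * snd w / 2))\<^sup>2 \<le> B * (1 - (norm (\<phi> w))\<^sup>2)" for w
  proof -
    have "(sin (of_int d * fst w / 2))\<^sup>2 + (sin (of_int d * snd w / 2))\<^sup>2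
      \<le> (B - 1) * (1 - (norm (\<phi> w))\<^sup>2)"
      using add_mono[OF comb[of "r $ 2" w "p $ 2", unfolded i1] comb[of "r $ 1" w "p $ 1", unfolded i2']]
      by (simp add: B_def distrib_right)
    also have "\<dots> \<le> B * (1 - (norm (\<phi> w))\<^sup>2)" by (intro mult_right_mono D0) simp
    finally show ?thesis .
  qed
  then have "1 / B * ((sin (of_int d * fst w / 2))\<^sup>2 + (sin (of_int d * snd w / 2))\<^sup>2) \<le> 1 - (norm (\<phi> w))\<^sup>2" for w
    using B by (simp add: divide_le_eq mult.commute)
  moreover have "d \<noteq> 0" using uvl(4) by (simp add: d_def p_def r_def)
  ultimately show ?thesis using B by (intro exI[of _ "1 / B"] conjI exI[of _ d]) auto
qed

text \<open>By 1 - x <= exp (-x), |\<phi>|^k is below a product of one function of each coordinate,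
  both with circle integral of order k^(-1/2). Absolute values inside the inversion integral make
  the bound uniform in the site.\<close>

lemma local_bound_exists: "\<exists>K. \<forall>a k l. prob {\<omega>\<in>space P. inc a (a + k) \<omega> = l} \<le> K / (real k + 1)"
proof -
  interpret T: finite_measure torus_measure by (rule finite_measure_torus)
  obtain \<beta> d where \<beta>: "\<beta> > 0" and d: "d \<noteq> (0::int)"
    and dec: "\<And>w. \<beta> * ((sin (of_int d * fst w / 2))\<^sup>2 + (sin (of_int d * snd w / 2))\<^sup>2) \<le> 1 - (norm (\<phi> w))\<^sup>2"
    using phi_decay by blast
  define g where "g \<kappa> x = exp (- \<kappa> * (sin (of_int d * x / 2))\<^sup>2)" for \<kappa> x :: real
  have gm: "g \<kappa> \<in> borel_measurable borel" for \<kappa>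
    unfolding g_def by (intro borel_measurable_continuous_onI continuous_intros) auto
  define A where "A = (2 * \<bar>of_int d\<bar> + 1)\<^sup>2 * (2 * pi ^ 3 / (\<beta> * (of_int d)\<^sup>2)) / (2 * pi)\<^sup>2"
  have A0: "A \<ge> 0" unfolding A_def using \<beta> by simp
  have bound: "prob {\<omega>\<in>space P. inc a (a + k) \<omega> = l} \<le> A / real k" if k: "k > 0" for a k l
  proof -
    define \<kappa> where "\<kappa> = real k * \<beta> / 2"
    have \<kappa>: "\<kappa> > 0" using k \<beta> by (simp add: \<kappa>_def)
    have gb: "norm (g \<kappa> x) \<le> 1" "0 \<le> g \<kappa> x" for x using \<kappa> by (auto simp: g_def)
    have pt: "norm (\<phi> w) ^ k \<le> g \<kappa> (fst w) * g \<kappa> (snd w)" for w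
    proof -
      let ?z = "\<beta> * ((sin (of_int d * fst w / 2))\<^sup>2 + (sin (of_int d * snd w / 2))\<^sup>2)"
      have "(norm (\<phi> w))\<^sup>2 \<le> 1 + - ?z" using dec[of w] by simp
      also have "\<dots> \<le> exp (- ?z)" by (rule exp_ge_add_one_self)
      also have "\<dots> = (exp (- ?z / 2))\<^sup>2" by (simp add: power2_eq_square exp_add[symmetric])
      finally have "norm (\<phi> w) \<le> exp (- ?z / 2)" by (rule power2_le_imp_le) simp
      then have "norm (\<phi> w) ^ k \<le> exp (- ?z / 2) ^ k" by (intro power_mono) auto
      also have "\<dots> = exp (real k * (- ?z / 2))" by (rule exp_of_nat_mult[symmetric])
      also have "\<dots> = g \<kappa> (fst w) * g \<kappa> (snd w)"
        unfolding g_def exp_add[symmetric] \<kappa>_def by (intro arg_cong[where f=exp]) (simp add: field_simps)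
      finally show ?thesis .
    qed
    have gg: "integrable torus_measure (\<lambda>w. g \<kappa> (fst w) * g \<kappa> (snd w))"
    proof (rule T.integrable_const_bound[where B=1])
      have "g \<kappa> (fst w) * g \<kappa> (snd w) \<le> 1" for w :: "real \<times> real"
        using mult_mono[of "g \<kappa> (fst w)" 1 "g \<kappa> (snd w)" 1] gb by auto
      then show "AE w in torus_measure. norm (g \<kappa> (fst w) * g \<kappa> (snd w)) \<le> 1" using gb by simp
      show "(\<lambda>w. g \<kappa> (fst w) * g \<kappa> (snd w)) \<in> borel_measurable torus_measure"
        by (intro borel_measurable_times measurable_compose[OF fst_torus_measurable gm] measurable_compose[OF snd_torus_measurable gm])
    qed
    have "prob {\<omega>\<in>space P. inc a (a + k) \<omega> = l} = norm (complex_of_real (prob {\<omega>\<in>space P. inc a (a + k) \<omega> = l}))" by simp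
    also have "\<dots> = (1 / (2 * pi)\<^sup>2) * norm (\<integral>w. \<phi> w ^ k * iexp (- dotp w l) \<partial>torus_measure)"
      unfolding fourier_inversion by (simp add: norm_mult norm_divide norm_power)
    also have "\<dots> \<le> (1 / (2 * pi)\<^sup>2) * (\<integral>w. g \<kappa> (fst w) * g \<kappa> (snd w) \<partial>torus_measure)"
    proof (rule mult_left_mono)
      show "norm (\<integral>w. \<phi> w ^ k * iexp (- dotp w l) \<partial>torus_measure) \<le> (\<integral>w. g \<kappa> (fst w) * g \<kappa> (snd w) \<partial>torus_measure)"
      proof (rule Bochner_Integration.integral_norm_bound_integral[OF _ gg])
        show "norm (\<phi> w ^ k * iexp (- dotp w l)) \<le> g \<kappa> (fst w) * g \<kappa> (snd w)" for w
          using pt[of w] by (simp add: norm_mult norm_power del: of_real_minus)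
        show "integrable torus_measure (\<lambda>w. \<phi> w ^ k * iexp (- dotp w l))"
        proof (rule T.integrable_const_bound[where B=1])
          show "AE w in torus_measure. norm (\<phi> w ^ k * iexp (- dotp w l)) \<le> 1"
            by (simp add: norm_mult norm_power power_le_one norm_phi_le del: of_real_minus)
          have "(\<lambda>w. iexp (- dotp w l)) \<in> borel_measurable torus_measure" by measurable
          then show "(\<lambda>w. \<phi> w ^ k * iexp (- dotp w l)) \<in> borel_measurable torus_measure"
            by (intro borel_measurable_times phi_power_measurable)
        qed
      qed
    qed simp
    also have "(\<integral>w. g \<kappa> (fst w) * g \<kappa> (snd w) \<partial>torus_measure) = (\<integral>x. g \<kappa> x \<partial>circle_measure) * (\<integral>x. g \<kappa> x \<partial>circle_measure)"
      by (rule torus_integral_product[where B=1]) (use gm gb in auto)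
    also have "\<dots> \<le> ((2 * \<bar>of_int d\<bar> + 1) * sqrt (pi / (\<kappa> * (of_int d / pi)\<^sup>2))) * ((2 * \<bar>of_int d\<bar> + 1) * sqrt (pi / (\<kappa> * (of_int d / pi)\<^sup>2)))"
      using circle_integral_exp_sin_le[OF d \<kappa>, folded g_def] \<kappa>
      by (intro mult_mono) (auto intro!: integral_nonneg_AE AE_I2 gb)
    also have "\<dots> = (2 * \<bar>of_int d\<bar> + 1)\<^sup>2 * (sqrt (pi / (\<kappa> * (of_int d / pi)\<^sup>2)))\<^sup>2"
      by (simp add: power2_eq_square mult_ac)
    also have "(sqrt (pi / (\<kappa> * (of_int d / pi)\<^sup>2)))\<^sup>2 = pi / (\<kappa> * (of_int d / pi)\<^sup>2)"
      using \<kappa> by (intro real_sqrt_pow2) auto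
    also have "\<dots> = 2 * pi ^ 3 / (\<beta> * (of_int d)\<^sup>2) / real k"
      unfolding \<kappa>_def by (simp add: power_divide power2_eq_square power3_eq_cube mult_ac)
    also have "1 / (2 * pi)\<^sup>2 * ((2 * \<bar>of_int d\<bar> + 1)\<^sup>2 * (2 * pi ^ 3 / (\<beta> * (of_int d)\<^sup>2) / real k)) = A / real k"
      by (simp add: A_def)
    \<comment> \<open>The calculation leaves monotonicity of the scaling by 1 / (2 pi)^2 as a
      premise, which is discharged next.\<close>
    finally have mono: "(\<And>x y :: real. x \<le> y \<Longrightarrow> 1 / (2 * pi)\<^sup>2 * x \<le> 1 / (2 * pi)\<^sup>2 * y)
        \<Longrightarrow> prob {\<omega>\<in>space P. inc a (a + k) \<omega> = l} \<le> A / real k" .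
    show ?thesis by (rule mono, rule mult_left_mono) auto
  qed
  show ?thesis
  \<comment> \<open>2 A serves k >= 1, where k + 1 <= 2 k, and the added 1 serves k = 0.\<close>
  proof (intro exI[of _ "2 * A + 1"] allI)
    fix a k l
    show "prob {\<omega>\<in>space P. inc a (a + k) \<omega> = l} \<le> (2 * A + 1) / (real k + 1)"
    proof (cases "k = 0")
      case True
      have "prob {\<omega>\<in>space P. inc a (a + k) \<omega> = l} \<le> 1" by simp
      also have "1 \<le> (2 * A + 1) / (real k + 1)" using True A0 by simp
      finally show ?thesis .
    next
      case False
      then have k: "real k \<ge> 1" by simp
      have "A / real k \<le> (2 * A + 1) / (real k + 1)"
      proof -
        have "A * (real k + 1) \<le> (2 * A + 1) * real k"
          using mult_left_mono[OF k A0] k by (simp add: algebra_simps)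
        then show ?thesis using k by (simp add: pos_le_divide_eq pos_divide_le_eq)
      qed
      then show ?thesis using bound[of k a l] False by simp
    qed
  qed
qed

end

section \<open>Asymptotics of the Green function\<close>

lemma torus_integral_lborel:
  fixes f :: "real \<times> real \<Rightarrow> complex"
  assumes f: "f \<in> borel_measurable (lborel \<Otimes>\<^sub>M lborel)" and b: "\<And>w. norm (f w) \<le> B"
  shows "(\<integral>w. f w \<partial>torus_measure)
    = (\<integral>x. (\<integral>y. (indicator {-pi..pi} x * indicator {-pi..pi} y) *\<^sub>R f (x, y) \<partial>lborel) \<partial>lborel)"
proof -
  interpret T: finite_measure torus_measure by (rule finite_measure_torus)
  interpret U: finite_measure circle_measure by (rule finite_measure_circle)
  interpret pair_sigma_finite circle_measure circle_measure ..
  have sub: "(\<lambda>x. x) \<in> measurable circle_measure lborel" by (simp add: measurable_restrict_space1)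
  have "(\<lambda>w. (fst w, snd w)) \<in> measurable torus_measure (lborel \<Otimes>\<^sub>M lborel)"
    by (rule measurable_Pair) (auto intro: measurable_compose[OF measurable_fst sub] measurable_compose[OF measurable_snd sub])
  then have fm: "f \<in> borel_measurable torus_measure"
    using measurable_compose[OF _ f] by simp
  have "integrable torus_measure f"
    by (rule T.integrable_const_bound[where B=B]) (use b fm in auto)
  then have "(\<integral>w. f w \<partial>torus_measure) = (\<integral>x. (\<integral>y. f (x, y) \<partial>circle_measure) \<partial>circle_measure)"
    using integral_fst[of "\<lambda>x y. f (x, y)"] by simp
  also have "\<dots> = (\<integral>x. indicator {-pi..pi} x *\<^sub>R (\<integral>y. indicator {-pi..pi} y *\<^sub>R f (x, y) \<partial>lborel) \<partial>lborel)"
    by (simp add: integral_restrict_space)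
  also have "\<dots> = (\<integral>x. (\<integral>y. (indicator {-pi..pi} x * indicator {-pi..pi} y) *\<^sub>R f (x, y) \<partial>lborel) \<partial>lborel)"
    by (simp only: integral_scaleR_right[symmetric] scaleR_scaleR)
  finally show ?thesis .
qed

lemma lborel_double_scale:
  fixes f :: "real \<Rightarrow> real \<Rightarrow> complex"
  assumes c: "c > 0"
  shows "(\<integral>x. (\<integral>y. f x y \<partial>lborel) \<partial>lborel) = (c * c) *\<^sub>R (\<integral>x. (\<integral>y. f (c * x) (c * y) \<partial>lborel) \<partial>lborel)"
proof -
  have "(\<integral>x. (\<integral>y. f x y \<partial>lborel) \<partial>lborel) = \<bar>c\<bar> *\<^sub>R (\<integral>x. (\<integral>y. f (0 + c * x) y \<partial>lborel) \<partial>lborel)"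
    using c by (intro lborel_integral_real_affine) auto
  also have "\<dots> = \<bar>c\<bar> *\<^sub>R (\<integral>x. \<bar>c\<bar> *\<^sub>R (\<integral>y. f (0 + c * x) (0 + c * y) \<partial>lborel) \<partial>lborel)"
    using c by (subst (2) lborel_integral_real_affine[where c=c and t=0]) auto
  finally show ?thesis using c by simp
qed

lemma gaussian_integral_2:
  fixes a b c :: real
  assumes a: "a > 0" and det: "a * c - b\<^sup>2 > 0"
  shows "(\<integral>x. (\<integral>y. exp (- (c * x\<^sup>2 + 2 * b * (x * y) + a * y\<^sup>2) / 2) \<partial>lborel) \<partial>lborel) = 2 * pi / sqrt (a * c - b\<^sup>2)"
proof -
  \<comment> \<open>What remains as the coefficient of -x^2 after completing the square in
    y.\<close>
  define e where "e = (a * c - b\<^sup>2) / (2 * a)"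
  have e: "e > 0" using a det by (simp add: e_def)
  have sq: "- (c * x\<^sup>2 + 2 * b * (x * y) + a * y\<^sup>2) / 2 = - e * (x - 0)\<^sup>2 + - (a / 2) * (y - (- b * x / a))\<^sup>2" for x y
    using a by (simp add: e_def field_simps power2_eq_square)
  have "(\<integral>x. (\<integral>y. exp (- (c * x\<^sup>2 + 2 * b * (x * y) + a * y\<^sup>2) / 2) \<partial>lborel) \<partial>lborel)
    = (\<integral>x. exp (- e * (x - 0)\<^sup>2) * sqrt (pi / (a / 2)) \<partial>lborel)"
    unfolding sq exp_add integral_mult_right_zero
    using a by (subst gaussian_integral(2)) auto
  also have "\<dots> = sqrt (pi / e) * sqrt (pi / (a / 2))"
    unfolding integral_mult_left_zero gaussian_integral(2)[OF e] ..
  also have "\<dots> = sqrt (pi / e * (pi / (a / 2)))" by (rule real_sqrt_mult[symmetric])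
  also have "pi / e * (pi / (a / 2)) = (2 * pi)\<^sup>2 / (a * c - b\<^sup>2)"
    using a by (simp add: e_def power2_eq_square)
  finally show ?thesis unfolding real_sqrt_divide real_sqrt_abs by simp
qed

context lattice_walk begin

definition F :: "real \<times> real \<Rightarrow> complex" where "F w = 1 - \<phi> w"

lemma Re_F: "Re (F w) = D w" by (simp add: F_def D_def)

lemma phi_lborel_measurable: "\<phi> \<in> borel_measurable (lborel \<Otimes>\<^sub>M lborel)"
proof -
  have [measurable]: "(\<lambda>x. real_of_int (\<zeta> 0 (snd x) $ j)) \<in> borel_measurable ((lborel \<Otimes>\<^sub>M lborel) \<Otimes>\<^sub>M P)" for j
    by (rule measurable_compose[OF measurable_snd zeta_compose_meas])
  have 1: "fst \<in> measurable (((lborel :: real measure) \<Otimes>\<^sub>M (lborel :: real measure)) \<Otimes>\<^sub>M P) (lborel \<Otimes>\<^sub>M lborel)" by (rule measurable_fst)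
  have 2: "fst \<in> borel_measurable ((lborel :: real measure) \<Otimes>\<^sub>M (lborel :: real measure))" "snd \<in> borel_measurable ((lborel :: real measure) \<Otimes>\<^sub>M (lborel :: real measure))"
    by measurable
  have [measurable]: "(\<lambda>x. fst (fst x)) \<in> borel_measurable (((lborel :: real measure) \<Otimes>\<^sub>M (lborel :: real measure)) \<Otimes>\<^sub>M P)"
      "(\<lambda>x. snd (fst x)) \<in> borel_measurable (((lborel :: real measure) \<Otimes>\<^sub>M (lborel :: real measure)) \<Otimes>\<^sub>M P)"
    by (rule measurable_compose[OF 1 2(1)], rule measurable_compose[OF 1 2(2)])
  have "(\<lambda>(w, \<omega>). iexp (dotp w (\<zeta> 0 \<omega>))) \<in> borel_measurable ((lborel \<Otimes>\<^sub>M lborel) \<Otimes>\<^sub>M P)"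
    unfolding case_prod_beta' dotp_def by measurable
  from borel_measurable_lebesgue_integral[OF this] show ?thesis unfolding \<phi>_def[abs_def] .
qed

lemma norm_exp_F_le: "norm (exp (- real k * F w)) \<le> 1"
  using D_nonneg[of w] by (simp add: norm_exp_eq_Re Re_F)

text \<open>The central limit scaling of 1 - \<phi>. The remainder is a truncated third moment, so
  second moments of the step suffice.\<close>

lemma F_scaled_tendsto: "(\<lambda>k. real k * F (inverse (sqrt (real k)) *\<^sub>R w)) \<longlonglongrightarrow> q w"
proof -
  let ?X = "\<lambda>\<omega>. dotp w (\<zeta> 0 \<omega>)"
  let ?t = "\<lambda>k. inverse (sqrt (real k))"
  let ?h = "\<lambda>k. expectation (\<lambda>\<omega>. min (6 * (?X \<omega>)\<^sup>2) (\<bar>?t k\<bar> * \<bar>?X \<omega>\<bar> ^ 3))"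
  have Xm[measurable]: "?X \<in> borel_measurable P" by (rule zeta_compose_meas[where h="dotp w"])
  have var: "variance ?X = 2 * q w" using dotp_int(2)[of w] by (simp add: q_def)
  have ch: "\<phi> (c *\<^sub>R w) = char (distr P borel ?X) c" for c
  proof -
    have "dotp (c *\<^sub>R w) l = c * dotp w l" for l by (simp add: dotp_def algebra_simps)
    then show ?thesis unfolding char_def \<phi>_def by (subst integral_distr) auto
  qed
  have approx: "norm (real k * F (?t k *\<^sub>R w) - q w) \<le> ?h k / 6" if "k > 0" for k
  proof -
    have t2: "(?t k)\<^sup>2 = 1 / real k" by (simp add: power_divide inverse_eq_divide)
    have "norm (\<phi> (?t k *\<^sub>R w) - (1 - (?t k)\<^sup>2 * (2 * q w) / 2)) \<le> (?t k)\<^sup>2 / 6 * ?h k"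
      unfolding ch by (rule char_approx3'[OF Xm dotp_int(1) dotp_square_int dotp_int(2) var refl])
    then have *: "norm (\<phi> (?t k *\<^sub>R w) - (1 - 1 / real k * q w)) \<le> 1 / real k / 6 * ?h k"
      unfolding t2 by simp
    have "real k * F (?t k *\<^sub>R w) - q w = - (real k * (\<phi> (?t k *\<^sub>R w) - (1 - 1 / real k * q w)))"
      using that by (simp add: F_def field_simps)
    then have "norm (real k * F (?t k *\<^sub>R w) - q w) = real k * norm (\<phi> (?t k *\<^sub>R w) - (1 - 1 / real k * q w))"
      by (simp add: norm_mult)
    also have "\<dots> \<le> real k * (1 / real k / 6 * ?h k)" by (intro mult_left_mono *) simp
    finally show ?thesis using that by simp
  qed
  have t0: "?t \<longlonglongrightarrow> 0"
    by (rule tendsto_inverse_0_at_top, rule filterlim_compose[OF sqrt_at_top filterlim_real_sequentially])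
  have "(\<lambda>k. min (6 * (?X \<omega>)\<^sup>2) (\<bar>?t k\<bar> * \<bar>?X \<omega>\<bar> ^ 3)) \<longlonglongrightarrow> min (6 * (?X \<omega>)\<^sup>2) (\<bar>0\<bar> * \<bar>?X \<omega>\<bar> ^ 3)" for \<omega>
    by (intro tendsto_intros t0)
  then have "?h \<longlonglongrightarrow> expectation (\<lambda>\<omega>. 0)"
    by (intro integral_dominated_convergence[where w="\<lambda>\<omega>. 6 * (?X \<omega>)\<^sup>2"])
       (use dotp_square_int in \<open>auto intro!: AE_I2 simp: min_absorb2\<close>)
  then have "(\<lambda>k. ?h k / 6) \<longlonglongrightarrow> 0" by (simp add: tendsto_divide_zero)
  then have "(\<lambda>k. real k * F (?t k *\<^sub>R w) - q w) \<longlonglongrightarrow> 0"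
    by (rule Lim_null_comparison[rotated]) (use eventually_gt_at_top[of 0] in eventually_elim, use approx in simp)
  from tendsto_add[OF this tendsto_const[of "complex_of_real (q w)"]] show ?thesis by simp
qed

definition covdet :: real where
  "covdet = (cov_matrix P (\<zeta> 0) $ 2 $ 2) * (cov_matrix P (\<zeta> 0) $ 1 $ 1) - (cov_matrix P (\<zeta> 0) $ 1 $ 2)\<^sup>2"

lemma covdet_pos: "cov_matrix P (\<zeta> 0) $ 2 $ 2 > 0" "covdet > 0"
proof -
  let ?a = "cov_matrix P (\<zeta> 0) $ 2 $ 2" and ?b = "cov_matrix P (\<zeta> 0) $ 1 $ 2" and ?c = "cov_matrix P (\<zeta> 0) $ 1 $ 1"
  show a: "?a > 0" using q_eq[of "(0, 1)"] q_pos[of "(0, 1)"] by (simp add: prod_eq_iff)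
  \<comment> \<open>At this vector twice the form equals ?a * covdet, so its positivity passes to
    the determinant.\<close>
  have "0 < 2 * q (?a, - ?b)" using q_pos[of "(?a, - ?b)"] a by (simp add: prod_eq_iff)
  also have "\<dots> = ?a * covdet" unfolding q_eq covdet_def by (simp add: power2_eq_square algebra_simps)
  finally show "covdet > 0" using a by (simp add: zero_less_mult_iff)
qed

lemma exp_q_integral: "(\<integral>x. (\<integral>y. exp (- q (x, y)) \<partial>lborel) \<partial>lborel) = 2 * pi / sqrt covdet"
proof -
  have *: "- q (x, y) = - (cov_matrix P (\<zeta> 0) $ 1 $ 1 * x\<^sup>2 + 2 * (cov_matrix P (\<zeta> 0) $ 1 $ 2) * (x * y) + cov_matrix P (\<zeta> 0) $ 2 $ 2 * y\<^sup>2) / 2" for x y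
    using q_eq[of "(x, y)"] by (simp add: algebra_simps)
  show ?thesis unfolding * covdet_def
    by (rule gaussian_integral_2[OF covdet_pos(1) covdet_pos(2)[unfolded covdet_def]])
qed

text \<open>The return probability at time k of the continuous-time walk with jump rate 1.\<close>
definition Q :: "nat \<Rightarrow> real" where
  "Q k = (1 / (2 * pi)\<^sup>2) * Re (\<integral>w. exp (- real k * F w) \<partial>torus_measure)"

text \<open>Rescaling both variables by 1 / sqrt k turns the integrand into exp (-q) in the limit.
  Since Re F = D has a quadratic lower bound on the entire square, one Gaussian dominates everywhere
  and no other point of the torus contributes, as it would for \<phi>^k and a periodic walk.\<close>

lemma Q_asymp: "(\<lambda>k. real k * Q k) \<longlonglongrightarrow> 1 / (2 * pi * sqrt covdet)"
proof -
  obtain c where c: "c > 0" "\<And>w. \<bar>fst w\<bar> \<le> pi \<Longrightarrow> \<bar>snd w\<bar> \<le> pi \<Longrightarrow> c * ((fst w)\<^sup>2 + (snd w)\<^sup>2) \<le> D w"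
    using D_lower by blast
  let ?t = "\<lambda>k. inverse (sqrt (real k))"
  let ?I = "\<lambda>x. indicator {-pi..pi} x :: real"
  define G where "G k x y = (?I (?t k * x) * ?I (?t k * y)) *\<^sub>R exp (- real k * F (?t k * x, ?t k * y))" for k x y
  define H where "H x y = exp (- c * (x - 0)\<^sup>2) * exp (- c * (y - 0)\<^sup>2)" for x y :: real
  note [measurable] = phi_lborel_measurable
  have Fm: "(\<lambda>w. exp (- real k * F w)) \<in> borel_measurable (lborel \<Otimes>\<^sub>M lborel)" for k
    unfolding F_def by measurable
  have Gm[measurable]: "(\<lambda>w. G k (fst w) (snd w)) \<in> borel_measurable (lborel \<Otimes>\<^sub>M lborel)" for k
  proof -
    have "(\<lambda>w. (?t k * fst w, ?t k * snd w)) \<in> measurable (lborel \<Otimes>\<^sub>M lborel) (lborel \<Otimes>\<^sub>M lborel)"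
      by measurable
    from measurable_compose[OF this Fm[of k]] show ?thesis unfolding G_def by measurable
  qed
  have Hm[measurable]: "(\<lambda>w. H (fst w) (snd w)) \<in> borel_measurable (lborel \<Otimes>\<^sub>M lborel)"
    unfolding H_def by measurable
  have scale: "real k * (\<integral>w. exp (- real k * F w) \<partial>torus_measure) = (\<integral>x. (\<integral>y. G k x y \<partial>lborel) \<partial>lborel)" if "k > 0" for k
  proof -
    have tt: "?t k > 0" "?t k * ?t k = 1 / real k" using that by (auto simp: inverse_eq_divide)
    have "(\<integral>w. exp (- real k * F w) \<partial>torus_measure) = (\<integral>x. (\<integral>y. (?I x * ?I y) *\<^sub>R exp (- real k * F (x, y)) \<partial>lborel) \<partial>lborel)"
      by (rule torus_integral_lborel[OF Fm norm_exp_F_le])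
    also have "\<dots> = (?t k * ?t k) *\<^sub>R (\<integral>x. (\<integral>y. G k x y \<partial>lborel) \<partial>lborel)"
      unfolding G_def by (rule lborel_double_scale[OF tt(1)])
    finally show ?thesis using that unfolding tt(2) by (simp add: scaleR_conv_of_real)
  qed
  have GH: "norm (G k x y) \<le> H x y" if "k > 0" for k x y
  proof (cases "\<bar>?t k * x\<bar> \<le> pi \<and> \<bar>?t k * y\<bar> \<le> pi")
    case True
    have t2: "(?t k)\<^sup>2 = 1 / real k" by (simp add: power_divide inverse_eq_divide)
    have "c * ((?t k * x)\<^sup>2 + (?t k * y)\<^sup>2) \<le> D (?t k * x, ?t k * y)"
      using c(2)[of "(?t k * x, ?t k * y)"] True by simp
    then have "real k * (c * ((?t k * x)\<^sup>2 + (?t k * y)\<^sup>2)) \<le> real k * D (?t k * x, ?t k * y)"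
      by (intro mult_left_mono) auto
    also have "real k * (c * ((?t k * x)\<^sup>2 + (?t k * y)\<^sup>2)) = c * x\<^sup>2 + c * y\<^sup>2"
      using that unfolding power_mult_distrib t2 by (simp add: field_simps)
    finally have "c * x\<^sup>2 + c * y\<^sup>2 \<le> real k * D (?t k * x, ?t k * y)" .
    then have "exp (- (real k * D (?t k * x, ?t k * y))) \<le> H x y"
      unfolding H_def exp_add[symmetric] by simp
    moreover have "norm (G k x y) \<le> exp (- (real k * D (?t k * x, ?t k * y)))"
      unfolding G_def by (auto simp: norm_exp_eq_Re Re_F indicator_def)
    ultimately show ?thesis by linarith
  next
    case False
    then have "G k x y = 0" unfolding G_def by (auto simp: indicator_def abs_le_iff)
    then show ?thesis by (simp add: H_def)
  qed
  have Hint: "integrable (lborel \<Otimes>\<^sub>M lborel) (\<lambda>w. H (fst w) (snd w))"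
  proof (rule lborel_pair.Fubini_integrable)
    have "(\<integral>y. norm (H (fst (x, y)) (snd (x, y))) \<partial>lborel) = exp (- c * (x - 0)\<^sup>2) * sqrt (pi / c)" for x
      using gaussian_integral(2)[OF c(1), of 0] by (simp add: H_def)
    then show "integrable lborel (\<lambda>x. \<integral>y. norm (H (fst (x, y)) (snd (x, y))) \<partial>lborel)"
      using gaussian_integral(1)[OF c(1), of 0] by simp
    show "AE x in lborel. integrable lborel (\<lambda>y. H (fst (x, y)) (snd (x, y)))"
      using gaussian_integral(1)[OF c(1), of 0] by (simp add: H_def)
  qed (rule Hm)
  have Gint: "integrable (lborel \<Otimes>\<^sub>M lborel) (\<lambda>w. G k (fst w) (snd w))" if "k > 0" for k
    by (rule Bochner_Integration.integrable_bound[OF Hint Gm]) (use GH[OF that] in \<open>auto intro!: AE_I2 order_trans[OF GH[OF that] abs_ge_self]\<close>)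
  have lim: "(\<lambda>k. G k x y) \<longlonglongrightarrow> complex_of_real (exp (- q (x, y)))" for x y
  proof -
    have t0: "?t \<longlonglongrightarrow> 0"
      by (rule tendsto_inverse_0_at_top, rule filterlim_compose[OF sqrt_at_top filterlim_real_sequentially])
    have ind: "eventually (\<lambda>k. ?I (?t k * x) = 1) sequentially" for x :: real
    proof -
      have "(\<lambda>k. ?t k * x) \<longlonglongrightarrow> 0 * x" by (intro tendsto_intros t0)
      then have "eventually (\<lambda>k. dist (?t k * x) 0 < pi) sequentially" by (intro tendstoD) auto
      then show ?thesis by eventually_elim (auto simp: indicator_def dist_real_def)
    qed
    have "(\<lambda>k. exp (- (real k * F (?t k *\<^sub>R (x, y))))) \<longlonglongrightarrow> exp (- complex_of_real (q (x, y)))"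
      by (intro tendsto_intros F_scaled_tendsto)
    then have "(\<lambda>k. exp (- (real k * F (?t k *\<^sub>R (x, y))))) \<longlonglongrightarrow> complex_of_real (exp (- q (x, y)))"
      by (simp only: exp_of_real[symmetric] of_real_minus)
    then show ?thesis
      by (rule Lim_transform_eventually)
         (use ind[of x] ind[of y] in eventually_elim, simp add: G_def)
  qed
  \<comment> \<open>Shifted to \<open>Suc k\<close>, since the Gaussian bound is available for
    positive k only.\<close>
  have "(\<lambda>k. \<integral>w. G (Suc k) (fst w) (snd w) \<partial>(lborel \<Otimes>\<^sub>M lborel)) \<longlonglongrightarrow> (\<integral>w. complex_of_real (exp (- q (fst w, snd w))) \<partial>(lborel \<Otimes>\<^sub>M lborel))"
  proof (rule integral_dominated_convergence[OF _ _ Hint])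
    show "AE w in lborel \<Otimes>\<^sub>M lborel. (\<lambda>k. G (Suc k) (fst w) (snd w)) \<longlonglongrightarrow> complex_of_real (exp (- q (fst w, snd w)))"
      by (intro AE_I2 LIMSEQ_Suc lim)
    show "AE w in lborel \<Otimes>\<^sub>M lborel. norm (G (Suc k) (fst w) (snd w)) \<le> H (fst w) (snd w)" for k
      by (intro AE_I2 GH) simp
    show "(\<lambda>w. complex_of_real (exp (- q (fst w, snd w)))) \<in> borel_measurable (lborel \<Otimes>\<^sub>M lborel)"
      by (rule borel_measurable_LIMSEQ_metric[OF Gm lim])
  qed (rule Gm)
  moreover have "(\<integral>w. G (Suc k) (fst w) (snd w) \<partial>(lborel \<Otimes>\<^sub>M lborel)) = real (Suc k) * (\<integral>w. exp (- real (Suc k) * F w) \<partial>torus_measure)" for k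
    unfolding scale[OF zero_less_Suc] using lborel_pair.integral_fst[of "G (Suc k)"] Gint[of "Suc k"] by (simp add: case_prod_beta')
  moreover have "(\<integral>w. complex_of_real (exp (- q (fst w, snd w))) \<partial>(lborel \<Otimes>\<^sub>M lborel)) = complex_of_real (2 * pi / sqrt covdet)"
  proof -
    have m: "(\<lambda>w. complex_of_real (exp (- q (fst w, snd w)))) \<in> borel_measurable (lborel \<Otimes>\<^sub>M lborel)"
      by (rule borel_measurable_LIMSEQ_metric[OF Gm lim])
    have "norm (complex_of_real (exp (- q (x, y)))) \<le> H x y" for x y
      by (rule LIMSEQ_le_const2[OF tendsto_norm[OF LIMSEQ_Suc[OF lim]]]) (auto intro: GH)
    then have "integrable (lborel \<Otimes>\<^sub>M lborel) (\<lambda>w. complex_of_real (exp (- q (fst w, snd w))))"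
      by (intro Bochner_Integration.integrable_bound[OF Hint m]) (auto intro!: AE_I2 intro: order_trans[OF _ abs_ge_self])
    then have "(\<integral>x. (\<integral>y. complex_of_real (exp (- q (x, y))) \<partial>lborel) \<partial>lborel) = (\<integral>w. complex_of_real (exp (- q (fst w, snd w))) \<partial>(lborel \<Otimes>\<^sub>M lborel))"
      using lborel_pair.integral_fst[of "\<lambda>x y. complex_of_real (exp (- q (x, y)))"] by (simp add: case_prod_beta')
    then show ?thesis unfolding exp_q_integral[symmetric] integral_complex_of_real by simp
  qed
  ultimately have "(\<lambda>k. complex_of_real (real (Suc k)) * (\<integral>w. exp (- real (Suc k) * F w) \<partial>torus_measure)) \<longlonglongrightarrow> complex_of_real (2 * pi / sqrt covdet)"
    by simp
  from tendsto_Re[OF this]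
  have "(\<lambda>k. real (Suc k) * Re (\<integral>w. exp (- real (Suc k) * F w) \<partial>torus_measure)) \<longlonglongrightarrow> 2 * pi / sqrt covdet"
    by simp
  from tendsto_mult[OF tendsto_const[of "1 / (2 * pi)\<^sup>2"] this]
  have "(\<lambda>k. real (Suc k) * Q (Suc k)) \<longlonglongrightarrow> 1 / (2 * pi)\<^sup>2 * (2 * pi / sqrt covdet)"
    by (simp add: Q_def mult_ac)
  also have "1 / (2 * pi)\<^sup>2 * (2 * pi / sqrt covdet) = 1 / (2 * pi * sqrt covdet)"
    by (simp add: power2_eq_square)
  finally show ?thesis by (rule LIMSEQ_imp_Suc[where f="\<lambda>k. real k * Q k"])
qed

end

context lattice_walk begin

text \<open>The step is centered, so the linear term can be subtracted for free, and |exp (i x) - 1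
  - i x| <= x^2 / 2.\<close>

lemma norm_F_le_q: "norm (F w) \<le> q w"
proof -
  let ?X = "\<lambda>\<omega>. dotp w (\<zeta> 0 \<omega>)"
  have pt: "norm (iexp x - 1 - \<i> * x) \<le> x\<^sup>2 / 2" for x :: real
    using iexp_approx1[of x 1] by (simp add: numeral_2_eq_2 diff_diff_eq)
  have iX: "integrable P (\<lambda>\<omega>. \<i> * complex_of_real (?X \<omega>))"
    by (intro integrable_mult_right integrable_of_real dotp_int)
  have "expectation (\<lambda>\<omega>. iexp (?X \<omega>) - 1 - \<i> * ?X \<omega>) = \<phi> w - 1 - \<i> * complex_of_real (expectation ?X)"
    using integrable_iexp_dotp[of w 0] iX by (simp add: \<phi>_def prob_space)
  then have E: "\<phi> w - 1 = expectation (\<lambda>\<omega>. iexp (?X \<omega>) - 1 - \<i> * ?X \<omega>)"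
    by (simp add: dotp_int(2))
  have "norm (F w) = norm (\<phi> w - 1)" by (simp add: F_def norm_minus_commute)
  also have "\<dots> = norm (expectation (\<lambda>\<omega>. iexp (?X \<omega>) - 1 - \<i> * ?X \<omega>))" unfolding E ..
  also have "\<dots> \<le> expectation (\<lambda>\<omega>. (?X \<omega>)\<^sup>2 / 2)"
  proof (rule order_trans[OF integral_norm_bound], rule integral_mono)
    show "integrable P (\<lambda>\<omega>. norm (iexp (?X \<omega>) - 1 - \<i> * ?X \<omega>))"
      by (rule integrable_norm, intro Bochner_Integration.integrable_diff integrable_iexp_dotp iX) simp
    show "integrable P (\<lambda>\<omega>. (?X \<omega>)\<^sup>2 / 2)" by (intro integrable_divide dotp_square_int)
  qed (rule pt)
  finally show ?thesis by (simp add: q_def)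
qed

lemma q_upper: "\<exists>A\<ge>0. \<forall>w. q w \<le> A * ((fst w)\<^sup>2 + (snd w)\<^sup>2)"
proof -
  let ?a = "cov_matrix P (\<zeta> 0) $ 1 $ 1" and ?b = "cov_matrix P (\<zeta> 0) $ 1 $ 2" and ?c = "cov_matrix P (\<zeta> 0) $ 2 $ 2"
  have "q w \<le> (\<bar>?a\<bar> + \<bar>?b\<bar> + \<bar>?c\<bar>) * ((fst w)\<^sup>2 + (snd w)\<^sup>2)" for w
  proof -
    have "2 * (fst w * snd w) * ?b \<le> \<bar>2 * (fst w * snd w)\<bar> * \<bar>?b\<bar>" by (simp add: abs_mult[symmetric])
    also have "\<dots> \<le> ((fst w)\<^sup>2 + (snd w)\<^sup>2) * \<bar>?b\<bar>"
    proof (rule mult_right_mono)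
      show "\<bar>2 * (fst w * snd w)\<bar> \<le> (fst w)\<^sup>2 + (snd w)\<^sup>2"
        using sum_squares_bound[of "\<bar>fst w\<bar>" "\<bar>snd w\<bar>"] by (simp add: abs_mult)
    qed simp
    finally have 1: "2 * (fst w * snd w) * ?b \<le> ((fst w)\<^sup>2 + (snd w)\<^sup>2) * \<bar>?b\<bar>" .
    have 2: "(fst w)\<^sup>2 * ?a \<le> ((fst w)\<^sup>2 + (snd w)\<^sup>2) * \<bar>?a\<bar>"
      by (rule order_trans[OF mult_left_mono[OF abs_ge_self] mult_right_mono]) auto
    have 3: "(snd w)\<^sup>2 * ?c \<le> ((fst w)\<^sup>2 + (snd w)\<^sup>2) * \<bar>?c\<bar>"
      by (rule order_trans[OF mult_left_mono[OF abs_ge_self] mult_right_mono]) auto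
    have "2 * q w \<le> ((fst w)\<^sup>2 + (snd w)\<^sup>2) * (\<bar>?a\<bar> + \<bar>?b\<bar> + \<bar>?c\<bar>)"
      unfolding q_eq distrib_left using 1 2 3 by linarith
    moreover have "0 \<le> ((fst w)\<^sup>2 + (snd w)\<^sup>2) * (\<bar>?a\<bar> + \<bar>?b\<bar> + \<bar>?c\<bar>)" by simp
    ultimately show ?thesis by (subst mult.commute) linarith
  qed
  then show ?thesis by (intro exI[of _ "\<bar>?a\<bar> + \<bar>?b\<bar> + \<bar>?c\<bar>"]) auto
qed

text \<open>The bound |F| <= q and the quadratic bounds on q and D give |F| = O(D). Hence the
  numerator of the difference is O(D^2), while the two denominators are at least D / 2 and D / 3 for
  every r < 1, and the powers of D cancel.\<close>

lemma resolvent_difference_bounded: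
  "\<exists>B. \<forall>w r. \<bar>fst w\<bar> \<le> pi \<longrightarrow> \<bar>snd w\<bar> \<le> pi \<longrightarrow> 0 \<le> r \<longrightarrow> r < 1 \<longrightarrow>
     norm (1 / (1 - complex_of_real r * \<phi> w) - 1 / (1 - complex_of_real r * exp (- F w))) \<le> B"
proof -
  obtain c where c: "c > 0" "\<And>w. \<bar>fst w\<bar> \<le> pi \<Longrightarrow> \<bar>snd w\<bar> \<le> pi \<Longrightarrow> c * ((fst w)\<^sup>2 + (snd w)\<^sup>2) \<le> D w"
    using D_lower by blast
  obtain A where A: "A \<ge> 0" "\<And>w. q w \<le> A * ((fst w)\<^sup>2 + (snd w)\<^sup>2)" using q_upper by blast
  \<comment> \<open>exp 2 (A / c)^2 comes from the numerator, 6 = 2 * 3 from the two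
    denominators.\<close>
  define B where "B = 6 * exp 2 * (A / c)\<^sup>2"
  have "norm (1 / (1 - complex_of_real r * \<phi> w) - 1 / (1 - complex_of_real r * exp (- F w))) \<le> B"
    if w: "\<bar>fst w\<bar> \<le> pi" "\<bar>snd w\<bar> \<le> pi" and r: "0 \<le> r" "r < 1" for w r
  proof -
    let ?E = "exp (- F w)" and ?d = "D w"
    have d: "0 \<le> ?d" "?d \<le> 2"
      using D_nonneg[of w] complex_Re_le_cmod[of "- \<phi> w"] norm_phi_le[of w] by (auto simp: D_def)
    have Fd: "norm (F w) \<le> A / c * ?d"
    proof -
      have "norm (F w) \<le> A * ((fst w)\<^sup>2 + (snd w)\<^sup>2)" using norm_F_le_q[of w] A(2)[of w] by linarith
      also have "\<dots> = A / c * (c * ((fst w)\<^sup>2 + (snd w)\<^sup>2))" using c(1) by simp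
      also have "\<dots> \<le> A / c * ?d" using c A(1) w by (intro mult_left_mono) auto
      finally show ?thesis .
    qed
    have num: "norm (\<phi> w - ?E) \<le> exp 2 * (A / c)\<^sup>2 * ?d\<^sup>2"
    proof -
      have "norm (exp (- F w) - (\<Sum>i\<le>1. (- F w) ^ i / fact i)) \<le> exp \<bar>Re (- F w)\<bar> * norm (- F w) ^ Suc 1 / fact 1"
        by (rule Taylor_exp)
      then have "norm (\<phi> w - ?E) \<le> exp ?d * (norm (F w))\<^sup>2"
        using d(1) by (simp add: F_def[symmetric] Re_F numeral_2_eq_2[symmetric] norm_minus_commute) (simp add: F_def norm_minus_commute)
      also have "\<dots> \<le> exp 2 * (A / c * ?d)\<^sup>2"
        using d Fd by (intro mult_mono power_mono) auto
      finally show ?thesis unfolding power_mult_distrib[of "A / c" ?d] mult.assoc .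
    qed
    have rp: "1 - r * Re (\<phi> w) \<ge> ?d / 2"
    proof (cases "Re (\<phi> w) \<ge> 0")
      case True
      then have "r * Re (\<phi> w) \<le> 1 * Re (\<phi> w)" using r by (intro mult_right_mono) auto
      then have "?d \<le> 1 - r * Re (\<phi> w)" by (simp add: D_def)
      then show ?thesis using d by linarith
    next
      case False
      then have "r * Re (\<phi> w) \<le> 0" using r by (simp add: mult_nonneg_nonpos)
      then show ?thesis using d by linarith
    qed
    have den1: "?d / 2 \<le> norm (1 - complex_of_real r * \<phi> w)"
      using rp complex_Re_le_cmod[of "1 - complex_of_real r * \<phi> w"] by simp
    \<comment> \<open>(1 - d / 3) (1 + d) >= 1 for 0 <= d <= 2, which yields exp (-d) <= 1 - d /
      3.\<close>
    have den2: "?d / 3 \<le> norm (1 - complex_of_real r * ?E)"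
    proof -
      have "exp (- ?d) * (1 + ?d) \<le> exp (- ?d) * exp ?d" by (intro mult_left_mono exp_ge_add_one_self) auto
      then have 1: "exp (- ?d) * (1 + ?d) \<le> 1" by (simp add: exp_add[symmetric])
      have "(1 - ?d / 3) * (1 + ?d) = 1 + ?d * (2 - ?d) / 3" by (simp add: field_simps)
      then have "1 \<le> (1 - ?d / 3) * (1 + ?d)" using d by simp
      with 1 have "exp (- ?d) * (1 + ?d) \<le> (1 - ?d / 3) * (1 + ?d)" by linarith
      then have "exp (- ?d) \<le> 1 - ?d / 3" using d by (simp add: mult_le_cancel_right)
      moreover have "r * exp (- ?d) \<le> 1 * exp (- ?d)" using r by (intro mult_right_mono) auto
      moreover have "1 - r * exp (- ?d) \<le> norm (1 - complex_of_real r * ?E)"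
        using norm_triangle_ineq2[of 1 "complex_of_real r * ?E"] r by (simp add: norm_mult norm_exp_eq_Re Re_F)
      ultimately show ?thesis by linarith
    qed
    show ?thesis
    proof (cases "?d = 0")
      case True
      then have "F w = 0" using Fd by simp
      then have "\<phi> w = ?E" by (simp add: F_def)
      moreover have "0 \<le> B" using A by (simp add: B_def)
      ultimately show ?thesis by simp
    next
      case False
      then have dp: "?d > 0" using d by simp
      have nz: "1 - complex_of_real r * \<phi> w \<noteq> 0" "1 - complex_of_real r * ?E \<noteq> 0" using den1 den2 dp by auto
      have "1 / (1 - complex_of_real r * \<phi> w) - 1 / (1 - complex_of_real r * ?E)
          = complex_of_real r * (\<phi> w - ?E) / ((1 - complex_of_real r * \<phi> w) * (1 - complex_of_real r * ?E))"
        using nz by (simp add: field_simps)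
      then have "norm (1 / (1 - complex_of_real r * \<phi> w) - 1 / (1 - complex_of_real r * ?E))
          = r * norm (\<phi> w - ?E) / (norm (1 - complex_of_real r * \<phi> w) * norm (1 - complex_of_real r * ?E))"
        using r by (simp add: norm_divide norm_mult)
      also have "\<dots> \<le> 1 * (exp 2 * (A / c)\<^sup>2 * ?d\<^sup>2) / ((?d / 2) * (?d / 3))"
        using num den1 den2 dp r by (intro frac_le mult_mono) auto
      also have "\<dots> = B" using dp by (simp add: B_def power2_eq_square)
      finally show ?thesis .
    qed
  qed
  then show ?thesis by blast
qed

definition p :: "nat \<Rightarrow> real" where "p k = (1 / (2 * pi)\<^sup>2) * Re (\<integral>w. \<phi> w ^ k \<partial>torus_measure)"

lemma prob_return_eq: "prob {\<omega>\<in>space P. inc a (a + k) \<omega> = 0} = p k"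
proof -
  have "complex_of_real (prob {\<omega>\<in>space P. inc a (a + k) \<omega> = 0}) = complex_of_real (1 / (2 * pi)\<^sup>2) * (\<integral>w. \<phi> w ^ k \<partial>torus_measure)"
    using fourier_inversion[of a k 0] by (simp add: dotp_0)
  from arg_cong[OF this, of Re] show ?thesis by (simp add: p_def)
qed

lemma exp_F_torus_measurable: "(\<lambda>w. exp (- real k * F w)) \<in> borel_measurable torus_measure"
  unfolding F_def by measurable

text \<open>For r < 1 the geometric series may be summed under the integral. Each of the two Abel
  sums alone diverges as r tends to 1, the walk being recurrent, so the resolvents are subtracted
  before integrating.\<close>

lemma abel_difference_bounded: "\<exists>K. \<forall>r. 0 \<le> r \<longrightarrow> r < 1 \<longrightarrow> \<bar>\<Sum>k. r ^ k * (p k - Q k)\<bar> \<le> K"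
proof -
  interpret T: finite_measure torus_measure by (rule finite_measure_torus)
  obtain B where B: "\<And>w r. \<bar>fst w\<bar> \<le> pi \<Longrightarrow> \<bar>snd w\<bar> \<le> pi \<Longrightarrow> 0 \<le> r \<Longrightarrow> r < 1 \<Longrightarrow>
     norm (1 / (1 - complex_of_real r * \<phi> w) - 1 / (1 - complex_of_real r * exp (- F w))) \<le> B"
    using resolvent_difference_bounded by blast
  let ?M = "measure torus_measure (space torus_measure)"
  have "\<bar>\<Sum>k. r ^ k * (p k - Q k)\<bar> \<le> (1 / (2 * pi)\<^sup>2) * (B * ?M)" if r: "0 \<le> r" "r < 1" for r
  proof -
    let ?E = "\<lambda>w. exp (- F w)"
    define a where "a k w = complex_of_real r ^ k * (\<phi> w ^ k - ?E w ^ k)" for k w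
    have EF: "exp (- real k * F w) = ?E w ^ k" for k w
      using exp_of_nat_mult[of k "- F w"] by simp
    have nE: "norm (?E w) \<le> 1" for w using norm_exp_F_le[of 1 w] by simp
    have ab: "norm (a k w) \<le> 2 * r ^ k" for k w
    proof -
      have "norm (\<phi> w ^ k - ?E w ^ k) \<le> norm (\<phi> w) ^ k + norm (?E w) ^ k"
        using norm_triangle_ineq4[of "\<phi> w ^ k" "?E w ^ k"] by (simp add: norm_power)
      also have "\<dots> \<le> 1 + 1" by (intro add_mono power_le_one norm_phi_le nE) auto
      finally have "norm (\<phi> w ^ k - ?E w ^ k) \<le> 2" by simp
      then have "r ^ k * norm (\<phi> w ^ k - ?E w ^ k) \<le> r ^ k * 2" using r by (intro mult_left_mono) auto
      then show ?thesis using r by (simp add: a_def norm_mult norm_power mult.commute)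
    qed
    have am: "a k \<in> borel_measurable torus_measure" for k
      unfolding a_def EF[symmetric]
      by (intro borel_measurable_times borel_measurable_diff phi_power_measurable exp_F_torus_measurable) simp
    have ai: "integrable torus_measure (a k)" for k
      by (rule T.integrable_const_bound[where B="2 * r ^ k"]) (auto intro: am ab)
    have ri: "integrable torus_measure (\<lambda>w. \<phi> w ^ k)" "integrable torus_measure (\<lambda>w. ?E w ^ k)" for k
      using T.integrable_const_bound[of "\<lambda>w. \<phi> w ^ k" 1] phi_power_measurable[of k]
        T.integrable_const_bound[of "\<lambda>w. ?E w ^ k" 1] exp_F_torus_measurable[of k] norm_phi_le nE unfolding EF
      by (auto simp: norm_power power_le_one)
    have gs: "summable (\<lambda>k. 2 * r ^ k)" using r by (intro summable_mult summable_geometric) auto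
    have terms: "r ^ k * (p k - Q k) = (1 / (2 * pi)\<^sup>2) * Re (\<integral>w. a k w \<partial>torus_measure)" for k
    proof -
      have "(\<integral>w. a k w \<partial>torus_measure) = complex_of_real (r ^ k) * ((\<integral>w. \<phi> w ^ k \<partial>torus_measure) - (\<integral>w. ?E w ^ k \<partial>torus_measure))"
        unfolding a_def integral_mult_right_zero by (simp add: ri)
      then have "Re (\<integral>w. a k w \<partial>torus_measure) = r ^ k * (Re (\<integral>w. \<phi> w ^ k \<partial>torus_measure) - Re (\<integral>w. ?E w ^ k \<partial>torus_measure))"
        by (simp only: Re_complex_of_real times_complex.sel Im_complex_of_real minus_complex.sel mult_zero_left diff_zero)
      then show ?thesis unfolding p_def Q_def EF by (simp add: right_diff_distrib diff_divide_distrib)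
    qed
    have s1: "AE w in torus_measure. summable (\<lambda>k. norm (a k w))"
      by (intro AE_I2 summable_comparison_test'[OF gs]) (use ab in auto)
    have s2: "summable (\<lambda>k. \<integral>w. norm (a k w) \<partial>torus_measure)"
    proof (rule summable_comparison_test')
      show "summable (\<lambda>k. 2 * r ^ k * ?M)" by (rule summable_mult2[OF gs])
      fix k
      have "(\<integral>w. norm (a k w) \<partial>torus_measure) \<le> (\<integral>w. 2 * r ^ k \<partial>torus_measure)"
        by (rule integral_mono) (use ai ab in auto)
      then show "norm (\<integral>w. norm (a k w) \<partial>torus_measure) \<le> 2 * r ^ k * ?M"
        by (simp add: mult.commute)
    qed
    have suma: "(\<Sum>k. a k w) = 1 / (1 - complex_of_real r * \<phi> w) - 1 / (1 - complex_of_real r * ?E w)" for w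
    proof -
      have geo: "(\<lambda>k. complex_of_real r ^ k * z ^ k) sums (1 / (1 - complex_of_real r * z))" if "norm z \<le> 1" for z
      proof -
        have "r * norm z \<le> r * 1" using that r by (intro mult_left_mono) auto
        then have "norm (complex_of_real r * z) < 1" using r by (simp add: norm_mult)
        from geometric_sums[OF this] show ?thesis by (simp add: power_mult_distrib)
      qed
      have "(\<lambda>k. a k w) sums (1 / (1 - complex_of_real r * \<phi> w) - 1 / (1 - complex_of_real r * ?E w))"
        unfolding a_def right_diff_distrib by (intro sums_diff geo norm_phi_le nE)
      then show ?thesis by (rule sums_unique[symmetric])
    qed
    have sums: "(\<lambda>k. \<integral>w. a k w \<partial>torus_measure) sums (\<integral>w. (\<Sum>k. a k w) \<partial>torus_measure)"
      by (rule sums_integral[OF ai s1 s2])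
    have "(\<Sum>k. r ^ k * (p k - Q k)) = (1 / (2 * pi)\<^sup>2) * Re (\<integral>w. (\<Sum>k. a k w) \<partial>torus_measure)"
      unfolding terms by (rule sums_unique[symmetric], rule sums_mult, rule sums_Re[OF sums])
    then have "\<bar>\<Sum>k. r ^ k * (p k - Q k)\<bar> = (1 / (2 * pi)\<^sup>2) * \<bar>Re (\<integral>w. (\<Sum>k. a k w) \<partial>torus_measure)\<bar>"
      by (simp add: abs_mult)
    also have "\<dots> \<le> (1 / (2 * pi)\<^sup>2) * (B * ?M)"
    proof (rule mult_left_mono)
      have "\<bar>Re (\<integral>w. (\<Sum>k. a k w) \<partial>torus_measure)\<bar> \<le> norm (\<integral>w. (\<Sum>k. a k w) \<partial>torus_measure)"
        by (rule abs_Re_le_cmod)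
      also have "\<dots> \<le> (\<integral>w. B \<partial>torus_measure)"
      proof (rule order_trans[OF integral_norm_bound], rule integral_mono)
        show "integrable torus_measure (\<lambda>w. norm (\<Sum>k. a k w))" by (intro integrable_norm integrable_suminf[OF ai s1 s2])
        show "norm (\<Sum>k. a k w) \<le> B" if "w \<in> space torus_measure" for w
          unfolding suma using that r by (intro B) (auto simp: space_pair_measure space_restrict_space)
      qed simp
      also have "\<dots> = B * ?M" by simp
      finally show "\<bar>Re (\<integral>w. (\<Sum>k. a k w) \<partial>torus_measure)\<bar> \<le> B * ?M" .
    qed simp
    finally show ?thesis .
  qed
  then show ?thesis by blast
qed

text \<open>By the Tauberian lemma the partial sums of p - Q are bounded, hence invisible after
  division by ln n; those of Q follow from its 1 / k asymptotics.\<close>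

lemma green_asymp: "(\<lambda>n. (\<Sum>k<n. p k) / ln (real n)) \<longlonglongrightarrow> 1 / (2 * pi * sqrt covdet)"
proof -
  obtain K where K: "\<And>a k l. prob {\<omega>\<in>space P. inc a (a + k) \<omega> = l} \<le> K / (real k + 1)"
    using local_bound_exists by blast
  have pK: "\<bar>p k\<bar> \<le> K / (real k + 1)" for k
    unfolding prob_return_eq[of 0 k, symmetric] using K[of 0 k 0] by simp
  have "\<exists>K'. \<forall>k. \<bar>Q k\<bar> \<le> K' / (real k + 1)"
  proof -
    have "Bseq (\<lambda>k. real k * Q k)" by (rule convergent_imp_Bseq, rule convergentI, rule Q_asymp)
    then obtain b where b: "\<And>k. norm (real k * Q k) \<le> b" by (auto simp: Bseq_def)
    \<comment> \<open>2 b serves k >= 1, and |Q 0| serves k = 0.\<close>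
    have "\<bar>Q k\<bar> \<le> (2 * b + \<bar>Q 0\<bar>) / (real k + 1)" for k
    proof (cases "k = 0")
      case True
      then show ?thesis using b[of 0] by simp
    next
      case False
      have "(real k + 1) * \<bar>Q k\<bar> \<le> (2 * real k) * \<bar>Q k\<bar>" using False by (intro mult_right_mono) auto
      also have "\<dots> \<le> 2 * b" using b[of k] by (simp add: abs_mult)
      finally show ?thesis by (simp add: pos_le_divide_eq mult.commute)
    qed
    then show ?thesis by blast
  qed
  then obtain K' where K': "\<And>k. \<bar>Q k\<bar> \<le> K' / (real k + 1)" by blast
  obtain K'' where K'': "\<And>r. 0 \<le> r \<Longrightarrow> r < 1 \<Longrightarrow> \<bar>\<Sum>k. r ^ k * (p k - Q k)\<bar> \<le> K''"
    using abel_difference_bounded by blast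
  have "\<bar>p k - Q k\<bar> \<le> (K + K') / (real k + 1)" for k
    using pK[of k] K'[of k] by (simp add: add_divide_distrib)
  from partial_sums_bounded_of_abel_bounded[OF this K'']
  have bd: "\<bar>\<Sum>k<n. p k - Q k\<bar> \<le> K'' + 2 * (K + K')" for n by blast
  have 0: "(\<lambda>n. (K'' + 2 * (K + K')) / ln (real n)) \<longlonglongrightarrow> 0"
    by (rule real_tendsto_divide_at_top[OF tendsto_const filterlim_compose[OF ln_at_top filterlim_real_sequentially]])
  have "(\<lambda>n. (\<Sum>k<n. p k - Q k) / ln (real n)) \<longlonglongrightarrow> 0"
    by (rule Lim_null_comparison[OF _ 0], use eventually_gt_at_top[of 1] in eventually_elim)
       (use bd in \<open>simp add: abs_divide divide_right_mono\<close>)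
  from tendsto_add[OF this sum_asymp_ln[OF Q_asymp]] show ?thesis
    by (simp add: sum_subtractf diff_divide_distrib)
qed

theorem AE_self_intersections:
  "AE \<omega> in P. normalised_self_intersections (\<lambda>i. \<Sum>m<i. \<zeta> m \<omega>) (1 / (pi * sqrt covdet))"
proof -
  obtain K where K: "\<And>a k l. prob {\<omega>\<in>space P. inc a (a + k) \<omega> = l} \<le> K / (real k + 1)"
    using local_bound_exists by blast
  \<comment> \<open>The strong law has the limit 2 * (1 / (2 pi sqrt covdet)), which is the constant
    claimed.\<close>
  interpret log_walk P \<zeta> K p "1 / (2 * pi * sqrt covdet)"
    by standard (use K prob_return_eq green_asymp covdet_pos in auto)
  show ?thesis using AE_normalised_self_intersections by (simp add: Z_def[abs_def])
qed

end

theorem theorem2p2: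
  fixes P :: "'w measure" and \<zeta> :: "nat \<Rightarrow> 'w \<Rightarrow> int ^ 2"
    and \<mu> :: "'e measure" and X :: "int ^ 2 \<Rightarrow> 'e \<Rightarrow> real"
  assumes P_prob: "prob_space P"
    and zeta_indep: "prob_space.indep_vars P (\<lambda>_. count_space UNIV) \<zeta> UNIV"
    and zeta_ident: "\<And>i. distr P (count_space UNIV) (\<zeta> i) = distr P (count_space UNIV) (\<zeta> 0)"
    and zeta_L2: "\<And>j. integrable P (\<lambda>\<omega>. (to_real2 (\<zeta> 0 \<omega>) $ j)\<^sup>2)"
    and zeta_mean: "\<And>j. prob_space.expectation P (\<lambda>\<omega>. to_real2 (\<zeta> 0 \<omega>) $ j) = 0"
    and zeta_nonsing: "det (cov_matrix P (\<zeta> 0)) \<noteq> 0"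
    and zeta_aperiodic: "gen_subgroup {l. measure P {\<omega> \<in> space P. \<zeta> 0 \<omega> = l} > 0} = UNIV"
    and mu_prob: "prob_space \<mu>"
    and X_indep: "prob_space.indep_vars \<mu> (\<lambda>_. borel) X UNIV"
    and X_ident: "\<And>l. distr \<mu> borel (X l) = distr \<mu> borel (X 0)"
    and X_L2: "integrable \<mu> (\<lambda>x. (X 0 x)\<^sup>2)"
    and X_mean: "prob_space.expectation \<mu> (X 0) = 0"
    and X_var: "prob_space.expectation \<mu> (\<lambda>x. (X 0 x)\<^sup>2) = 1"
  shows "AE \<omega> in P. satisfies_FCLT \<mu>
           (\<lambda>n x t. (\<Sum>i<nat \<lfloor>real n * t\<rfloor>. X (\<Sum>m<i. \<zeta> m \<omega>) x) / sqrt (real n * ln (real n)))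
           (sqrt (1 / (pi * sqrt (det (cov_matrix P (\<zeta> 0))))))"
proof -
  interpret P: prob_space P by (rule P_prob)
  interpret lattice_walk P \<zeta>
    by standard (use zeta_indep zeta_ident zeta_L2 zeta_mean zeta_aperiodic in auto)
  interpret S: prob_space \<mu> by (rule mu_prob)
  have meas[measurable]: "X l \<in> borel_measurable \<mu>" for l
    using X_indep by (auto simp: S.indep_vars_def)
  \<comment> \<open>Moments are given for \<open>X 0\<close> only; equality in law carries them to
    all sites.\<close>
  have int: "integrable \<mu> (\<lambda>x. h (X l x)) \<longleftrightarrow> integrable \<mu> (\<lambda>x. h (X 0 x))"
    and exp: "S.expectation (\<lambda>x. h (X l x)) = S.expectation (\<lambda>x. h (X 0 x))"
    if [measurable]: "h \<in> borel_measurable borel" for h :: "real \<Rightarrow> real" and l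
    using integrable_distr_eq[of "X l" \<mu> borel h] integrable_distr_eq[of "X 0" \<mu> borel h]
      integral_distr[of "X l" \<mu> borel h] integral_distr[of "X 0" \<mu> borel h] X_ident[of l] by simp_all
  interpret random_scenery \<mu> X
  proof
    show "integrable \<mu> (\<lambda>x. (X l x)\<^sup>2)" for l using int[of "\<lambda>y. y\<^sup>2" l] X_L2 by simp
    show "S.expectation (X l) = 0" for l using exp[of "\<lambda>y. y" l] X_mean by simp
    show "S.expectation (\<lambda>x. (X l x)\<^sup>2) = 1" for l using exp[of "\<lambda>y. y\<^sup>2" l] X_var by simp
    show "distr \<mu> borel (X l) = distr \<mu> borel (X l')" for l l' using X_ident[of l] X_ident[of l'] by simp
  qed (rule X_indep)
  have covdet: "covdet = det (cov_matrix P (\<zeta> 0))"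
    by (simp add: covdet_def det_2 cov_matrix_def power2_eq_square mult.commute)
  show ?thesis
    using AE_self_intersections
  proof eventually_elim
    case (elim \<omega>)
    \<comment> \<open>The trajectory is frozen here: what remains is a statement about the scenery
      along one fixed path.\<close>
    interpret quenched_scenery \<mu> X "\<lambda>i. \<Sum>m<i. \<zeta> m \<omega>" "1 / (pi * sqrt (det (cov_matrix P (\<zeta> 0))))"
      by (intro quenched_scenery.intro random_scenery_axioms elim[unfolded covdet])
    show ?case using functional_clt unfolding Y_def[abs_def] .
  qed
qed

end
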